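(* For every $n\ge1$, the action of $\mathfrak{S}_{n+1}$ on $\operatorname{Leib}(n)$ given by the anticyclic structure of $\operatorname{Leib}$ is isomorphic to the Lie module $\operatorname{Lie}(n+1)$.
   Context: All vector spaces are over $\mathbb{Q}$. The symmetric group $\mathfrak{S}_n$ acts on $\mathcal{P}(n)$ by $(\sigma\cdot E)(x_1,\dots,x_n)=E(x_{\sigma(1)},\dots,x_{\sigma(n)})$. An anticyclic operad is a symmetric operad $\mathcal{P}$ (unit $1\in\mathcal{P}(1)$, partial compositions $\circ_i$) together with an action of $\mathfrak{S}_{n+1}$ on each $\mathcal{P}(n)$ extending the action of $\mathfrak{S}_n$ (the stabilizer of $n+1$), such that, writing $\tau_n$ for the action of the long cycle $(n+1,n,\dots,2,1)$ ($1\mapsto n+1$, $i\mapsto i-1$ for $i\ge 2$): $\tau_1(1)=-1$ and, for $f\in\mathcal{P}(m)$, $g\in\mathcal{P}(n)$, $\tau(f\circ_i g)=\tau_m(f)\circ_{i-1}g$ for $2\le i\le m$ and $\tau(f\circ_1 g)=-\tau_n(g)\circ_n\tau_m(f)$. A morphism of anticyclic operads is a morphism of operads commuting with the actions of $\mathfrak{S}_{n+1}$. A non-symmetric anticyclic operad is a non-symmetric operad with endomorphisms $\tau_n$ of $\mathcal{P}(n)$ satisfying $\tau_n^{n+1}=\mathrm{Id}$ and these same identities. If $\mathcal{P}$ is a non-symmetric anticyclic operad, the symmetric operad with components $\mathcal{P}(n)\otimes\mathbb{Q}\mathfrak{S}_n\cong\operatorname{Ind}_{\mathbb{Z}/(n+1)\mathbb{Z}}^{\mathfrak{S}_{n+1}}\mathcal{P}(n)$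 is naturally an anticyclic operad, with $\tau_n(E\otimes 1)=\tau_n(E)\otimes 1$. The non-symmetric operad $\operatorname{Dias}$ is generated by binary operations $x\dashv y$, $x\vdash y$ with relations $x\dashv(y\vdash z)=x\dashv(y\dashv z)=(x\dashv y)\dashv z$, $x\vdash(y\dashv z)=(x\vdash y)\dashv z$, $x\vdash(y\vdash z)=(x\vdash y)\vdash z=(x\dashv y)\vdash z$. It is a non-symmetric anticyclic operad with the unique structure such that $\tau_1=-\mathrm{Id}$, $\tau_2(x_1\dashv x_2)=-x_1\vdash x_2$, $\tau_2(x_1\vdash x_2)=x_1\dashv x_2-x_1\vdash x_2$. We also write $\operatorname{Dias}$ for the associated (symmetric) anticyclic operad. $\operatorname{Leib}$ is the sub-operad of the symmetric operad $\operatorname{Dias}$ generated by $[x_1,x_2]=x_1\dashv x_2-x_2\vdash x_1$; it is presented by the binary product $[x,y]$ (no symmetry) with relation $[x,[y,z]]=[[x,y],z]-[[x,z],y]$. It carries the unique anticyclic operad structure for which the inclusion into $\operatorname{Dias}$ is a morphism of anticyclic operads. $\operatorname{Lie}(n+1)$ is the arity $n+1$ component of the Lie operad, i.e. the multilinear part of the free Lie algebra on $x_1,\dots,x_{n+1}$, with $\mathfrak{S}_{n+1}$ permuting the variables. *)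

theory Defs
  imports
    Complex_Main
    "HOL-Library.Poly_Mapping"
    "HOL-Combinatorics.Permutations"
    "HOL-Combinatorics.Multiset_Permutations"
begin

section \<open>Rational vector spaces\<close>

class scaleQ =
  fixes scaleQ :: "rat \<Rightarrow> 'a \<Rightarrow> 'a"  (infixr \<open>*\<^sub>Q\<close> 75)

class rat_vector = scaleQ + ab_group_add +
  assumes scaleQ_add_right: "a *\<^sub>Q (x + y) = a *\<^sub>Q x + a *\<^sub>Q y"
    and scaleQ_add_left: "(a + b) *\<^sub>Q x = a *\<^sub>Q x + b *\<^sub>Q x"
    and scaleQ_scaleQ: "a *\<^sub>Q b *\<^sub>Q x = (a * b) *\<^sub>Q x"
    and scaleQ_one: "1 *\<^sub>Q x = x"

global_interpretation rat_vector:
  vector_space "scaleQ :: rat \<Rightarrow> 'a \<Rightarrow> 'a::rat_vector"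
  by unfold_locales (rule scaleQ_add_right scaleQ_add_left scaleQ_scaleQ scaleQ_one)+

instantiation rat :: rat_vector
begin

definition scaleQ_rat :: "rat \<Rightarrow> rat \<Rightarrow> rat" where
  "scaleQ_rat = (*)"

instance
  by standard (simp_all add: scaleQ_rat_def algebra_simps)

end

instantiation poly_mapping :: (type, rat_vector) rat_vector
begin

lift_definition scaleQ_poly_mapping :: "rat \<Rightarrow> ('a \<Rightarrow>\<^sub>0 'b) \<Rightarrow> ('a \<Rightarrow>\<^sub>0 'b)" is
  "\<lambda>c p k. c *\<^sub>Q p k"
  by (erule rev_finite_subset) auto

instance
  by standard (transfer; simp add: fun_eq_iff scaleQ_add_right scaleQ_add_left
      scaleQ_scaleQ scaleQ_one)+

end

text \<open>
  Vector spaces are subspaces of an ambient type of class \<open>rat_vector\<close>; linear maps between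
  them are constrained only on their domain.
\<close>

definition linear_on :: "'a::rat_vector set \<Rightarrow> ('a \<Rightarrow> 'b::rat_vector) \<Rightarrow> bool" where
  "linear_on V f \<longleftrightarrow>
     (\<forall>x\<in>V. \<forall>y\<in>V. f (x + y) = f x + f y) \<and> (\<forall>c. \<forall>x\<in>V. f (c *\<^sub>Q x) = c *\<^sub>Q f x)"

section \<open>Representations of symmetric groups\<close>

text \<open>\<open>\<SS>\<^sub>k\<close> is the set of \<open>\<sigma>\<close> with \<open>\<sigma> permutes {1..k}\<close>; thus
  \<open>\<SS>\<^sub>k \<subseteq> \<SS>\<^sub>k\<^sub>+\<^sub>1\<close> is the stabilizer of \<open>k + 1\<close>.\<close>

definition sym_rep :: "nat \<Rightarrow> 'a::rat_vector set \<Rightarrow> ((nat \<Rightarrow> nat) \<Rightarrow> 'a \<Rightarrow> 'a) \<Rightarrow> bool" where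
  "sym_rep k V \<rho> \<longleftrightarrow>
     rat_vector.subspace V \<and>
     (\<forall>\<sigma>. \<sigma> permutes {1..k} \<longrightarrow> linear_on V (\<rho> \<sigma>) \<and> (\<forall>v\<in>V. \<rho> \<sigma> v \<in> V)) \<and>
     (\<forall>v\<in>V. \<rho> id v = v) \<and>
     (\<forall>\<sigma> \<pi>. \<sigma> permutes {1..k} \<longrightarrow> \<pi> permutes {1..k} \<longrightarrow>
        (\<forall>v\<in>V. \<rho> (\<sigma> \<circ> \<pi>) v = \<rho> \<sigma> (\<rho> \<pi> v)))"

definition sym_rep_isomorphic ::
    "nat \<Rightarrow> 'a::rat_vector set \<Rightarrow> ((nat \<Rightarrow> nat) \<Rightarrow> 'a \<Rightarrow> 'a) \<Rightarrow>
     'b::rat_vector set \<Rightarrow> ((nat \<Rightarrow> nat) \<Rightarrow> 'b \<Rightarrow> 'b) \<Rightarrow> bool" where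
  "sym_rep_isomorphic k V \<rho> W \<rho>' \<longleftrightarrow>
     sym_rep k V \<rho> \<and> sym_rep k W \<rho>' \<and>
     (\<exists>\<phi>. linear_on V \<phi> \<and> bij_betw \<phi> V W \<and>
        (\<forall>\<sigma>. \<sigma> permutes {1..k} \<longrightarrow> (\<forall>v\<in>V. \<phi> (\<rho> \<sigma> v) = \<rho>' \<sigma> (\<phi> v))))"

section \<open>Operads\<close>

text \<open>
  Operads have components in arities \<open>n \<ge> 1\<close>; the value of \<open>component\<close> at \<open>0\<close> is irrelevant.
  In \<open>pcomp i f g\<close> (the partial composition \<open>f \<circ>\<^sub>i g\<close>) inputs are numbered from \<open>1\<close>.
\<close>

record 'a ns_operad =
  component :: "nat \<Rightarrow> 'a set"
  unit :: 'a
  pcomp :: "nat \<Rightarrow> 'a \<Rightarrow> 'a \<Rightarrow> 'a"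

record 'a operad = "'a ns_operad" +
  act :: "nat \<Rightarrow> (nat \<Rightarrow> nat) \<Rightarrow> 'a \<Rightarrow> 'a"

definition is_ns_operad :: "('a::rat_vector, 'z) ns_operad_scheme \<Rightarrow> bool" where
  "is_ns_operad P \<longleftrightarrow>
     (\<forall>n\<ge>1. rat_vector.subspace (component P n)) \<and>
     unit P \<in> component P 1 \<and>
     (\<forall>m\<ge>1. \<forall>n\<ge>1. \<forall>i\<in>{1..m}. \<forall>f\<in>component P m. \<forall>g\<in>component P n.
        pcomp P i f g \<in> component P (m + n - 1)) \<and>
     (\<forall>m\<ge>1. \<forall>n\<ge>1. \<forall>i\<in>{1..m}.
        (\<forall>f\<in>component P m. linear_on (component P n) (\<lambda>g. pcomp P i f g)) \<and>
        (\<forall>g\<in>component P n. linear_on (component P m) (\<lambda>f. pcomp P i f g))) \<and>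
     (\<forall>n\<ge>1. \<forall>f\<in>component P n.
        pcomp P 1 (unit P) f = f \<and> (\<forall>i\<in>{1..n}. pcomp P i f (unit P) = f)) \<and>
     (\<forall>l\<ge>1. \<forall>m\<ge>1. \<forall>n\<ge>1. \<forall>f\<in>component P l. \<forall>g\<in>component P m. \<forall>h\<in>component P n.
        (\<forall>i\<in>{1..l}. \<forall>j\<in>{1..m}.
           pcomp P (i + j - 1) (pcomp P i f g) h = pcomp P i f (pcomp P j g h)) \<and>
        (\<forall>i k. 1 \<le> i \<and> i < k \<and> k \<le> l \<longrightarrow>
           pcomp P (k + m - 1) (pcomp P i f g) h = pcomp P i (pcomp P k f h) g))"

text \<open>
  With \<open>(\<sigma> \<cdot> E)(x\<^sub>1, \<dots>) = E(x\<^bsub>\<sigma>(1)\<^esub>, \<dots>)\<close> one has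
  \<open>(\<sigma> \<cdot> f) \<circ>\<^bsub>\<sigma>(j)\<^esub> (\<rho> \<cdot> g) = \<pi> \<cdot> (f \<circ>\<^sub>j g)\<close>, where \<open>\<pi>\<close> is the following permutation:
  \<open>\<pi>(p)\<close> is the index of the variable that the left hand side plugs into the \<open>p\<close>-th input of
  \<open>f \<circ>\<^sub>j g\<close>.
\<close>

definition block_perm ::
    "nat \<Rightarrow> nat \<Rightarrow> nat \<Rightarrow> (nat \<Rightarrow> nat) \<Rightarrow> (nat \<Rightarrow> nat) \<Rightarrow> nat \<Rightarrow> nat" where
  "block_perm m n j \<sigma> \<rho> p =
     (let shift = (\<lambda>a. if a < \<sigma> j then a else a + n - 1) in
      if p < 1 \<or> m + n - 1 < p then p
      else if p < j then shift (\<sigma> p)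
      else if p < j + n then \<sigma> j - 1 + \<rho> (p - j + 1)
      else shift (\<sigma> (p - n + 1)))"

definition is_operad :: "('a::rat_vector, 'z) operad_scheme \<Rightarrow> bool" where
  "is_operad P \<longleftrightarrow>
     is_ns_operad P \<and>
     (\<forall>n\<ge>1. sym_rep n (component P n) (act P n)) \<and>
     (\<forall>m\<ge>1. \<forall>n\<ge>1. \<forall>\<sigma> \<rho>. \<sigma> permutes {1..m} \<longrightarrow> \<rho> permutes {1..n} \<longrightarrow>
        (\<forall>j\<in>{1..m}. \<forall>f\<in>component P m. \<forall>g\<in>component P n.
           pcomp P (\<sigma> j) (act P m \<sigma> f) (act P n \<rho> g) =
           act P (m + n - 1) (block_perm m n j \<sigma> \<rho>) (pcomp P j f g)))"

definition operad_morphism ::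
    "('a::rat_vector, 'z) operad_scheme \<Rightarrow> ('b::rat_vector, 'w) operad_scheme \<Rightarrow>
     (nat \<Rightarrow> 'a \<Rightarrow> 'b) \<Rightarrow> bool" where
  "operad_morphism P Q \<phi> \<longleftrightarrow>
     (\<forall>n\<ge>1. linear_on (component P n) (\<phi> n) \<and>
        (\<forall>f\<in>component P n. \<phi> n f \<in> component Q n)) \<and>
     \<phi> 1 (unit P) = unit Q \<and>
     (\<forall>m\<ge>1. \<forall>n\<ge>1. \<forall>i\<in>{1..m}. \<forall>f\<in>component P m. \<forall>g\<in>component P n.
        \<phi> (m + n - 1) (pcomp P i f g) = pcomp Q i (\<phi> m f) (\<phi> n g)) \<and>
     (\<forall>n\<ge>1. \<forall>\<sigma>. \<sigma> permutes {1..n} \<longrightarrow>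
        (\<forall>f\<in>component P n. \<phi> n (act P n \<sigma> f) = act Q n \<sigma> (\<phi> n f)))"

text \<open>The suboperad generated by a family \<open>G\<close>, \<open>G n\<close> consisting of elements of arity \<open>n\<close>.\<close>

inductive_set generated :: "('a::rat_vector, 'z) operad_scheme \<Rightarrow> (nat \<Rightarrow> 'a set) \<Rightarrow> (nat \<times> 'a) set"
  for P :: "('a::rat_vector, 'z) operad_scheme" and G :: "nat \<Rightarrow> 'a set" where
  gen: "g \<in> G n \<Longrightarrow> (n, g) \<in> generated P G"
| zero: "(n, 0) \<in> generated P G"
| add: "(n, f) \<in> generated P G \<Longrightarrow> (n, g) \<in> generated P G \<Longrightarrow> (n, f + g) \<in> generated P G"
| scale: "(n, f) \<in> generated P G \<Longrightarrow> (n, c *\<^sub>Q f) \<in> generated P G"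
| unit: "(1, unit P) \<in> generated P G"
| pcomp: "(m, f) \<in> generated P G \<Longrightarrow> (n, g) \<in> generated P G \<Longrightarrow> 1 \<le> n \<Longrightarrow> 1 \<le> i \<Longrightarrow> i \<le> m \<Longrightarrow>
    (m + n - 1, pcomp P i f g) \<in> generated P G"
| act: "(n, f) \<in> generated P G \<Longrightarrow> \<sigma> permutes {1..n} \<Longrightarrow>
    (n, act P n \<sigma> f) \<in> generated P G"

definition generated_suboperad ::
    "'a::rat_vector operad \<Rightarrow> (nat \<Rightarrow> 'a set) \<Rightarrow> 'a operad" where
  "generated_suboperad P G = P\<lparr>component := \<lambda>n. {f. (n, f) \<in> generated P G}\<rparr>"

section \<open>Anticyclic operads\<close>

definition long_cycle :: "nat \<Rightarrow> nat \<Rightarrow> nat" where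
  "long_cycle n i = (if i = 1 then n + 1 else if 2 \<le> i \<and> i \<le> n + 1 then i - 1 else i)"

definition anticyclic_identities ::
    "('a::rat_vector, 'z) ns_operad_scheme \<Rightarrow> (nat \<Rightarrow> 'a \<Rightarrow> 'a) \<Rightarrow> bool" where
  "anticyclic_identities P \<tau> \<longleftrightarrow>
     \<tau> 1 (unit P) = - unit P \<and>
     (\<forall>m\<ge>1. \<forall>n\<ge>1. \<forall>f\<in>component P m. \<forall>g\<in>component P n.
        (\<forall>i\<in>{2..m}. \<tau> (m + n - 1) (pcomp P i f g) = pcomp P (i - 1) (\<tau> m f) g) \<and>
        \<tau> (m + n - 1) (pcomp P 1 f g) = - pcomp P n (\<tau> n g) (\<tau> m f))"

definition is_ns_anticyclic_operad ::
    "('a::rat_vector, 'z) ns_operad_scheme \<Rightarrow> (nat \<Rightarrow> 'a \<Rightarrow> 'a) \<Rightarrow> bool" where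
  "is_ns_anticyclic_operad P \<tau> \<longleftrightarrow>
     is_ns_operad P \<and>
     (\<forall>n\<ge>1. linear_on (component P n) (\<tau> n) \<and>
        (\<forall>f\<in>component P n. \<tau> n f \<in> component P n \<and> (\<tau> n ^^ (n + 1)) f = f)) \<and>
     anticyclic_identities P \<tau>"

definition is_anticyclic_operad ::
    "('a::rat_vector, 'z) operad_scheme \<Rightarrow> (nat \<Rightarrow> (nat \<Rightarrow> nat) \<Rightarrow> 'a \<Rightarrow> 'a) \<Rightarrow> bool" where
  "is_anticyclic_operad P \<alpha> \<longleftrightarrow>
     is_operad P \<and>
     (\<forall>n\<ge>1. sym_rep (n + 1) (component P n) (\<alpha> n)) \<and>
     (\<forall>n\<ge>1. \<forall>\<sigma>. \<sigma> permutes {1..n} \<longrightarrow> (\<forall>f\<in>component P n. \<alpha> n \<sigma> f = act P n \<sigma> f)) \<and>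
     anticyclic_identities P (\<lambda>n. \<alpha> n (long_cycle n))"

definition anticyclic_morphism ::
    "('a::rat_vector, 'z) operad_scheme \<Rightarrow> (nat \<Rightarrow> (nat \<Rightarrow> nat) \<Rightarrow> 'a \<Rightarrow> 'a) \<Rightarrow>
     ('b::rat_vector, 'w) operad_scheme \<Rightarrow> (nat \<Rightarrow> (nat \<Rightarrow> nat) \<Rightarrow> 'b \<Rightarrow> 'b) \<Rightarrow>
     (nat \<Rightarrow> 'a \<Rightarrow> 'b) \<Rightarrow> bool" where
  "anticyclic_morphism P \<alpha> Q \<beta> \<phi> \<longleftrightarrow>
     operad_morphism P Q \<phi> \<and>
     (\<forall>n\<ge>1. \<forall>\<sigma>. \<sigma> permutes {1..n + 1} \<longrightarrow>
        (\<forall>f\<in>component P n. \<phi> n (\<alpha> n \<sigma> f) = \<beta> n \<sigma> (\<phi> n f)))"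

section \<open>The symmetric operad of a non-symmetric operad\<close>

text \<open>
  \<open>P(n) \<otimes> \<rat>\<SS>\<^sub>n\<close> is realised by finitely supported functions from one-line notations
  \<open>[\<sigma>(1), \<dots>, \<sigma>(n)]\<close> to \<open>P(n)\<close>, and \<open>E \<otimes> \<sigma>\<close> is the operation
  \<open>E(x\<^bsub>\<sigma>(1)\<^esub>, \<dots>, x\<^bsub>\<sigma>(n)\<^esub>)\<close>, written \<open>Poly_Mapping.single [\<sigma>(1), \<dots>, \<sigma>(n)] E\<close>.
  Substituting \<open>F \<otimes> v\<close> for \<open>x\<^sub>i\<close> in \<open>E \<otimes> w\<close> composes at the position of the letter \<open>i\<close> in \<open>w\<close>.
\<close>

definition word_subst :: "nat \<Rightarrow> nat list \<Rightarrow> nat list \<Rightarrow> nat list" where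
  "word_subst i w v =
     concat (map (\<lambda>a. if a < i then [a]
                      else if a = i then map (\<lambda>b. b + i - 1) v
                      else [a + length v - 1]) w)"

definition word_position :: "nat \<Rightarrow> nat list \<Rightarrow> nat" where
  "word_position i w = length (takeWhile (\<lambda>a. a \<noteq> i) w) + 1"

definition symmetrization :: "'a::rat_vector ns_operad \<Rightarrow> (nat list \<Rightarrow>\<^sub>0 'a) operad" where
  "symmetrization P =
     \<lparr>component = \<lambda>n. {p. Poly_Mapping.keys p \<subseteq> permutations_of_set {1..n} \<and>
        (\<forall>w\<in>permutations_of_set {1..n}. Poly_Mapping.lookup p w \<in> component P n)},
      unit = Poly_Mapping.single [1] (unit P),
      pcomp = \<lambda>i p q. \<Sum>w\<in>Poly_Mapping.keys p. \<Sum>v\<in>Poly_Mapping.keys q.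
        Poly_Mapping.single (word_subst i w v)
          (pcomp P (word_position i w) (Poly_Mapping.lookup p w) (Poly_Mapping.lookup q v)),
      act = \<lambda>n \<sigma> p. \<Sum>w\<in>Poly_Mapping.keys p.
        Poly_Mapping.single (map \<sigma> w) (Poly_Mapping.lookup p w)\<rparr>"

text \<open>
  The anticyclic structure on the symmetrization induced by \<open>\<tau>\<close>. As \<open>\<SS>\<^sub>n\<close> and the long cycle
  generate \<open>\<SS>\<^sub>n\<^sub>+\<^sub>1\<close>, the choice is unique on the components; \<open>[1..<n + 1]\<close> is the identity.
\<close>

definition symmetrization_anticyclic ::
    "'a::rat_vector ns_operad \<Rightarrow> (nat \<Rightarrow> 'a \<Rightarrow> 'a) \<Rightarrow>
     nat \<Rightarrow> (nat \<Rightarrow> nat) \<Rightarrow> (nat list \<Rightarrow>\<^sub>0 'a) \<Rightarrow> (nat list \<Rightarrow>\<^sub>0 'a)" where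
  "symmetrization_anticyclic P \<tau> =
     (SOME \<alpha>. is_anticyclic_operad (symmetrization P) \<alpha> \<and>
        (\<forall>n\<ge>1. \<forall>E\<in>component P n.
           \<alpha> n (long_cycle n) (Poly_Mapping.single [1..<n + 1] E) =
           Poly_Mapping.single [1..<n + 1] (\<tau> n E)))"

section \<open>The non-symmetric operad Dias\<close>

text \<open>
  The free non-symmetric operad on two binary generators has as basis of its arity \<open>n\<close>
  component the planar binary trees with \<open>n\<close> leaves and inner nodes labelled \<open>\<stileturn>\<close> or \<open>\<turnstile>\<close>.
\<close>

datatype dtree = Leaf | Dashv dtree dtree | Vdash dtree dtree

primrec leaves :: "dtree \<Rightarrow> nat" where
  "leaves Leaf = 1"
| "leaves (Dashv a b) = leaves a + leaves b"
| "leaves (Vdash a b) = leaves a + leaves b"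

text \<open>\<open>graft t i s\<close> replaces the \<open>i\<close>-th leaf of \<open>t\<close> by \<open>s\<close>, for \<open>1 \<le> i \<le> leaves t\<close>.\<close>

primrec graft :: "dtree \<Rightarrow> nat \<Rightarrow> dtree \<Rightarrow> dtree" where
  "graft Leaf i s = s"
| "graft (Dashv a b) i s =
     (if i \<le> leaves a then Dashv (graft a i s) b else Dashv a (graft b (i - leaves a) s))"
| "graft (Vdash a b) i s =
     (if i \<le> leaves a then Vdash (graft a i s) b else Vdash a (graft b (i - leaves a) s))"

text \<open>
  The type \<^typ>\<open>dtree \<Rightarrow>\<^sub>0 rat\<close> is the direct sum of all components; \<open>\<circ>\<^sub>i\<close> vanishes on those of
  arity less than \<open>i\<close> in the first argument.
\<close>

definition free_pcomp :: "nat \<Rightarrow> (dtree \<Rightarrow>\<^sub>0 rat) \<Rightarrow> (dtree \<Rightarrow>\<^sub>0 rat) \<Rightarrow> (dtree \<Rightarrow>\<^sub>0 rat)" where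
  "free_pcomp i p q =
     (\<Sum>t\<in>Poly_Mapping.keys p. \<Sum>s\<in>Poly_Mapping.keys q.
        if 1 \<le> i \<and> i \<le> leaves t
        then Poly_Mapping.single (graft t i s) (Poly_Mapping.lookup p t * Poly_Mapping.lookup q s)
        else 0)"

abbreviation tree_vec :: "dtree \<Rightarrow> (dtree \<Rightarrow>\<^sub>0 rat)" where
  "tree_vec t \<equiv> Poly_Mapping.single t 1"

definition dias_relations :: "(dtree \<times> dtree) set" where
  "dias_relations =
     {(Dashv Leaf (Vdash Leaf Leaf), Dashv Leaf (Dashv Leaf Leaf)),
      (Dashv Leaf (Dashv Leaf Leaf), Dashv (Dashv Leaf Leaf) Leaf),
      (Vdash Leaf (Dashv Leaf Leaf), Dashv (Vdash Leaf Leaf) Leaf),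
      (Vdash Leaf (Vdash Leaf Leaf), Vdash (Vdash Leaf Leaf) Leaf),
      (Vdash (Vdash Leaf Leaf) Leaf, Vdash (Dashv Leaf Leaf) Leaf)}"

inductive_set dias_ideal :: "(dtree \<Rightarrow>\<^sub>0 rat) set" where
  rel: "(s, t) \<in> dias_relations \<Longrightarrow> tree_vec s - tree_vec t \<in> dias_ideal"
| zero: "0 \<in> dias_ideal"
| add: "p \<in> dias_ideal \<Longrightarrow> q \<in> dias_ideal \<Longrightarrow> p + q \<in> dias_ideal"
| scale: "p \<in> dias_ideal \<Longrightarrow> c *\<^sub>Q p \<in> dias_ideal"
| pcomp_left: "p \<in> dias_ideal \<Longrightarrow> free_pcomp i p q \<in> dias_ideal"
| pcomp_right: "q \<in> dias_ideal \<Longrightarrow> free_pcomp i p q \<in> dias_ideal"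

lemma subspace_congruence:
  fixes I :: "'a::rat_vector set"
  assumes zero: "0 \<in> I"
    and add: "\<And>p q. p \<in> I \<Longrightarrow> q \<in> I \<Longrightarrow> p + q \<in> I"
    and scale: "\<And>c p. p \<in> I \<Longrightarrow> c *\<^sub>Q p \<in> I"
  shows uminus_in: "\<And>p. p \<in> I \<Longrightarrow> - p \<in> I"
    and equivp_diff_in: "equivp (\<lambda>p q. p - q \<in> I)"
proof -
  show neg: "- p \<in> I" if "p \<in> I" for p
    using scale[OF that, of "- 1"] by simp
  show "equivp (\<lambda>p q. p - q \<in> I)"
  proof (rule equivpI)
    show "reflp (\<lambda>p q. p - q \<in> I)" by (simp add: reflp_def zero)
    show "symp (\<lambda>p q. p - q \<in> I)" using neg by (force simp: symp_def)
    show "transp (\<lambda>p q. p - q \<in> I)" using add by (force simp: transp_def)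
  qed
qed

lemmas dias_ideal_uminus =
  uminus_in[OF dias_ideal.zero dias_ideal.add dias_ideal.scale]

lemma sum_keys_superset:
  assumes "finite A" "Poly_Mapping.keys p \<subseteq> A" "\<And>k. F k 0 = (0::'c::comm_monoid_add)"
  shows "(\<Sum>k\<in>Poly_Mapping.keys p. F k (Poly_Mapping.lookup p k)) =
    (\<Sum>k\<in>A. F k (Poly_Mapping.lookup p k))"
  using assms by (intro sum.mono_neutral_left) (auto simp: in_keys_iff)

lemma free_pcomp_superset:
  assumes "finite A" "finite B" "Poly_Mapping.keys p \<subseteq> A" "Poly_Mapping.keys q \<subseteq> B"
  shows "free_pcomp i p q =
     (\<Sum>t\<in>A. \<Sum>s\<in>B. if 1 \<le> i \<and> i \<le> leaves t
        then Poly_Mapping.single (graft t i s) (Poly_Mapping.lookup p t * Poly_Mapping.lookup q s)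
        else 0)"
proof -
  have inner: "(\<Sum>s\<in>Poly_Mapping.keys q. if 1 \<le> i \<and> i \<le> leaves t
        then Poly_Mapping.single (graft t i s) (x * Poly_Mapping.lookup q s) else 0) =
      (\<Sum>s\<in>B. if 1 \<le> i \<and> i \<le> leaves t
        then Poly_Mapping.single (graft t i s) (x * Poly_Mapping.lookup q s) else 0)" for t x
    by (rule sum_keys_superset[where F = "\<lambda>s y. if 1 \<le> i \<and> i \<le> leaves t
          then Poly_Mapping.single (graft t i s) (x * y) else 0"]) (use assms in auto)
  show ?thesis
    unfolding free_pcomp_def inner
    by (rule sum_keys_superset[where F = "\<lambda>t x. \<Sum>s\<in>B. if 1 \<le> i \<and> i \<le> leaves t
          then Poly_Mapping.single (graft t i s) (x * Poly_Mapping.lookup q s) else 0"])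
      (use assms in \<open>auto intro!: sum.neutral\<close>)
qed

lemma free_pcomp_diff_left: "free_pcomp i (p - p') q = free_pcomp i p q - free_pcomp i p' q"
proof -
  let ?A = "Poly_Mapping.keys p \<union> Poly_Mapping.keys p'"
  have "Poly_Mapping.keys (p - p') \<subseteq> ?A"
    by (auto simp: in_keys_iff lookup_minus)
  then show ?thesis
    by (subst (1 2 3) free_pcomp_superset[where A = ?A and B = "Poly_Mapping.keys q"])
      (auto simp: lookup_minus algebra_simps single_diff sum_subtractf[symmetric]
        intro!: sum.cong)
qed

lemma free_pcomp_diff_right: "free_pcomp i p (q - q') = free_pcomp i p q - free_pcomp i p q'"
proof -
  let ?B = "Poly_Mapping.keys q \<union> Poly_Mapping.keys q'"
  have "Poly_Mapping.keys (q - q') \<subseteq> ?B"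
    by (auto simp: in_keys_iff lookup_minus)
  then show ?thesis
    by (subst (1 2 3) free_pcomp_superset[where A = "Poly_Mapping.keys p" and B = ?B])
      (auto simp: lookup_minus algebra_simps single_diff sum_subtractf[symmetric]
        intro!: sum.cong)
qed

text \<open>The direct sum of the components of Dias.\<close>

quotient_type dias = "dtree \<Rightarrow>\<^sub>0 rat" / "\<lambda>p q. p - q \<in> dias_ideal"
  by (rule equivp_diff_in) (auto intro: dias_ideal.intros)

instantiation dias :: rat_vector
begin

lift_definition zero_dias :: dias is 0 .

lift_definition plus_dias :: "dias \<Rightarrow> dias \<Rightarrow> dias" is "(+)"
  using dias_ideal.add by (fastforce simp: algebra_simps)

lift_definition uminus_dias :: "dias \<Rightarrow> dias" is uminus
  using dias_ideal_uminus by fastforce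

lift_definition minus_dias :: "dias \<Rightarrow> dias \<Rightarrow> dias" is "(-)"
  using dias_ideal.add[OF _ dias_ideal_uminus] by (fastforce simp: algebra_simps)

lift_definition scaleQ_dias :: "rat \<Rightarrow> dias \<Rightarrow> dias" is scaleQ
  by (metis dias_ideal.scale rat_vector.scale_right_diff_distrib)

instance
  by standard
    (transfer; simp add: algebra_simps scaleQ_add_right scaleQ_add_left scaleQ_scaleQ
      scaleQ_one dias_ideal.zero)+

end

lift_definition dias_pcomp :: "nat \<Rightarrow> dias \<Rightarrow> dias \<Rightarrow> dias" is free_pcomp
proof -
  fix i p p' q q'
  assume "p - p' \<in> dias_ideal" "q - q' \<in> dias_ideal"
  then have "free_pcomp i (p - p') q + free_pcomp i p' (q - q') \<in> dias_ideal"
    by (intro dias_ideal.intros)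
  then show "free_pcomp i p q - free_pcomp i p' q' \<in> dias_ideal"
    by (simp add: free_pcomp_diff_left free_pcomp_diff_right)
qed

lift_definition dias_tree :: "dtree \<Rightarrow> dias" is tree_vec .

definition Dias :: "dias ns_operad" where
  "Dias = \<lparr>component = \<lambda>n. rat_vector.span (dias_tree ` {t. leaves t = n}),
           unit = dias_tree Leaf, pcomp = dias_pcomp\<rparr>"

abbreviation dias_dashv :: dias where "dias_dashv \<equiv> dias_tree (Dashv Leaf Leaf)"
abbreviation dias_vdash :: dias where "dias_vdash \<equiv> dias_tree (Vdash Leaf Leaf)"

text \<open>Unique on the components, since Dias is generated by its arity 2 component.\<close>

definition dias_tau :: "nat \<Rightarrow> dias \<Rightarrow> dias" where
  "dias_tau = (SOME \<tau>. is_ns_anticyclic_operad Dias \<tau> \<and>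
     (\<forall>E\<in>component Dias 1. \<tau> 1 E = - E) \<and>
     \<tau> 2 dias_dashv = - dias_vdash \<and>
     \<tau> 2 dias_vdash = dias_dashv - dias_vdash)"

abbreviation SymDias :: "(nat list \<Rightarrow>\<^sub>0 dias) operad" where
  "SymDias \<equiv> symmetrization Dias"

definition SymDias_action ::
    "nat \<Rightarrow> (nat \<Rightarrow> nat) \<Rightarrow> (nat list \<Rightarrow>\<^sub>0 dias) \<Rightarrow> (nat list \<Rightarrow>\<^sub>0 dias)" where
  "SymDias_action = symmetrization_anticyclic Dias dias_tau"

section \<open>The operad Leib\<close>

definition leib_bracket :: "nat list \<Rightarrow>\<^sub>0 dias" where
  "leib_bracket =
     Poly_Mapping.single [1, 2] dias_dashv - Poly_Mapping.single [2, 1] dias_vdash"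

definition Leib :: "(nat list \<Rightarrow>\<^sub>0 dias) operad" where
  "Leib = generated_suboperad SymDias (\<lambda>n. if n = 2 then {leib_bracket} else {})"

text \<open>Unique on the components, the inclusion being injective.\<close>

definition Leib_action ::
    "nat \<Rightarrow> (nat \<Rightarrow> nat) \<Rightarrow> (nat list \<Rightarrow>\<^sub>0 dias) \<Rightarrow> (nat list \<Rightarrow>\<^sub>0 dias)" where
  "Leib_action = (SOME \<alpha>. is_anticyclic_operad Leib \<alpha> \<and>
     anticyclic_morphism Leib \<alpha> SymDias SymDias_action (\<lambda>n f. f))"

section \<open>The Lie modules\<close>

text \<open>
  The free Lie algebra on \<open>x\<^sub>0, x\<^sub>1, \<dots>\<close> is the free nonassociative algebra, with basis the
  bracket monomials, modulo the two-sided ideal generated by \<open>[p, p]\<close> and the Jacobi identity.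
\<close>

datatype lie_monomial = Var nat | Bracket lie_monomial lie_monomial

primrec variables :: "lie_monomial \<Rightarrow> nat list" where
  "variables (Var i) = [i]"
| "variables (Bracket a b) = variables a @ variables b"

primrec rename :: "(nat \<Rightarrow> nat) \<Rightarrow> lie_monomial \<Rightarrow> lie_monomial" where
  "rename \<sigma> (Var i) = Var (\<sigma> i)"
| "rename \<sigma> (Bracket a b) = Bracket (rename \<sigma> a) (rename \<sigma> b)"

definition free_bracket ::
    "(lie_monomial \<Rightarrow>\<^sub>0 rat) \<Rightarrow> (lie_monomial \<Rightarrow>\<^sub>0 rat) \<Rightarrow> (lie_monomial \<Rightarrow>\<^sub>0 rat)" where
  "free_bracket p q =
     (\<Sum>a\<in>Poly_Mapping.keys p. \<Sum>b\<in>Poly_Mapping.keys q.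
        Poly_Mapping.single (Bracket a b) (Poly_Mapping.lookup p a * Poly_Mapping.lookup q b))"

definition free_rename :: "(nat \<Rightarrow> nat) \<Rightarrow> (lie_monomial \<Rightarrow>\<^sub>0 rat) \<Rightarrow> (lie_monomial \<Rightarrow>\<^sub>0 rat)" where
  "free_rename \<sigma> p =
     (\<Sum>a\<in>Poly_Mapping.keys p. Poly_Mapping.single (rename \<sigma> a) (Poly_Mapping.lookup p a))"

inductive_set lie_ideal :: "(lie_monomial \<Rightarrow>\<^sub>0 rat) set" where
  alternating: "free_bracket p p \<in> lie_ideal"
| jacobi: "free_bracket p (free_bracket q r) + free_bracket q (free_bracket r p) +
     free_bracket r (free_bracket p q) \<in> lie_ideal"
| zero: "0 \<in> lie_ideal"
| add: "p \<in> lie_ideal \<Longrightarrow> q \<in> lie_ideal \<Longrightarrow> p + q \<in> lie_ideal"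
| scale: "p \<in> lie_ideal \<Longrightarrow> c *\<^sub>Q p \<in> lie_ideal"
| bracket_left: "p \<in> lie_ideal \<Longrightarrow> free_bracket p q \<in> lie_ideal"
| bracket_right: "q \<in> lie_ideal \<Longrightarrow> free_bracket p q \<in> lie_ideal"

lemmas lie_ideal_uminus =
  uminus_in[OF lie_ideal.zero lie_ideal.add lie_ideal.scale]

lemma free_bracket_superset:
  assumes "finite A" "finite B" "Poly_Mapping.keys p \<subseteq> A" "Poly_Mapping.keys q \<subseteq> B"
  shows "free_bracket p q =
     (\<Sum>a\<in>A. \<Sum>b\<in>B.
        Poly_Mapping.single (Bracket a b) (Poly_Mapping.lookup p a * Poly_Mapping.lookup q b))"
proof -
  have inner: "(\<Sum>b\<in>Poly_Mapping.keys q.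
        Poly_Mapping.single (Bracket a b) (x * Poly_Mapping.lookup q b)) =
      (\<Sum>b\<in>B. Poly_Mapping.single (Bracket a b) (x * Poly_Mapping.lookup q b))" for a x
    by (rule sum_keys_superset[where F = "\<lambda>b y. Poly_Mapping.single (Bracket a b) (x * y)"])
      (use assms in auto)
  show ?thesis
    unfolding free_bracket_def inner
    by (rule sum_keys_superset[where F = "\<lambda>a x. \<Sum>b\<in>B.
          Poly_Mapping.single (Bracket a b) (x * Poly_Mapping.lookup q b)"])
      (use assms in auto)
qed

lemma free_rename_superset:
  assumes "finite A" "Poly_Mapping.keys p \<subseteq> A"
  shows "free_rename \<sigma> p =
     (\<Sum>a\<in>A. Poly_Mapping.single (rename \<sigma> a) (Poly_Mapping.lookup p a))"
  unfolding free_rename_def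
  by (rule sum_keys_superset[where F = "\<lambda>a x. Poly_Mapping.single (rename \<sigma> a) x"])
    (use assms in auto)

lemma free_rename_add: "free_rename \<sigma> (p + q) = free_rename \<sigma> p + free_rename \<sigma> q"
proof -
  let ?A = "Poly_Mapping.keys p \<union> Poly_Mapping.keys q"
  have "Poly_Mapping.keys (p + q) \<subseteq> ?A"
    by (rule keys_add)
  then show ?thesis
    by (subst (1 2 3) free_rename_superset[where A = ?A])
      (auto simp: lookup_add single_add sum.distrib)
qed

lemma free_rename_scale: "free_rename \<sigma> (c *\<^sub>Q p) = c *\<^sub>Q free_rename \<sigma> p"
proof -
  have keys: "Poly_Mapping.keys (c *\<^sub>Q p) \<subseteq> Poly_Mapping.keys p"
    by (auto simp: in_keys_iff scaleQ_poly_mapping.rep_eq)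
  have single: "Poly_Mapping.single k (c *\<^sub>Q x) = c *\<^sub>Q Poly_Mapping.single k x"
    for k :: lie_monomial and x :: rat
    by (rule poly_mapping_eqI) (simp add: lookup_single scaleQ_poly_mapping.rep_eq when_def)
  show ?thesis
    using keys
    by (subst (1 2) free_rename_superset[where A = "Poly_Mapping.keys p"])
      (auto simp: scaleQ_poly_mapping.rep_eq single rat_vector.scale_sum_right)
qed

lemma free_rename_sum: "free_rename \<sigma> (sum f A) = (\<Sum>a\<in>A. free_rename \<sigma> (f a))"
  by (induction A rule: infinite_finite_induct)
    (simp_all add: free_rename_add, simp_all add: free_rename_def)

lemma free_rename_diff: "free_rename \<sigma> (p - q) = free_rename \<sigma> p - free_rename \<sigma> q"
  using free_rename_add[of \<sigma> "p - q" q] by (simp add: algebra_simps)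

lemma free_rename_single:
  "free_rename \<sigma> (Poly_Mapping.single a x) = Poly_Mapping.single (rename \<sigma> a) x"
  by (simp add: free_rename_def)

lemma free_bracket_sum_left: "free_bracket (sum f A) q = (\<Sum>a\<in>A. free_bracket (f a) q)"
proof -
  have add: "free_bracket (p + p') q = free_bracket p q + free_bracket p' q" for p p'
  proof -
    let ?A = "Poly_Mapping.keys p \<union> Poly_Mapping.keys p'"
    have "Poly_Mapping.keys (p + p') \<subseteq> ?A"
      by (rule keys_add)
    then show ?thesis
      by (subst (1 2 3) free_bracket_superset[where A = ?A and B = "Poly_Mapping.keys q"])
        (auto simp: lookup_add algebra_simps single_add sum.distrib)
  qed
  show ?thesis
    by (induction A rule: infinite_finite_induct)
      (simp_all add: add, simp_all add: free_bracket_def)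
qed

lemma free_bracket_sum_right: "free_bracket q (sum f A) = (\<Sum>a\<in>A. free_bracket q (f a))"
proof -
  have add: "free_bracket q (p + p') = free_bracket q p + free_bracket q p'" for p p'
  proof -
    let ?A = "Poly_Mapping.keys p \<union> Poly_Mapping.keys p'"
    have "Poly_Mapping.keys (p + p') \<subseteq> ?A"
      by (rule keys_add)
    then show ?thesis
      by (subst (1 2 3) free_bracket_superset[where B = ?A and A = "Poly_Mapping.keys q"])
        (auto simp: lookup_add algebra_simps single_add sum.distrib)
  qed
  show ?thesis
    by (induction A rule: infinite_finite_induct)
      (simp_all add: add, simp_all add: free_bracket_def)
qed

lemma free_bracket_single:
  "free_bracket (Poly_Mapping.single a x) (Poly_Mapping.single b y) =
   Poly_Mapping.single (Bracket a b) (x * y)"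
  by (simp add: free_bracket_def)

lemma free_rename_bracket:
  "free_rename \<sigma> (free_bracket p q) = free_bracket (free_rename \<sigma> p) (free_rename \<sigma> q)"
proof -
  have "free_rename \<sigma> (free_bracket p q) =
      (\<Sum>a\<in>Poly_Mapping.keys p. \<Sum>b\<in>Poly_Mapping.keys q.
         Poly_Mapping.single (Bracket (rename \<sigma> a) (rename \<sigma> b))
           (Poly_Mapping.lookup p a * Poly_Mapping.lookup q b))"
    by (simp add: free_bracket_def free_rename_sum free_rename_single)
  also have "\<dots> = free_bracket (free_rename \<sigma> p) (free_rename \<sigma> q)"
    unfolding free_rename_def free_bracket_sum_left
    by (simp only: free_bracket_sum_right free_bracket_single)
  finally show ?thesis .
qed

lemma free_rename_ideal: "p \<in> lie_ideal \<Longrightarrow> free_rename \<sigma> p \<in> lie_ideal"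
proof (induction rule: lie_ideal.induct)
  case zero
  then show ?case by (simp add: free_rename_def lie_ideal.zero)
qed (simp_all add: free_rename_add free_rename_scale free_rename_bracket lie_ideal.intros)

quotient_type free_lie = "lie_monomial \<Rightarrow>\<^sub>0 rat" / "\<lambda>p q. p - q \<in> lie_ideal"
  by (rule equivp_diff_in) (auto intro: lie_ideal.intros)

instantiation free_lie :: rat_vector
begin

lift_definition zero_free_lie :: free_lie is 0 .

lift_definition plus_free_lie :: "free_lie \<Rightarrow> free_lie \<Rightarrow> free_lie" is "(+)"
  using lie_ideal.add by (fastforce simp: algebra_simps)

lift_definition uminus_free_lie :: "free_lie \<Rightarrow> free_lie" is uminus
  using lie_ideal_uminus by fastforce

lift_definition minus_free_lie :: "free_lie \<Rightarrow> free_lie \<Rightarrow> free_lie" is "(-)"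
  using lie_ideal.add[OF _ lie_ideal_uminus] by (fastforce simp: algebra_simps)

lift_definition scaleQ_free_lie :: "rat \<Rightarrow> free_lie \<Rightarrow> free_lie" is scaleQ
  by (metis lie_ideal.scale rat_vector.scale_right_diff_distrib)

instance
  by standard
    (transfer; simp add: algebra_simps scaleQ_add_right scaleQ_add_left scaleQ_scaleQ
      scaleQ_one lie_ideal.zero)+

end

lift_definition lie_vec :: "lie_monomial \<Rightarrow> free_lie" is "\<lambda>a. Poly_Mapping.single a 1" .

lift_definition Lie_action :: "(nat \<Rightarrow> nat) \<Rightarrow> free_lie \<Rightarrow> free_lie" is free_rename
  by (metis free_rename_diff free_rename_ideal)

text \<open>The part of the free Lie algebra that is multilinear in \<open>x\<^sub>1, \<dots>, x\<^sub>k\<close>.\<close>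

definition Lie :: "nat \<Rightarrow> free_lie set" where
  "Lie k = rat_vector.span (lie_vec ` {a. variables a \<in> permutations_of_set {1..k}})"

end

theory Submission
  imports Defs
begin

text \<open>
  Let \<open>e\<^sub>k\<close> be the word \<open>x\<^sub>1 \<dots> x\<^sub>n\<close> pointed at its \<open>k\<close>-th letter; these words form a basis of Dias. Write
  \<open>e\<^sub>k = f\<^sub>k - f\<^sub>0\<close> with \<open>f\<^sub>0, \<dots>, f\<^sub>n\<close> the standard basis of \<open>\<rat>\<^bsup>n+1\<^esup>\<close>. Then \<open>\<tau>\<close> is the cyclic shift
  \<open>f\<^sub>k \<mapsto> f\<^sub>k\<^sub>-\<^sub>1\<close>. Therefore the symmetric operad Dias in arity \<open>n\<close> consists of cyclic words in the letters
  \<open>1, \<dots>, n + 1\<close> carrying a difference \<open>f\<^sub>a - f\<^sub>b\<close> of two marks, and the symmetric group on \<open>n + 1\<close>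
  letters acts by relabelling (\<open>marked\<close>, \<open>cyclic_act\<close>). The actions in question are given only by
  characteristic properties. That relabelling has these properties is checked on marked words
  (\<open>is_anticyclic_operad_cyclic_act\<close>), and that they determine the action is shown in
  \<open>dias_tau_eq_rotate\<close>, \<open>SymDias_action_eq\<close> and \<open>Leib_action_eq\<close>.

  The bracket \<open>x \<stileturn> y - y \<turnstile> x\<close> is a commutator with a mark on \<open>x\<close>. So Leib in arity \<open>n\<close> is spanned by
  multilinear Lie monomials \<open>L\<close> in \<open>1, \<dots>, n\<close> with one marked letter (\<open>component_Leib\<close>), in other words
  by the differences \<open>T\<^sub>a - T\<^bsub>n+1\<^esub>\<close>, where \<open>T = tr(L x\<^bsub>n+1\<^esub>)\<close> is a combination of cyclic words and the index
  denotes the mark. The identity \<open>tr([x, y] z) = tr(x [y, z])\<close> rewrites \<open>T\<close> as \<open>tr(x\<^sub>a B\<^sub>a)\<close>, with a Lie monomial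
  \<open>B\<^sub>a\<close> in the other letters, for every letter \<open>a\<close> (\<open>reroot_trace\<close>). Consequently the span of the elements
  \<open>T\<^sub>a - T\<^sub>b\<close> is stable under relabelling all \<open>n + 1\<close> letters (\<open>cyclic_act_Leib\<close>).

  The isomorphism sends \<open>T\<^sub>a - T\<^sub>b\<close> to \<open>[x\<^sub>a, B\<^sub>a] - [x\<^sub>b, B\<^sub>b]\<close>. It is well defined and equivariant because it
  is given on words, by \<open>a u \<mapsto> a u - u a\<close> for a cyclic word opened at its mark (\<open>comparison\<close>). It is
  injective since an explicit left inverse exists (\<open>unroot_comparison\<close>). Its values are expansions of Lie
  elements by the choice of \<open>B\<^sub>a\<close> (\<open>comparison_in_assoc_Lie\<close>). It is surjective because
  \<open>\<Sum>\<^sub>b [x\<^sub>b, B\<^sub>b] = 0\<close>, a telescoping sum over each cyclic word, so that \<open>\<Sum>\<^sub>b (T\<^sub>a - T\<^sub>b)\<close> has the image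
  \<open>(n + 1) [x\<^sub>a, B\<^sub>a]\<close> (\<open>Lie_in_comparison\<close>). Finally, expansion is injective on the multilinear Lie elements,
  which are spanned by left-normed brackets starting with \<open>x\<^bsub>n+1\<^esub>\<close> (\<open>retract_assoc\<close>).
\<close>

section \<open>Linear maps and linear extension\<close>

abbreviation "single \<equiv> Poly_Mapping.single"
abbreviation "keys \<equiv> Poly_Mapping.keys"
abbreviation "lookup \<equiv> Poly_Mapping.lookup"

abbreviation qlinear :: "('a::rat_vector \<Rightarrow> 'b::rat_vector) \<Rightarrow> bool" where
  "qlinear \<equiv> linear_on UNIV"

lemma qlinear_add: "qlinear f \<Longrightarrow> f (x + y) = f x + f y"
  and qlinear_scale: "qlinear f \<Longrightarrow> f (c *\<^sub>Q x) = c *\<^sub>Q f x"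
  by (auto simp: linear_on_def)

lemma qlinear_zero: "qlinear f \<Longrightarrow> f 0 = 0"
  using qlinear_scale[of f 0 0] by simp

lemma qlinear_uminus: "qlinear f \<Longrightarrow> f (- x) = - f x"
  using qlinear_scale[of f "- 1" x] by simp

lemma qlinear_diff: "qlinear f \<Longrightarrow> f (x - y) = f x - f y"
  using qlinear_add[of f "x - y" y] by (simp add: algebra_simps)

lemma qlinear_sum: "qlinear f \<Longrightarrow> f (sum g A) = (\<Sum>a\<in>A. f (g a))"
  by (induction A rule: infinite_finite_induct) (auto simp: qlinear_zero qlinear_add)

lemma linear_on_subset: "linear_on W f \<Longrightarrow> V \<subseteq> W \<Longrightarrow> linear_on V f"
  unfolding linear_on_def by blast

lemma qlinear_imp_linear_on: "qlinear f \<Longrightarrow> linear_on V f"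
  by (rule linear_on_subset) auto

lemma qlinear_eq_on_span:
  assumes "qlinear F" "qlinear G" "x \<in> rat_vector.span B" "\<And>b. b \<in> B \<Longrightarrow> F b = G b"
  shows "F x = G x"
  using assms(3)
  by (induction rule: rat_vector.span_induct_alt)
    (simp_all add: assms qlinear_zero qlinear_add qlinear_scale)

lemma bilinear_eq_on_span:
  assumes "f \<in> rat_vector.span A" "g \<in> rat_vector.span B"
    "\<And>g. qlinear (\<lambda>f. F f g)" "\<And>f. qlinear (F f)"
    "\<And>g. qlinear (\<lambda>f. G f g)" "\<And>f. qlinear (G f)"
    "\<And>a b. a \<in> A \<Longrightarrow> b \<in> B \<Longrightarrow> F a b = G a b"
  shows "F f g = G f g"
proof -
  have "F a g = G a g" if "a \<in> A" for a
    by (rule qlinear_eq_on_span[OF assms(4)[of a] assms(6)[of a] assms(2)])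
      (rule assms(7)[OF that])
  then show ?thesis
    by (rule qlinear_eq_on_span[OF assms(3)[of g] assms(5)[of g] assms(1)])
qed

lemma trilinear_eq_on_span:
  assumes "f \<in> rat_vector.span A" "g \<in> rat_vector.span B" "h \<in> rat_vector.span C"
    "\<And>g h. qlinear (\<lambda>f. F f g h)" "\<And>f h. qlinear (\<lambda>g. F f g h)" "\<And>f g. qlinear (F f g)"
    "\<And>g h. qlinear (\<lambda>f. G f g h)" "\<And>f h. qlinear (\<lambda>g. G f g h)" "\<And>f g. qlinear (G f g)"
    "\<And>a b c. a \<in> A \<Longrightarrow> b \<in> B \<Longrightarrow> c \<in> C \<Longrightarrow> F a b c = G a b c"
  shows "F f g h = G f g h"
proof -
  have "F a g h = G a g h" if "a \<in> A" for a
    using assms(2,3) by (rule bilinear_eq_on_span) (use assms(5,6,8-10) that in blast)+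
  then show ?thesis
    by (rule qlinear_eq_on_span[OF assms(4)[of g h] assms(7)[of g h] assms(1)])
qed

lemma qlinear_span_image:
  assumes "qlinear F" "\<And>b. b \<in> B \<Longrightarrow> F b \<in> V" "rat_vector.subspace V" "x \<in> rat_vector.span B"
  shows "F x \<in> V"
  using assms(4)
  by (induction rule: rat_vector.span_induct_alt)
    (use assms in \<open>simp_all add: qlinear_zero qlinear_add qlinear_scale rat_vector.subspace_0
        rat_vector.subspace_add rat_vector.subspace_scale\<close>)

lemma single_scaleQ: "single k (c *\<^sub>Q x) = c *\<^sub>Q single k x"
  by (rule poly_mapping_eqI) (simp add: lookup_single scaleQ_poly_mapping.rep_eq when_def)

lemma lookup_scaleQ: "lookup (c *\<^sub>Q p) k = c *\<^sub>Q lookup p k"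
  by (simp add: scaleQ_poly_mapping.rep_eq)

lemma poly_mapping_expansion:
  "p = (\<Sum>k\<in>keys p. single k (lookup p k))"
  by (rule poly_mapping_eqI)
    (simp add: lookup_sum lookup_single when_def in_keys_iff)

text \<open>
  The linear map out of a space of finitely supported functions with prescribed values on
  the basis.
\<close>

definition ext :: "('k \<Rightarrow> 'b::rat_vector) \<Rightarrow> ('k \<Rightarrow>\<^sub>0 rat) \<Rightarrow> 'b" where
  "ext F p = (\<Sum>k\<in>keys p. lookup p k *\<^sub>Q F k)"

lemma ext_superset:
  assumes "finite A" "keys p \<subseteq> A"
  shows "ext F p = (\<Sum>k\<in>A. lookup p k *\<^sub>Q F k)"
  unfolding ext_def using assms by (rule sum_keys_superset[where F = "\<lambda>k x. x *\<^sub>Q F k"]) simp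

lemma qlinear_ext: "qlinear (ext F)"
proof -
  have "ext F (p + q) = ext F p + ext F q" for p q
    using keys_add[of p q]
    by (subst (1 2 3) ext_superset[where A = "keys p \<union> keys q"])
      (auto simp: lookup_add scaleQ_add_left sum.distrib)
  moreover have "ext F (c *\<^sub>Q p) = c *\<^sub>Q ext F p" for c p
    by (subst (1 2) ext_superset[where A = "keys p"])
      (auto simp: lookup_scaleQ scaleQ_scaleQ scaleQ_rat_def in_keys_iff
        rat_vector.scale_sum_right)
  ultimately show ?thesis
    by (simp add: linear_on_def)
qed

lemmas ext_add = qlinear_add[OF qlinear_ext]
  and ext_scale = qlinear_scale[OF qlinear_ext]
  and ext_zero = qlinear_zero[OF qlinear_ext]
  and ext_diff = qlinear_diff[OF qlinear_ext]

lemma ext_single: "ext F (single k c) = c *\<^sub>Q F k"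
  by (simp add: ext_def)

lemma ext_cong: "(\<And>k. k \<in> keys p \<Longrightarrow> F k = G k) \<Longrightarrow> ext F p = ext G p"
  by (simp add: ext_def)

lemma qlinear_ext_comp: "qlinear G \<Longrightarrow> G (ext F p) = ext (\<lambda>k. G (F k)) p"
  by (simp add: ext_def qlinear_sum qlinear_scale)

lemma ext_fun_add: "ext (\<lambda>k. F k + G k) p = ext F p + ext G p"
  by (simp add: ext_def scaleQ_add_right sum.distrib)

lemma ext_fun_scale: "ext (\<lambda>k. c *\<^sub>Q F k) p = c *\<^sub>Q ext F p"
  by (simp add: ext_def scaleQ_scaleQ rat_vector.scale_sum_right mult.commute)

lemma ext_fun_diff: "ext (\<lambda>k. F k - G k) p = ext F p - ext G p"
  by (simp add: ext_def rat_vector.scale_right_diff_distrib sum_subtractf)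

lemma ext_fun_sum: "ext (\<lambda>k. \<Sum>a\<in>A. F a k) p = (\<Sum>a\<in>A. ext (F a) p)"
  by (simp add: ext_def rat_vector.scale_sum_right sum.swap[of _ A])

lemma ext_self: "ext (\<lambda>k. single k 1) p = p"
  by (subst (2) poly_mapping_expansion[of p])
    (simp add: ext_def single_scaleQ[symmetric] scaleQ_rat_def)

lemma qlinear_eq_ext:
  assumes "qlinear F"
  shows "F p = ext (\<lambda>k. F (single k 1)) p"
  using qlinear_ext_comp[OF assms, of "\<lambda>k. single k 1" p] by (simp add: ext_self)

section \<open>The diassociative operad\<close>

text \<open>
  A diassociative monomial is a word with one pointed letter: \<open>\<stileturn>\<close> keeps the pointed letter of its
  left factor and \<open>\<turnstile>\<close> that of its right factor. The function follows these choices down to a leaf.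
\<close>

primrec mark :: "dtree \<Rightarrow> nat" where
  "mark Leaf = 1"
| "mark (Dashv a b) = mark a"
| "mark (Vdash a b) = leaves a + mark b"

text \<open>
  Where the mark at \<open>a\<close> ends up when a block of \<open>n\<close> letters marked at \<open>b\<close> replaces \<open>i\<close>. The same
  renumbering governs leaves of trees, places in words and letters of words, and this is why one
  function serves for all compositions below.
\<close>

definition insert_mark :: "nat \<Rightarrow> nat \<Rightarrow> nat \<Rightarrow> nat \<Rightarrow> nat" where
  "insert_mark i n a b = (if a < i then a else if a = i then b + i - 1 else a + n - 1)"

lemma mark_bounds: "1 \<le> mark t \<and> mark t \<le> leaves t"
  by (induction t) auto

lemma leaves_pos: "1 \<le> leaves t"
  by (induction t) auto

lemma leaves_graft:
  "1 \<le> i \<Longrightarrow> i \<le> leaves t \<Longrightarrow> leaves (graft t i s) = leaves t + leaves s - 1"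
proof (induction t arbitrary: i)
  case (Dashv a b)
  then show ?case using leaves_pos[of a] leaves_pos[of b] leaves_pos[of s] by auto
next
  case (Vdash a b)
  then show ?case using leaves_pos[of a] leaves_pos[of b] leaves_pos[of s] by auto
qed auto

lemma mark_graft:
  "1 \<le> i \<Longrightarrow> i \<le> leaves t \<Longrightarrow> mark (graft t i s) = insert_mark i (leaves s) (mark t) (mark s)"
proof (induction t arbitrary: i)
  case (Dashv a b)
  then show ?case using mark_bounds[of a] mark_bounds[of b] mark_bounds[of s]
    by (auto simp: insert_mark_def)
next
  case (Vdash a b)
  show ?case
  proof (cases "i \<le> leaves a")
    case True
    with Vdash show ?thesis using mark_bounds[of a] mark_bounds[of b] mark_bounds[of s]
      by (auto simp: insert_mark_def leaves_graft)
  next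
    case False
    then have "mark (graft b (i - leaves a) s) =
        insert_mark (i - leaves a) (leaves s) (mark b) (mark s)"
      using Vdash by auto
    with False show ?thesis
      using mark_bounds[of a] mark_bounds[of b] mark_bounds[of s]
      by (auto simp: insert_mark_def)
  qed
qed (auto simp: insert_mark_def)

lemma free_pcomp_ext:
  "free_pcomp i p q =
     ext (\<lambda>t. ext (\<lambda>s. if 1 \<le> i \<and> i \<le> leaves t then tree_vec (graft t i s) else 0) q) p"
  by (simp add: free_pcomp_def ext_def rat_vector.scale_sum_right scaleQ_scaleQ if_distrib
      single_scaleQ[symmetric] scaleQ_rat_def cong: if_cong)

text \<open>
  Number of leaves and pointed leaf of each tree. Both behave well under grafting, so that this
  linear map vanishes on the ideal of relations and separates the classes of trees.
\<close>

definition free_coord :: "(dtree \<Rightarrow>\<^sub>0 rat) \<Rightarrow> (nat \<times> nat \<Rightarrow>\<^sub>0 rat)" where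
  "free_coord = ext (\<lambda>t. single (leaves t, mark t) 1)"

text \<open>
  The right hand side depends on \<open>p\<close> and \<open>q\<close> only through their coordinates. Hence the kernel of the
  coordinates is closed under composition with arbitrary elements, as an operadic ideal is.
\<close>

lemma free_coord_pcomp:
  "free_coord (free_pcomp i p q) =
     ext (\<lambda>(m, a). ext (\<lambda>(n, b). if 1 \<le> i \<and> i \<le> m
       then single (m + n - 1, insert_mark i n a b) 1 else 0) (free_coord q))
       (free_coord p)"
proof -
  have "free_coord (if 1 \<le> i \<and> i \<le> leaves t then tree_vec (graft t i s) else 0) =
      (if 1 \<le> i \<and> i \<le> leaves t
       then single (leaves t + leaves s - 1,
         insert_mark i (leaves s) (mark t) (mark s)) 1 else 0)" for s t
    by (simp add: free_coord_def ext_single ext_zero leaves_graft mark_graft scaleQ_one)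
  then show ?thesis
    by (simp add: free_pcomp_ext free_coord_def qlinear_ext_comp[OF qlinear_ext] ext_single
        scaleQ_one)
qed

lemma free_coord_ideal: "p \<in> dias_ideal \<Longrightarrow> free_coord p = 0"
proof (induction rule: dias_ideal.induct)
  case (rel s t)
  then show ?case
    by (auto simp: dias_relations_def free_coord_def ext_diff ext_single)
next
  case (pcomp_left p i q)
  then show ?case by (simp add: free_coord_pcomp ext_zero)
next
  case (pcomp_right q i p)
  then show ?case by (simp add: free_coord_pcomp ext_zero case_prod_unfold)
    (simp add: ext_def)
qed (simp_all add: free_coord_def ext_zero ext_add ext_scale)

lift_definition dias_coord :: "dias \<Rightarrow> (nat \<times> nat \<Rightarrow>\<^sub>0 rat)" is free_coord
proof -
  fix p q :: "dtree \<Rightarrow>\<^sub>0 rat"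
  assume "p - q \<in> dias_ideal"
  then have "free_coord (p - q) = 0" by (rule free_coord_ideal)
  then show "free_coord p = free_coord q" by (simp add: free_coord_def ext_diff)
qed

lemma qlinear_dias_coord: "qlinear dias_coord"
proof -
  have "dias_coord (x + y) = dias_coord x + dias_coord y" for x y
    by transfer (simp add: free_coord_def ext_add)
  moreover have "dias_coord (c *\<^sub>Q x) = c *\<^sub>Q dias_coord x" for c x
    by transfer (simp add: free_coord_def ext_scale)
  ultimately show ?thesis by (simp add: linear_on_def)
qed

lemma dias_coord_tree: "dias_coord (dias_tree t) = single (leaves t, mark t) 1"
  by transfer (simp add: free_coord_def ext_single scaleQ_one)

lemma qlinear_pcomp_left: "qlinear (\<lambda>f. dias_pcomp i f g)"
proof -
  have "dias_pcomp i (x + y) g = dias_pcomp i x g + dias_pcomp i y g" for x y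
    by transfer (simp add: free_pcomp_ext ext_add dias_ideal.zero)
  moreover have "dias_pcomp i (c *\<^sub>Q x) g = c *\<^sub>Q dias_pcomp i x g" for c x
    by transfer (simp add: free_pcomp_ext ext_scale dias_ideal.zero)
  ultimately show ?thesis by (simp add: linear_on_def)
qed

lemma qlinear_pcomp_right: "qlinear (\<lambda>g. dias_pcomp i f g)"
proof -
  have "dias_pcomp i f (x + y) = dias_pcomp i f x + dias_pcomp i f y" for x y
    by transfer (simp add: free_pcomp_ext ext_add ext_fun_add dias_ideal.zero)
  moreover have "dias_pcomp i f (c *\<^sub>Q x) = c *\<^sub>Q dias_pcomp i f x" for c x
    by transfer (simp add: free_pcomp_ext ext_scale ext_fun_scale dias_ideal.zero)
  ultimately show ?thesis by (simp add: linear_on_def)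
qed

lemmas dias_pcomp_linear =
  qlinear_add[OF qlinear_pcomp_left] qlinear_add[OF qlinear_pcomp_right]
  qlinear_diff[OF qlinear_pcomp_left] qlinear_diff[OF qlinear_pcomp_right]
  qlinear_uminus[OF qlinear_pcomp_left] qlinear_uminus[OF qlinear_pcomp_right]
  qlinear_scale[OF qlinear_pcomp_left] qlinear_scale[OF qlinear_pcomp_right]
  qlinear_zero[OF qlinear_pcomp_left] qlinear_zero[OF qlinear_pcomp_right]

lemma dias_pcomp_tree:
  "dias_pcomp i (dias_tree t) (dias_tree s) =
     (if 1 \<le> i \<and> i \<le> leaves t then dias_tree (graft t i s) else 0)"
  by transfer (auto simp: free_pcomp_ext ext_single scaleQ_one dias_ideal.zero)

lemma dias_tree_Dashv_cong:
  assumes "dias_tree a = dias_tree a'"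
  shows "dias_tree (Dashv a b) = dias_tree (Dashv a' b)"
  using dias_pcomp_tree[of 1 "Dashv Leaf b" a] dias_pcomp_tree[of 1 "Dashv Leaf b" a'] assms
  by simp

lemma dias_tree_Vdash_cong:
  assumes "dias_tree b = dias_tree b'"
  shows "dias_tree (Vdash a b) = dias_tree (Vdash a b')"
  using dias_pcomp_tree[of "leaves a + 1" "Vdash a Leaf" b]
    dias_pcomp_tree[of "leaves a + 1" "Vdash a Leaf" b'] assms
  by simp

text \<open>
  Three trees may be grafted on the leaves of a relation because the ideal is closed under
  composition; the last leaf is treated first so that the numbers of the other leaves stay valid.
\<close>

lemma dias_tree_relation:
  assumes "(s, t) \<in> dias_relations"
  shows "dias_tree (graft (graft (graft s 3 c) 2 b) 1 a) =
    dias_tree (graft (graft (graft t 3 c) 2 b) 1 a)"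
proof -
  have "dias_tree s = dias_tree t"
    using dias_ideal.rel[OF assms] by (simp add: dias_tree.abs_eq dias.abs_eq_iff)
  moreover have "leaves s = 3" "leaves t = 3"
    using assms by (auto simp: dias_relations_def)
  moreover have "dias_tree (graft (graft (graft u 3 c) 2 b) 1 a) =
      dias_pcomp 1 (dias_pcomp 2 (dias_pcomp 3 (dias_tree u) (dias_tree c)) (dias_tree b))
        (dias_tree a)" if "leaves u = 3" for u
    using that leaves_pos[of b] leaves_pos[of c] by (simp add: dias_pcomp_tree leaves_graft)
  ultimately show ?thesis by simp
qed

lemma dias_tree_axioms:
  "dias_tree (Dashv a (Vdash b c)) = dias_tree (Dashv (Dashv a b) c)"
  "dias_tree (Dashv a (Dashv b c)) = dias_tree (Dashv (Dashv a b) c)"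
  "dias_tree (Dashv (Vdash a b) c) = dias_tree (Vdash a (Dashv b c))"
  "dias_tree (Vdash (Vdash a b) c) = dias_tree (Vdash a (Vdash b c))"
  "dias_tree (Vdash (Dashv a b) c) = dias_tree (Vdash a (Vdash b c))"
proof -
  note R = dias_tree_relation[of _ _ c b a]
  show 2: "dias_tree (Dashv a (Dashv b c)) = dias_tree (Dashv (Dashv a b) c)"
    using R[of "Dashv Leaf (Dashv Leaf Leaf)" "Dashv (Dashv Leaf Leaf) Leaf"]
      leaves_pos[of a] leaves_pos[of b]
    by (simp add: dias_relations_def)
  show "dias_tree (Dashv a (Vdash b c)) = dias_tree (Dashv (Dashv a b) c)"
    using R[of "Dashv Leaf (Vdash Leaf Leaf)" "Dashv Leaf (Dashv Leaf Leaf)"] 2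
    by (simp add: dias_relations_def)
  show "dias_tree (Dashv (Vdash a b) c) = dias_tree (Vdash a (Dashv b c))"
    using R[of "Vdash Leaf (Dashv Leaf Leaf)" "Dashv (Vdash Leaf Leaf) Leaf"]
    by (simp add: dias_relations_def)
  show 4: "dias_tree (Vdash (Vdash a b) c) = dias_tree (Vdash a (Vdash b c))"
    using R[of "Vdash Leaf (Vdash Leaf Leaf)" "Vdash (Vdash Leaf Leaf) Leaf"]
    by (simp add: dias_relations_def)
  show "dias_tree (Vdash (Dashv a b) c) = dias_tree (Vdash a (Vdash b c))"
    using R[of "Vdash (Vdash Leaf Leaf) Leaf" "Vdash (Dashv Leaf Leaf) Leaf"] 4
    by (simp add: dias_relations_def)
qed

abbreviation append_leaves :: "nat \<Rightarrow> dtree \<Rightarrow> dtree" where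
  "append_leaves n \<equiv> (\<lambda>t. Dashv t Leaf) ^^ n"

abbreviation prepend_leaves :: "nat \<Rightarrow> dtree \<Rightarrow> dtree" where
  "prepend_leaves n \<equiv> Vdash Leaf ^^ n"

lemma append_leaves_cong:
  "dias_tree s = dias_tree t \<Longrightarrow> dias_tree (append_leaves n s) = dias_tree (append_leaves n t)"
  by (induction n) (auto intro: dias_tree_Dashv_cong)

lemma prepend_leaves_cong:
  "dias_tree s = dias_tree t \<Longrightarrow> dias_tree (prepend_leaves n s) = dias_tree (prepend_leaves n t)"
  by (induction n) (auto intro: dias_tree_Vdash_cong)

text \<open>
  What stands on the unpointed side of \<open>\<stileturn>\<close> matters only through its number of leaves: the relations
  dissolve its brackets and forget its labels.
\<close>

lemma dias_tree_Dashv: "dias_tree (Dashv s t) = dias_tree (append_leaves (leaves t) s)"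
proof (induction t arbitrary: s)
  case (Dashv a b)
  then show ?case
    using append_leaves_cong[of "Dashv s a" "append_leaves (leaves a) s" "leaves b"]
    by (simp add: dias_tree_axioms add.commute[of "leaves a"] funpow_add)
next
  case (Vdash a b)
  then show ?case
    using append_leaves_cong[of "Dashv s a" "append_leaves (leaves a) s" "leaves b"]
    by (simp add: dias_tree_axioms add.commute[of "leaves a"] funpow_add)
qed simp

lemma dias_tree_Vdash: "dias_tree (Vdash t s) = dias_tree (prepend_leaves (leaves t) s)"
proof (induction t arbitrary: s)
  case (Dashv a b)
  then show ?case
    using prepend_leaves_cong[of "Vdash b s" "prepend_leaves (leaves b) s" "leaves a"]
    by (simp add: dias_tree_axioms funpow_add)
next
  case (Vdash a b)
  then show ?case
    using prepend_leaves_cong[of "Vdash b s" "prepend_leaves (leaves b) s" "leaves a"]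
    by (simp add: dias_tree_axioms funpow_add)
qed simp

lemma append_prepend_leaves:
  "dias_tree (append_leaves n (prepend_leaves m t)) =
   dias_tree (prepend_leaves m (append_leaves n t))"
proof (induction m)
  case (Suc m)
  have "dias_tree (append_leaves n (Vdash Leaf s)) = dias_tree (Vdash Leaf (append_leaves n s))"
    for s
  proof (induction n)
    case (Suc n)
    then show ?case
      using dias_tree_Dashv_cong[OF Suc, of Leaf] by (simp add: dias_tree_axioms)
  qed simp
  with dias_tree_Vdash_cong[OF Suc, of Leaf] show ?case by simp
qed simp

text \<open>
  The tree \<open>x\<^sub>1 \<turnstile> (\<dots> \<turnstile> (x\<^sub>k\<^sub>-\<^sub>1 \<turnstile> ((x\<^sub>k \<stileturn> x\<^sub>k\<^sub>+\<^sub>1) \<stileturn> \<dots>)))\<close>, pointed at \<open>k\<close>.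
\<close>

definition normal_tree :: "nat \<Rightarrow> nat \<Rightarrow> dtree" where
  "normal_tree n k = prepend_leaves (k - 1) (append_leaves (n - k) Leaf)"

lemma leaves_mark_normal_tree:
  assumes "1 \<le> k" "k \<le> n"
  shows "leaves (normal_tree n k) = n" "mark (normal_tree n k) = k"
proof -
  have a: "leaves (append_leaves m t) = leaves t + m" "mark (append_leaves m t) = mark t" for m t
    by (induction m) auto
  have b: "leaves (prepend_leaves m t) = leaves t + m" "mark (prepend_leaves m t) = mark t + m"
    for m t
    by (induction m) auto
  show "leaves (normal_tree n k) = n" "mark (normal_tree n k) = k"
    using assms by (auto simp: normal_tree_def a b)
qed

lemma dias_tree_normal: "dias_tree t = dias_tree (normal_tree (leaves t) (mark t))"
proof (induction t)
  case Leaf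
  then show ?case by (simp add: normal_tree_def)
next
  case (Dashv a b)
  have "dias_tree (Dashv a b) = dias_tree (append_leaves (leaves b) a)"
    by (rule dias_tree_Dashv)
  also have "\<dots> = dias_tree (append_leaves (leaves b) (normal_tree (leaves a) (mark a)))"
    by (rule append_leaves_cong) (rule Dashv)
  also have "\<dots> = dias_tree (normal_tree (leaves a + leaves b) (mark a))"
  proof -
    have "leaves a + leaves b - mark a = leaves b + (leaves a - mark a)"
      using mark_bounds[of a] by simp
    then show ?thesis by (simp add: normal_tree_def append_prepend_leaves funpow_add)
  qed
  finally show ?case by simp
next
  case (Vdash a b)
  have "dias_tree (Vdash a b) = dias_tree (prepend_leaves (leaves a) b)"
    by (rule dias_tree_Vdash)
  also have "\<dots> = dias_tree (prepend_leaves (leaves a) (normal_tree (leaves b) (mark b)))"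
    by (rule prepend_leaves_cong) (rule Vdash)
  also have "\<dots> = dias_tree (normal_tree (leaves a + leaves b) (leaves a + mark b))"
  proof -
    have "leaves a + mark b - 1 = leaves a + (mark b - 1)"
      using mark_bounds[of b] by simp
    then show ?thesis by (simp add: normal_tree_def funpow_add)
  qed
  finally show ?case by simp
qed

text \<open>
  The word \<open>x\<^sub>1 \<dots> x\<^sub>n\<close> pointed at \<open>k\<close>. The value \<open>0\<close> at \<open>k = 0\<close> fits the description of Dias by
  differences \<open>f\<^sub>k - f\<^sub>0\<close> and makes the formula for \<open>\<tau>\<close> uniform in \<open>k\<close>.
\<close>

definition dias_basis :: "nat \<Rightarrow> nat \<Rightarrow> dias" where
  "dias_basis n k = (if 1 \<le> k \<and> k \<le> n then dias_tree (normal_tree n k) else 0)"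

lemma dias_tree_basis: "dias_tree t = dias_basis (leaves t) (mark t)"
  using mark_bounds[of t] by (simp add: dias_basis_def dias_tree_normal[of t])

lemma dias_basis_zero [simp]: "dias_basis n 0 = 0" "n < k \<Longrightarrow> dias_basis n k = 0"
  by (simp_all add: dias_basis_def)

lemma insert_mark_bounds:
  assumes "1 \<le> i" "i \<le> m" "1 \<le> a" "a \<le> m" "1 \<le> b" "b \<le> n"
  shows "1 \<le> insert_mark i n a b" "insert_mark i n a b \<le> m + n - 1"
  using assms by (auto simp: insert_mark_def)

lemma dias_pcomp_basis:
  assumes "1 \<le> i" "i \<le> m" "1 \<le> a" "a \<le> m" "1 \<le> b" "b \<le> n"
  shows "dias_pcomp i (dias_basis m a) (dias_basis n b) =
    dias_basis (m + n - 1) (insert_mark i n a b)"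
proof -
  have "dias_pcomp i (dias_basis m a) (dias_basis n b) =
      dias_tree (graft (normal_tree m a) i (normal_tree n b))"
    using assms by (simp add: dias_basis_def dias_pcomp_tree leaves_mark_normal_tree)
  then show ?thesis
    using assms by (simp add: dias_tree_basis leaves_graft mark_graft leaves_mark_normal_tree)
qed

definition coef :: "nat \<Rightarrow> nat \<Rightarrow> dias \<Rightarrow> rat" where
  "coef n k x = lookup (dias_coord x) (n, k)"

lemma qlinear_coef: "qlinear (coef n k)"
  by (simp add: linear_on_def coef_def qlinear_add[OF qlinear_dias_coord]
      qlinear_scale[OF qlinear_dias_coord] lookup_add lookup_scaleQ)

lemma coef_basis:
  "1 \<le> k \<Longrightarrow> k \<le> n \<Longrightarrow> coef n j (dias_basis n k) = (if j = k then 1 else 0)"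
  by (auto simp: coef_def dias_basis_def dias_coord_tree leaves_mark_normal_tree lookup_single)

lemma component_Dias: "component Dias n = rat_vector.span (dias_basis n ` {1..n})"
proof -
  have "dias_tree ` {t. leaves t = n} = dias_basis n ` {1..n}"
  proof (intro equalityI subsetI)
    fix x assume "x \<in> dias_tree ` {t. leaves t = n}"
    then show "x \<in> dias_basis n ` {1..n}"
      using mark_bounds by (auto simp: dias_tree_basis)
  next
    fix x assume "x \<in> dias_basis n ` {1..n}"
    then show "x \<in> dias_tree ` {t. leaves t = n}"
      by (auto simp: dias_basis_def leaves_mark_normal_tree)
  qed
  then show ?thesis by (simp add: Dias_def)
qed

lemma Dias_simps [simp]:
  "ns_operad.unit Dias = dias_basis 1 1" "ns_operad.pcomp Dias = dias_pcomp"
  by (simp_all add: Dias_def dias_tree_basis)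

lemma subspace_Dias: "rat_vector.subspace (component Dias n)"
  by (simp add: component_Dias)

lemma basis_in_Dias: "dias_basis n k \<in> component Dias n"
  by (cases "1 \<le> k \<and> k \<le> n")
    (auto simp: component_Dias rat_vector.span_zero dias_basis_def
      intro!: rat_vector.span_base image_eqI[of _ _ k])

lemma qlinear_eq_on_Dias:
  assumes "x \<in> component Dias n" "qlinear F" "qlinear G"
    "\<And>k. 1 \<le> k \<Longrightarrow> k \<le> n \<Longrightarrow> F (dias_basis n k) = G (dias_basis n k)"
  shows "F x = G x"
  using assms by (intro qlinear_eq_on_span[of F G x "dias_basis n ` {1..n}"])
    (auto simp: component_Dias)

lemma qlinear_id: "qlinear (\<lambda>x. x)"
  by (simp add: linear_on_def)

lemma bilinear_eq_on_Dias:
  assumes "f \<in> component Dias m" "g \<in> component Dias n"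
    "\<And>g. qlinear (\<lambda>f. F f g)" "\<And>f. qlinear (F f)"
    "\<And>g. qlinear (\<lambda>f. G f g)" "\<And>f. qlinear (G f)"
    "\<And>a b. 1 \<le> a \<Longrightarrow> a \<le> m \<Longrightarrow> 1 \<le> b \<Longrightarrow> b \<le> n \<Longrightarrow>
      F (dias_basis m a) (dias_basis n b) = G (dias_basis m a) (dias_basis n b)"
  shows "F f g = G f g"
  using assms(1,2) unfolding component_Dias
  by (rule bilinear_eq_on_span) (use assms(3-7) in auto)

lemma trilinear_eq_on_Dias:
  assumes "f \<in> component Dias l" "g \<in> component Dias m" "h \<in> component Dias n"
    "\<And>g h. qlinear (\<lambda>f. F f g h)" "\<And>f h. qlinear (\<lambda>g. F f g h)" "\<And>f g. qlinear (F f g)"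
    "\<And>g h. qlinear (\<lambda>f. G f g h)" "\<And>f h. qlinear (\<lambda>g. G f g h)" "\<And>f g. qlinear (G f g)"
    "\<And>a b c. 1 \<le> a \<Longrightarrow> a \<le> l \<Longrightarrow> 1 \<le> b \<Longrightarrow> b \<le> m \<Longrightarrow> 1 \<le> c \<Longrightarrow> c \<le> n \<Longrightarrow>
      F (dias_basis l a) (dias_basis m b) (dias_basis n c) =
      G (dias_basis l a) (dias_basis m b) (dias_basis n c)"
  shows "F f g h = G f g h"
  using assms(1-3) unfolding component_Dias
  by (rule trilinear_eq_on_span) (use assms(4-10) in auto)

lemma insert_mark_assoc:
  assumes "1 \<le> i" "1 \<le> j" "j \<le> m" "1 \<le> b" "b \<le> m" "1 \<le> n"
  shows "insert_mark (i + j - 1) n (insert_mark i m a b) c =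
    insert_mark i (m + n - 1) a (insert_mark j n b c)"
  using assms
  by (cases a i rule: linorder_cases; cases b j rule: linorder_cases) (auto simp: insert_mark_def)

lemma insert_mark_parallel:
  assumes "1 \<le> i" "i < k" "1 \<le> b" "b \<le> m" "1 \<le> c"
  shows "insert_mark (k + m - 1) n (insert_mark i m a b) c =
    insert_mark i m (insert_mark k n a c) b"
  using assms
  by (cases a i rule: linorder_cases; cases a k rule: linorder_cases) (auto simp: insert_mark_def)

(* The numeral 1 is kept as it is, so that rules about the first input of a composition match. *)
declare One_nat_def [simp del]

lemma pcomp_in_Dias:
  assumes "1 \<le> i" "i \<le> m" "f \<in> component Dias m" "g \<in> component Dias n"
  shows "dias_pcomp i f g \<in> component Dias (m + n - 1)"
proof (rule qlinear_span_image[OF qlinear_pcomp_left _ subspace_Dias assms(3)[unfolded component_Dias]])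
  fix x assume "x \<in> dias_basis m ` {1..m}"
  then obtain a where a: "x = dias_basis m a" "1 \<le> a" "a \<le> m" by auto
  show "dias_pcomp i x g \<in> component Dias (m + n - 1)"
    by (rule qlinear_span_image[OF qlinear_pcomp_right _ subspace_Dias
          assms(4)[unfolded component_Dias]])
      (use assms(1,2) a in \<open>auto simp: dias_pcomp_basis basis_in_Dias\<close>)
qed

lemma Dias_assoc:
  assumes "1 \<le> i" "i \<le> l" "1 \<le> j" "j \<le> m"
    "f \<in> component Dias l" "g \<in> component Dias m" "h \<in> component Dias n"
  shows "dias_pcomp (i + j - 1) (dias_pcomp i f g) h = dias_pcomp i f (dias_pcomp j g h)"
proof (rule trilinear_eq_on_Dias[OF assms(5-7)])
  fix a b c assume "1 \<le> a" "a \<le> l" "1 \<le> b" "b \<le> m" "1 \<le> c" "c \<le> n"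
  with assms(1-4) show "dias_pcomp (i + j - 1) (dias_pcomp i (dias_basis l a) (dias_basis m b))
        (dias_basis n c) =
      dias_pcomp i (dias_basis l a) (dias_pcomp j (dias_basis m b) (dias_basis n c))"
    using insert_mark_bounds[of i l a b m] insert_mark_bounds[of j m b c n]
    by (simp add: dias_pcomp_basis insert_mark_assoc add.assoc)
qed (simp_all add: linear_on_def dias_pcomp_linear)

lemma Dias_parallel:
  assumes "1 \<le> i" "i < k" "k \<le> l"
    "f \<in> component Dias l" "g \<in> component Dias m" "h \<in> component Dias n"
  shows "dias_pcomp (k + m - 1) (dias_pcomp i f g) h = dias_pcomp i (dias_pcomp k f h) g"
proof (rule trilinear_eq_on_Dias[OF assms(4-6)])
  fix a b c assume *: "1 \<le> a" "a \<le> l" "1 \<le> b" "b \<le> m" "1 \<le> c" "c \<le> n"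
  have "dias_pcomp (k + m - 1) (dias_pcomp i (dias_basis l a) (dias_basis m b)) (dias_basis n c)
      = dias_basis (l + m - 1 + n - 1) (insert_mark (k + m - 1) n (insert_mark i m a b) c)"
    using * assms(1-3) insert_mark_bounds[of i l a b m]
    by (simp add: dias_pcomp_basis)
  moreover have "dias_pcomp i (dias_pcomp k (dias_basis l a) (dias_basis n c)) (dias_basis m b)
      = dias_basis (l + n - 1 + m - 1) (insert_mark i m (insert_mark k n a c) b)"
    using * assms(1-3) insert_mark_bounds[of k l a c n]
    by (simp add: dias_pcomp_basis)
  moreover have "l + m - 1 + n - 1 = l + n - 1 + m - 1" using * by simp
  ultimately show "dias_pcomp (k + m - 1) (dias_pcomp i (dias_basis l a) (dias_basis m b))
        (dias_basis n c) =
      dias_pcomp i (dias_pcomp k (dias_basis l a) (dias_basis n c)) (dias_basis m b)"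
    using * assms(1-3) by (simp add: insert_mark_parallel)
qed (simp_all add: linear_on_def dias_pcomp_linear)

lemma Dias_unit:
  assumes "f \<in> component Dias n"
  shows "dias_pcomp 1 (dias_basis 1 1) f = f"
    and "1 \<le> i \<Longrightarrow> i \<le> n \<Longrightarrow> dias_pcomp i f (dias_basis 1 1) = f"
proof -
  show "dias_pcomp 1 (dias_basis 1 1) f = f"
    by (rule qlinear_eq_on_Dias[OF assms qlinear_pcomp_right qlinear_id])
      (simp add: dias_pcomp_basis insert_mark_def)
  assume i: "1 \<le> i" "i \<le> n"
  show "dias_pcomp i f (dias_basis 1 1) = f"
    by (rule qlinear_eq_on_Dias[OF assms qlinear_pcomp_left qlinear_id])
      (use i in \<open>auto simp: dias_pcomp_basis insert_mark_def\<close>)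
qed

lemma is_ns_operad_Dias: "is_ns_operad Dias"
  unfolding is_ns_operad_def Dias_simps
  using subspace_Dias pcomp_in_Dias Dias_assoc Dias_parallel Dias_unit
    qlinear_imp_linear_on[OF qlinear_pcomp_left] qlinear_imp_linear_on[OF qlinear_pcomp_right]
    basis_in_Dias
  by auto

section \<open>The anticyclic structure of the diassociative operad\<close>

text \<open>
  Identify the word pointed at \<open>k\<close> with \<open>f\<^sub>k - f\<^sub>0\<close> in \<open>\<rat>\<^bsup>n+1\<^esup>\<close>. The formula is then the cyclic shift
  \<open>f\<^sub>k \<mapsto> f\<^sub>k\<^sub>-\<^sub>1\<close>, because \<open>f\<^sub>k\<^sub>-\<^sub>1 - f\<^sub>n = (f\<^sub>k\<^sub>-\<^sub>1 - f\<^sub>0) - (f\<^sub>n - f\<^sub>0)\<close>.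
\<close>

definition dias_rotate :: "nat \<Rightarrow> dias \<Rightarrow> dias" where
  "dias_rotate n x = (\<Sum>k=1..n. coef n k x *\<^sub>Q (dias_basis n (k - 1) - dias_basis n n))"

lemma qlinear_dias_rotate: "qlinear (dias_rotate n)"
  by (simp add: linear_on_def dias_rotate_def qlinear_add[OF qlinear_coef]
      qlinear_scale[OF qlinear_coef] scaleQ_add_left sum.distrib rat_vector.scale_sum_right
      scaleQ_scaleQ scaleQ_rat_def)

lemmas dias_rotate_linear =
  qlinear_add[OF qlinear_dias_rotate] qlinear_scale[OF qlinear_dias_rotate]
  qlinear_diff[OF qlinear_dias_rotate] qlinear_uminus[OF qlinear_dias_rotate]
  qlinear_zero[OF qlinear_dias_rotate]

lemma dias_rotate_basis:
  "1 \<le> k \<Longrightarrow> k \<le> n \<Longrightarrow> dias_rotate n (dias_basis n k) = dias_basis n (k - 1) - dias_basis n n"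
  by (simp add: dias_rotate_def coef_basis if_distrib[of "\<lambda>c. c *\<^sub>Q _"] scaleQ_one cong: if_cong)

lemma dias_rotate_in_Dias: "dias_rotate n x \<in> component Dias n"
  unfolding dias_rotate_def
  by (intro rat_vector.subspace_sum rat_vector.subspace_scale rat_vector.subspace_diff
      subspace_Dias basis_in_Dias)

text \<open>
  The vector \<open>f\<^sub>k - f\<^sub>0\<close> becomes \<open>f\<^sub>k\<^sub>-\<^sub>j - f\<^sub>-\<^sub>j\<close> with indices modulo \<open>n + 1\<close>; subtracting \<open>j\<close> is written
  as adding \<open>j n\<close> to avoid truncated subtraction.
\<close>

lemma dias_rotate_power_basis:
  "k \<le> n \<Longrightarrow> (dias_rotate n ^^ j) (dias_basis n k) =
     dias_basis n ((k + j * n) mod (n + 1)) - dias_basis n ((j * n) mod (n + 1))"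
proof (induction j)
  case (Suc j)
  have step: "dias_rotate n (dias_basis n k) = dias_basis n ((k + n) mod (n + 1)) - dias_basis n n"
    if "k \<le> n" for k
  proof (cases "k = 0")
    case False
    then have "(k + n) mod (n + 1) = k - 1"
      using that by (simp add: mod_if)
    with False that show ?thesis by (simp add: dias_rotate_basis)
  qed (simp add: dias_rotate_linear)
  have "(x mod (n + 1) + n) mod (n + 1) = (n + x) mod (n + 1)" for x
    by (simp add: mod_simps add.commute)
  moreover have "x mod (n + 1) \<le> n" for x
    using mod_less_divisor[of "n + 1" x] by linarith
  ultimately show ?case
    using Suc by (simp add: dias_rotate_linear step add_ac)
qed simp

lemma dias_rotate_order:
  assumes "x \<in> component Dias n"
  shows "(dias_rotate n ^^ (n + 1)) x = x"
proof (rule qlinear_eq_on_Dias[OF assms _ qlinear_id])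
  have "qlinear (dias_rotate n ^^ j)" for j
    by (induction j) (simp_all add: linear_on_def dias_rotate_linear)
  then show "qlinear (dias_rotate n ^^ (n + 1))" .
  fix k assume k: "1 \<le> k" "k \<le> n"
  have "(dias_rotate n ^^ (n + 1)) (dias_basis n k) =
      dias_basis n ((k + (n + 1) * n) mod (n + 1)) - dias_basis n (((n + 1) * n) mod (n + 1))"
    by (rule dias_rotate_power_basis) (rule k)
  also have "(k + (n + 1) * n) mod (n + 1) = k"
    using k by (simp only: mod_mult_self2) simp
  also have "((n + 1) * n) mod (n + 1) = 0"
    by (rule mod_mult_self1_is_0)
  finally show "(dias_rotate n ^^ (n + 1)) (dias_basis n k) = dias_basis n k"
    by simp
qed

lemma anticyclic_Dias: "anticyclic_identities Dias dias_rotate"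
  unfolding anticyclic_identities_def Dias_simps
proof (intro conjI allI impI ballI)
  show "dias_rotate 1 (dias_basis 1 1) = - dias_basis 1 1"
    by (simp add: dias_rotate_basis)
next
  fix m n f g i
  assume mn: "1 \<le> m" "1 \<le> n" and f: "f \<in> component Dias m" and g: "g \<in> component Dias n"
    and i: "i \<in> {2..m}"
  show "dias_rotate (m + n - 1) (dias_pcomp i f g) = dias_pcomp (i - 1) (dias_rotate m f) g"
  proof (rule bilinear_eq_on_Dias[OF f g])
    fix a b assume ab: "1 \<le> a" "a \<le> m" "1 \<le> b" "b \<le> n"
    show "dias_rotate (m + n - 1) (dias_pcomp i (dias_basis m a) (dias_basis n b)) =
      dias_pcomp (i - 1) (dias_rotate m (dias_basis m a)) (dias_basis n b)"
    proof (cases "a = 1")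
      case True
      with ab i mn have "insert_mark i n a b = 1" "insert_mark (i - 1) n m b = m + n - 1"
        by (auto simp: insert_mark_def)
      moreover have "1 \<le> i - 1" "i - 1 \<le> m" "1 \<le> m" "1 \<le> m + n - 1" "1 \<le> i" "i \<le> m"
        using i mn by auto
      ultimately show ?thesis
        using True ab
        by (simp add: dias_pcomp_basis dias_rotate_basis dias_pcomp_linear)
    next
      case False
      with ab i mn have "insert_mark i n a b - 1 = insert_mark (i - 1) n (a - 1) b"
        "insert_mark (i - 1) n m b = m + n - 1"
        by (auto simp: insert_mark_def)
      moreover have "1 \<le> i - 1" "i - 1 \<le> m" "1 \<le> m" "1 \<le> i" "i \<le> m" "1 \<le> a - 1" "a - 1 \<le> m"
        using False ab i mn by auto
      ultimately show ?thesis
        using ab insert_mark_bounds[of i m a b n]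
        by (simp add: dias_pcomp_basis dias_rotate_basis dias_pcomp_linear)
    qed
  qed (simp_all add: linear_on_def dias_pcomp_linear dias_rotate_linear)
next
  fix m n f g
  assume mn: "1 \<le> m" "1 \<le> n" and f: "f \<in> component Dias m" and g: "g \<in> component Dias n"
  show "dias_rotate (m + n - 1) (dias_pcomp 1 f g) =
      - dias_pcomp n (dias_rotate n g) (dias_rotate m f)"
  proof (rule bilinear_eq_on_Dias[OF f g])
    fix a b assume ab: "1 \<le> a" "a \<le> m" "1 \<le> b" "b \<le> n"
    have c: "n + m - 1 = m + n - 1" by simp
    have L: "dias_rotate (m + n - 1) (dias_pcomp 1 (dias_basis m a) (dias_basis n b)) =
        dias_basis (m + n - 1) (if a = 1 then b - 1 else a + n - 2) -
        dias_basis (m + n - 1) (m + n - 1)"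
      using ab mn by (auto simp: dias_pcomp_basis dias_rotate_basis insert_mark_def)
    have "- dias_pcomp n (dias_rotate n (dias_basis n b)) (dias_rotate m (dias_basis m a)) =
        dias_pcomp n (dias_basis n n) (dias_basis m (a - 1) - dias_basis m m) -
        dias_pcomp n (dias_basis n (b - 1)) (dias_basis m (a - 1) - dias_basis m m)"
      using ab by (simp add: dias_rotate_basis dias_pcomp_linear)
    also have "dias_pcomp n (dias_basis n n) (dias_basis m (a - 1) - dias_basis m m) =
        (if a = 1 then 0 else dias_basis (m + n - 1) (a + n - 2)) -
        dias_basis (m + n - 1) (m + n - 1)"
      using ab mn by (auto simp: dias_pcomp_linear dias_pcomp_basis insert_mark_def c add_ac)
    also have "dias_pcomp n (dias_basis n (b - 1)) (dias_basis m (a - 1) - dias_basis m m) =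
        (if a = 1 then - dias_basis (m + n - 1) (b - 1) else 0)"
      using ab mn
      by (cases "b = 1") (auto simp: dias_pcomp_linear dias_pcomp_basis insert_mark_def c)
    finally show "dias_rotate (m + n - 1) (dias_pcomp 1 (dias_basis m a) (dias_basis n b)) =
        - dias_pcomp n (dias_rotate n (dias_basis n b)) (dias_rotate m (dias_basis m a))"
      using L by auto
  qed (simp_all add: linear_on_def dias_pcomp_linear dias_rotate_linear)
qed

lemma dias_generators: "dias_dashv = dias_basis 2 1" "dias_vdash = dias_basis 2 2"
  by (simp_all add: dias_tree_basis)

lemma dias_tau_spec:
  "is_ns_anticyclic_operad Dias dias_tau"
  "dias_tau 2 (dias_basis 2 1) = - dias_basis 2 2"
  "dias_tau 2 (dias_basis 2 2) = dias_basis 2 1 - dias_basis 2 2"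
proof -
  let ?Q = "\<lambda>\<tau>. is_ns_anticyclic_operad Dias \<tau> \<and> (\<forall>E\<in>component Dias 1. \<tau> 1 E = - E) \<and>
     \<tau> 2 dias_dashv = - dias_vdash \<and> \<tau> 2 dias_vdash = dias_dashv - dias_vdash"
  have "?Q dias_rotate"
  proof (intro conjI ballI)
    show "is_ns_anticyclic_operad Dias dias_rotate"
      unfolding is_ns_anticyclic_operad_def
      using is_ns_operad_Dias qlinear_imp_linear_on[OF qlinear_dias_rotate]
        dias_rotate_in_Dias dias_rotate_order anticyclic_Dias by auto
    show "dias_rotate 1 E = - E" if "E \<in> component Dias 1" for E
      by (rule qlinear_eq_on_Dias[OF that qlinear_dias_rotate])
        (auto simp: linear_on_def dias_rotate_basis)
  qed (simp_all add: dias_generators dias_rotate_basis flip: One_nat_def)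
  then have "?Q dias_tau"
    unfolding dias_tau_def by (rule someI[of ?Q])
  then show "is_ns_anticyclic_operad Dias dias_tau"
    "dias_tau 2 (dias_basis 2 1) = - dias_basis 2 2"
    "dias_tau 2 (dias_basis 2 2) = dias_basis 2 1 - dias_basis 2 2"
    by (simp_all add: dias_generators)
qed

lemma anticyclic_identity_middle:
  assumes "anticyclic_identities P \<tau>" "f \<in> component P m" "g \<in> component P n"
    "1 \<le> n" "2 \<le> i" "i \<le> m"
  shows "\<tau> (m + n - 1) (ns_operad.pcomp P i f g) = ns_operad.pcomp P (i - 1) (\<tau> m f) g"
proof -
  have "i \<in> {2..m}" "1 \<le> m" using assms by auto
  with assms show ?thesis unfolding anticyclic_identities_def by blast
qed

lemma anticyclic_identity_first:
  assumes "anticyclic_identities P \<tau>" "f \<in> component P m" "g \<in> component P n"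
    "1 \<le> n" "1 \<le> m"
  shows "\<tau> (m + n - 1) (ns_operad.pcomp P 1 f g) = - ns_operad.pcomp P n (\<tau> n g) (\<tau> m f)"
  using assms unfolding anticyclic_identities_def by blast

text \<open>
  Uniqueness of the anticyclic structure: every basis element of arity \<open>n + 1\<close> is a composite of one
  of arity \<open>n\<close> with a generator, and the anticyclic identities compute \<open>\<tau>\<close> of the composite.
\<close>

lemma dias_tau_basis:
  "1 \<le> k \<Longrightarrow> k \<le> n \<Longrightarrow> dias_tau n (dias_basis n k) = dias_basis n (k - 1) - dias_basis n n"
proof (induction n arbitrary: k)
  case (Suc n)
  have ids: "anticyclic_identities Dias dias_tau"
    using dias_tau_spec(1) by (simp add: is_ns_anticyclic_operad_def)
  show ?case
  proof (cases "n = 0")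
    case True
    with Suc.prems ids show ?thesis
      by (simp add: anticyclic_identities_def le_antisym flip: One_nat_def)
  next
    case False
    then have n: "1 \<le> n" by simp
    have Suc_n: "2 + n - 1 = Suc n" by simp
    show ?thesis
    proof (cases "k \<le> n")
      case True
      have "dias_tau (Suc n) (dias_pcomp 1 (dias_basis 2 1) (dias_basis n k)) =
          - dias_pcomp n (dias_tau n (dias_basis n k)) (dias_tau 2 (dias_basis 2 1))"
        using anticyclic_identity_first[OF ids basis_in_Dias basis_in_Dias, of n 2 1 k] n
        by (simp add: Suc_n del: diff_Suc_1)
      moreover have "dias_pcomp 1 (dias_basis 2 1) (dias_basis n k) = dias_basis (Suc n) k"
        using True n Suc.prems dias_pcomp_basis[of 1 2 1 k n] Suc_n by (simp add: insert_mark_def)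
      moreover have "dias_pcomp n (dias_basis n j) (dias_basis 2 2) =
          dias_basis (Suc n) (if j = n then Suc n else j)" if "1 \<le> j" "j \<le> n" for j
        using that n dias_pcomp_basis[of n n j 2 2] by (auto simp: insert_mark_def)
      ultimately show ?thesis
        using True n Suc.prems
        by (cases "k = 1") (simp_all add: Suc.IH dias_tau_spec dias_pcomp_linear)
    next
      case False
      with Suc.prems have k: "k = Suc n" by simp
      have "dias_tau (Suc n) (dias_pcomp 2 (dias_basis 2 2) (dias_basis n n)) =
          dias_pcomp 1 (dias_tau 2 (dias_basis 2 2)) (dias_basis n n)"
      proof -
        have "2 - 1 = (1::nat)" by simp
        then show ?thesis
          using anticyclic_identity_middle[OF ids basis_in_Dias basis_in_Dias n, of 2 2 2 n]
          by (simp only: Suc_n Dias_simps le_refl simp_thms)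
      qed
      then show ?thesis
        using k n dias_pcomp_basis[of 2 2 2 n n] dias_pcomp_basis[of 1 2 1 n n]
          dias_pcomp_basis[of 1 2 2 n n]
        by (simp add: dias_tau_spec dias_pcomp_linear insert_mark_def)
    qed
  qed
qed simp

lemma linear_on_eq_on_span:
  assumes "linear_on (rat_vector.span B) F" "linear_on (rat_vector.span B) G"
    "x \<in> rat_vector.span B" "\<And>b. b \<in> B \<Longrightarrow> F b = G b"
  shows "F x = G x"
proof -
  let ?S = "{x \<in> rat_vector.span B. F x = G x}"
  have "F 0 = G 0"
    using assms(1,2) rat_vector.span_zero[of B] unfolding linear_on_def
    by (metis rat_vector.scale_zero_left)
  then have "rat_vector.subspace ?S"
    using assms(1,2) by (auto simp: rat_vector.subspace_def linear_on_def rat_vector.span_zero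
        rat_vector.span_add rat_vector.span_scale)
  then have "rat_vector.span B \<subseteq> ?S"
    using assms(4) by (intro rat_vector.span_minimal) (auto intro: rat_vector.span_base)
  with assms(3) show ?thesis by auto
qed

lemma dias_tau_eq_rotate:
  assumes "x \<in> component Dias n" "1 \<le> n"
  shows "dias_tau n x = dias_rotate n x"
proof -
  have "linear_on (component Dias n) (dias_tau n)"
    using dias_tau_spec(1) assms(2) by (auto simp: is_ns_anticyclic_operad_def)
  moreover have "dias_tau n b = dias_rotate n b" if "b \<in> dias_basis n ` {1..n}" for b
    using that by (auto simp: dias_tau_basis dias_rotate_basis)
  ultimately show ?thesis
    using linear_on_eq_on_span[OF _ qlinear_imp_linear_on[OF qlinear_dias_rotate]] assms(1)
    unfolding component_Dias by blast
qed

declare One_nat_def [simp]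

section \<open>Substitution of words\<close>

abbreviation perms :: "nat \<Rightarrow> nat list set" where
  "perms n \<equiv> permutations_of_set {1..n}"

text \<open>
  The effect of a substitution on one letter. Identities between iterated substitutions need to be
  checked letter by letter only.
\<close>

definition letter_subst :: "nat \<Rightarrow> nat list \<Rightarrow> nat \<Rightarrow> nat list" where
  "letter_subst i v a =
     (if a < i then [a] else if a = i then map (\<lambda>b. b + i - 1) v else [a + length v - 1])"

lemma word_subst_eq: "word_subst i w v = concat (map (letter_subst i v) w)"
  by (simp add: word_subst_def letter_subst_def[abs_def])

lemma word_subst_append [simp]: "word_subst i (w @ w') v = word_subst i w v @ word_subst i w' v"
  by (simp add: word_subst_eq)

lemma word_subst_Cons: "word_subst i (a # w) v = letter_subst i v a @ word_subst i w v"
  by (simp add: word_subst_eq)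

lemma word_subst_absent:
  "i \<notin> set w \<Longrightarrow> word_subst i w v = map (\<lambda>a. insert_mark i (length v) a 1) w"
  by (induction w) (auto simp: word_subst_eq letter_subst_def insert_mark_def)

lemma letter_subst_other: "a \<noteq> i \<Longrightarrow> letter_subst i v a = [insert_mark i (length v) a b]"
  by (auto simp: letter_subst_def insert_mark_def)

lemma permsD: "w \<in> perms n \<Longrightarrow> distinct w \<and> set w = {1..n} \<and> length w = n"
  by (auto simp: permutations_of_set_def distinct_card[symmetric])

lemma permsI: "set w = {1..n} \<Longrightarrow> length w = n \<Longrightarrow> w \<in> perms n"
  by (auto simp: permutations_of_set_def intro!: card_distinct)

lemma length_word_subst:
  assumes "w \<in> perms m" "v \<in> perms n" "i \<in> {1..m}"
  shows "length (word_subst i w v) = m + n - 1"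
proof -
  obtain xs ys where w: "w = xs @ i # ys" and "i \<notin> set xs" "i \<notin> set ys"
    using assms(1,3) permsD[OF assms(1)] by (metis distinct_append split_list distinct.simps(2)
        not_distinct_conv_prefix)
  then show ?thesis
    using permsD[OF assms(1)] permsD[OF assms(2)]
    by (auto simp: word_subst_Cons word_subst_absent letter_subst_def)
qed

lemma word_subst_perms:
  assumes "w \<in> perms m" "v \<in> perms n" "i \<in> {1..m}"
  shows "word_subst i w v \<in> perms (m + n - 1)"
proof (rule permsI)
  show "length (word_subst i w v) = m + n - 1"
    by (rule length_word_subst[OF assms])
  have v: "set v = {1..n}" "length v = n" and w: "set w = {1..m}"
    using permsD[OF assms(1)] permsD[OF assms(2)] by auto
  show "set (word_subst i w v) = {1..m + n - 1}"
  proof (intro equalityI subsetI)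
    fix x assume "x \<in> set (word_subst i w v)"
    then show "x \<in> {1..m + n - 1}"
      using assms(3) v w by (auto simp: word_subst_eq letter_subst_def split: if_splits)
  next
    fix x assume x: "x \<in> {1..m + n - 1}"
    consider "x < i" | "i \<le> x" "x < i + n" | "i + n \<le> x" by linarith
    then have "\<exists>a\<in>{1..m}. x \<in> set (letter_subst i v a)"
    proof cases
      case 1
      with x assms(3) show ?thesis by (intro bexI[of _ x]) (auto simp: letter_subst_def)
    next
      case 2
      then have "x = (x - i + 1) + i - 1" "x - i + 1 \<in> set v" by (auto simp: v)
      then have "x \<in> (\<lambda>b. b + i - 1) ` set v" by (rule image_eqI)
      with assms(3) show ?thesis
        by (intro bexI[of _ i]) (auto simp: letter_subst_def)
    next
      case 3
      with x show ?thesis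
        by (intro bexI[of _ "x - n + 1"]) (auto simp: letter_subst_def v)
    qed
    then show "x \<in> set (word_subst i w v)"
      by (auto simp: word_subst_eq w)
  qed
qed

lemma word_position_split: "a \<notin> set xs \<Longrightarrow> word_position a (xs @ a # ys) = length xs + 1"
  by (induction xs) (auto simp: word_position_def)

lemma word_position_bounds:
  "a \<in> set w \<Longrightarrow> 1 \<le> word_position a w \<and> word_position a w \<le> length w"
  by (auto simp: word_position_split dest!: split_list_first)

lemma word_position_map:
  "inj_on \<sigma> (set w) \<Longrightarrow> a \<in> set w \<Longrightarrow> word_position (\<sigma> a) (map \<sigma> w) = word_position a w"
  unfolding word_position_def
  by (induction w) (auto simp: inj_on_def)

text \<open>
  Composition in Dias renumbers places and substitution renumbers letters; the two renumberings
  agree. This allows the mark of a pointed word to be recorded by its letter from now on.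
\<close>

lemma word_position_subst:
  assumes w: "w \<in> perms m" and v: "v \<in> perms n" and i: "i \<in> {1..m}" and a: "a \<in> {1..m}"
    and b: "b \<in> {1..n}"
  shows "word_position (insert_mark i n a b) (word_subst i w v) =
    insert_mark (word_position i w) n (word_position a w) (word_position b v)"
proof -
  have len: "length v = n" and dw: "distinct w" and dv: "distinct v"
    using w v permsD by blast+
  have d: "distinct (word_subst i w v)"
    using word_subst_perms[OF w v i] permsD by blast
  have pos: "word_position x us = length xs + 1"
    if "us = xs @ x # ys" "distinct us" for x :: nat and us xs ys
    using that word_position_split by auto
  have len_absent: "length (word_subst i xs v) = length xs" if "i \<notin> set xs" for xs
    using that by (simp add: word_subst_absent)
  obtain xs ys where xy: "w = xs @ a # ys"
    using a w permsD by (metis split_list)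
  show ?thesis
  proof (cases "a = i")
    case True
    obtain vs us where vu: "v = vs @ b # us"
      using b v permsD by (metis split_list)
    have "word_subst i w v = (word_subst i xs v @ map (\<lambda>b. b + i - 1) vs) @
        insert_mark i n a b # (map (\<lambda>b. b + i - 1) us @ word_subst i ys v)"
      using True xy vu
      by (auto simp: word_subst_Cons letter_subst_def insert_mark_def)
    from pos[OF this d] have "word_position (insert_mark i n a b) (word_subst i w v) =
        length xs + length vs + 1"
      using dw xy True by (simp add: len_absent)
    then show ?thesis
      using pos[OF xy dw] pos[OF vu dv] True by (simp add: insert_mark_def)
  next
    case False
    have sub: "word_subst i w v = word_subst i xs v @ insert_mark i n a b # word_subst i ys v"
      using False xy len by (simp add: word_subst_Cons letter_subst_other[where b = b])
    note p = pos[OF sub d]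
    have "i \<in> set w"
      using i permsD[OF w] by simp
    with False xy consider "i \<in> set xs" | "i \<in> set ys"
      by auto
    then show ?thesis
    proof cases
      case 1
      then obtain us zs where us: "xs = us @ i # zs" by (metis split_list)
      have "i \<notin> set us" "i \<notin> set zs" using dw us xy by auto
      then have "length (word_subst i xs v) = length us + n + length zs"
        using us len by (simp add: word_subst_Cons len_absent letter_subst_def)
      moreover have "word_position i w = length us + 1"
        using pos[of w us i] us xy dw by simp
      ultimately show ?thesis
        using p pos[OF xy dw] us by (simp add: insert_mark_def)
    next
      case 2
      then obtain us zs where us: "ys = us @ i # zs" by (metis split_list)
      have "i \<notin> set xs" using dw us xy by auto
      moreover have "word_position i w = length xs + 1 + length us + 1"
        using pos[of w "xs @ a # us" i] us xy dw by simp
      ultimately show ?thesis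
        using p pos[OF xy dw] by (simp add: insert_mark_def len_absent)
    qed
  qed
qed

lemma concat_map_concat_map:
  "concat (map f (concat (map g w))) = concat (map (\<lambda>a. concat (map f (g a))) w)"
  by (induction w) auto

lemma word_subst_assoc:
  assumes v: "v \<in> perms m" and u: "u \<in> perms n" and "1 \<le> i" and j: "j \<in> {1..m}"
  shows "word_subst (i + j - 1) (word_subst i w v) u = word_subst i w (word_subst j v u)"
proof -
  have m: "set v = {1..m}" "length v = m" "set u = {1..n}" "length u = n"
    using v u permsD by blast+
  have inner: "letter_subst (i + j - 1) u (b + i - 1) = map (\<lambda>c. c + i - 1) (letter_subst j u b)"
    if "b \<in> {1..m}" for b
    using that assms(3) j m by (auto simp: letter_subst_def)
  have "concat (map (letter_subst (i + j - 1) u) (letter_subst i v a)) =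
      letter_subst i (word_subst j v u) a" for a
  proof (cases "a = i")
    case True
    then show ?thesis
      using inner m
      by (auto simp: letter_subst_def[of i] word_subst_eq map_concat comp_def intro!: arg_cong[of _ _ concat])
  next
    case False
    have "length (word_subst j v u) = m + n - 1"
      by (rule length_word_subst[OF v u j])
    moreover have "a < i \<Longrightarrow> a < i + j - 1" "i < a \<Longrightarrow> i + j - 1 < a + m - 1"
      using j assms(3) by auto
    ultimately show ?thesis
      using False assms(3) j m(2,4)
      by (cases a i rule: linorder_cases) (simp_all add: letter_subst_def add.assoc)
  qed
  then show ?thesis
    unfolding word_subst_eq concat_map_concat_map by (simp add: word_subst_eq)
qed

lemma word_subst_parallel:
  assumes v: "v \<in> perms m" and u: "u \<in> perms n" and ik: "1 \<le> i" "i < k"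
  shows "word_subst (k + m - 1) (word_subst i w v) u = word_subst i (word_subst k w u) v"
proof -
  have m: "set v = {1..m}" "length v = m" "set u = {1..n}" "length u = n"
    using v u permsD by blast+
  have "concat (map (letter_subst (k + m - 1) u) (letter_subst i v a)) =
      concat (map (letter_subst i v) (letter_subst k u a))" for a
  proof -
    have A: "concat (map (letter_subst (k + m - 1) u) (map (\<lambda>b. b + i - 1) v)) =
        map (\<lambda>b. b + i - 1) v"
    proof -
      have "map (letter_subst (k + m - 1) u) (map (\<lambda>b. b + i - 1) v) =
          map (\<lambda>b. [b + i - 1]) v"
        using ik m by (auto simp: letter_subst_def)
      then show ?thesis by (simp only: concat_map_singleton)
    qed
    have B: "concat (map (letter_subst i v) (map (\<lambda>b. b + k - 1) u)) =
        map (\<lambda>b. b + (k + m - 1) - 1) u"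
    proof -
      have "map (letter_subst i v) (map (\<lambda>b. b + k - 1) u) =
          map (\<lambda>b. [b + (k + m - 1) - 1]) u"
        using ik m by (auto simp: letter_subst_def)
      then show ?thesis by (simp only: concat_map_singleton)
    qed
    consider "a < i" | "a = i" | "i < a" "a < k" | "a = k" | "k < a"
      using ik by linarith
    then show ?thesis
    proof cases
      case 2
      then show ?thesis using A ik by (simp add: letter_subst_def[of i v a] letter_subst_def[of k u a])
          (simp add: letter_subst_def)
    next
      case 4
      then show ?thesis using B ik m by (simp add: letter_subst_def[of i v a] letter_subst_def[of k u a])
          (simp add: letter_subst_def)
    qed (use ik m in \<open>auto simp: letter_subst_def\<close>)
  qed
  then show ?thesis
    unfolding word_subst_eq concat_map_concat_map by simp
qed

lemma block_perm_insert_mark: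
  assumes "\<sigma> permutes {1..m}" "\<rho> permutes {1..n}" "j \<in> {1..m}" "a \<in> {1..m}" "b \<in> {1..n}"
  shows "block_perm m n j \<sigma> \<rho> (insert_mark j n a b) = insert_mark (\<sigma> j) n (\<sigma> a) (\<rho> b)"
proof -
  have "\<sigma> a = \<sigma> j \<longleftrightarrow> a = j"
    using permutes_inj[OF assms(1)] by (auto dest: injD)
  moreover have "1 \<le> \<rho> b" "\<rho> b \<le> n" "1 \<le> \<sigma> j" "\<sigma> j \<le> m" "1 \<le> \<sigma> a" "\<sigma> a \<le> m"
    using permutes_in_image[OF assms(1)] permutes_in_image[OF assms(2)] assms(3-5) by fastforce+
  ultimately show ?thesis
    using assms(3-5)
    by (cases a j rule: linorder_cases) (auto simp: insert_mark_def block_perm_def Let_def)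
qed

lemma word_subst_block_perm:
  assumes "\<sigma> permutes {1..m}" "\<rho> permutes {1..n}" "j \<in> {1..m}" "w \<in> perms m" "v \<in> perms n"
  shows "word_subst (\<sigma> j) (map \<sigma> w) (map \<rho> v) = map (block_perm m n j \<sigma> \<rho>) (word_subst j w v)"
proof -
  have v: "set v = {1..n}" "length v = n" and w: "set w = {1..m}"
    using permsD[OF assms(4)] permsD[OF assms(5)] by auto
  have "letter_subst (\<sigma> j) (map \<rho> v) (\<sigma> a) = map (block_perm m n j \<sigma> \<rho>) (letter_subst j v a)"
    if a: "a \<in> {1..m}" for a
  proof (cases "a = j")
    case True
    have "block_perm m n j \<sigma> \<rho> (b + j - 1) = \<rho> b + \<sigma> j - 1" if "b \<in> {1..n}" for b
      using block_perm_insert_mark[OF assms(1-3,3) that] by (simp add: insert_mark_def)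
    with True show ?thesis by (auto simp: letter_subst_def v)
  next
    case False
    then have "\<sigma> a \<noteq> \<sigma> j"
      using permutes_inj[OF assms(1)] by (auto dest: injD)
    show ?thesis
    proof (cases "n = 0")
      case True
      have "1 \<le> \<sigma> j" "\<sigma> j \<le> m" "1 \<le> \<sigma> a" "\<sigma> a \<le> m"
        using permutes_in_image[OF assms(1)] assms(3) a by fastforce+
      with False True \<open>\<sigma> a \<noteq> \<sigma> j\<close> a assms(3) show ?thesis
        using v by (auto simp: letter_subst_def block_perm_def Let_def)
    next
      case n: False
      then have "1 \<in> {1..n}" by auto
      from block_perm_insert_mark[OF assms(1-3) a this] show ?thesis
        using False \<open>\<sigma> a \<noteq> \<sigma> j\<close> v
        by (simp add: letter_subst_other[of a j v 1]
              letter_subst_other[of "\<sigma> a" "\<sigma> j" "map \<rho> v" "\<rho> 1"] del: One_nat_def)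
    qed
  qed
  then show ?thesis
    by (auto simp: word_subst_eq map_concat comp_def w intro!: arg_cong[of _ _ concat])
qed

section \<open>The symmetric operad of the diassociative operad\<close>

text \<open>
  The word \<open>w\<close> pointed at the letter \<open>a\<close>. In contrast to its place, the letter is simply relabelled by
  the symmetric group and renumbered by composition.
\<close>

definition pointed_word :: "nat \<Rightarrow> nat list \<Rightarrow> nat \<Rightarrow> (nat list \<Rightarrow>\<^sub>0 dias)" where
  "pointed_word n w a = single w (dias_basis n (word_position a w))"

definition pointed_words :: "nat \<Rightarrow> (nat list \<Rightarrow>\<^sub>0 dias) set" where
  "pointed_words n = {pointed_word n w a |w a. w \<in> perms n \<and> a \<in> {1..n}}"

abbreviation sym_pcomp :: "nat \<Rightarrow> (nat list \<Rightarrow>\<^sub>0 dias) \<Rightarrow> (nat list \<Rightarrow>\<^sub>0 dias) \<Rightarrow> (nat list \<Rightarrow>\<^sub>0 dias)"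
  where "sym_pcomp \<equiv> ns_operad.pcomp SymDias"

lemma SymDias_component:
  "component SymDias n = {p. keys p \<subseteq> perms n \<and>
     (\<forall>w\<in>perms n. lookup p w \<in> component Dias n)}"
  by (simp add: symmetrization_def)

lemma pointed_words_subset: "pointed_words n \<subseteq> component SymDias n"
  by (auto simp: pointed_words_def SymDias_component pointed_word_def lookup_single when_def
      basis_in_Dias rat_vector.subspace_0[OF subspace_Dias] split: if_splits)

lemma subspace_SymDias: "rat_vector.subspace (component SymDias n)"
  unfolding rat_vector.subspace_def SymDias_component
proof (intro conjI ballI allI; clarify)
  show "keys 0 \<subseteq> perms n \<and>
      (\<forall>w\<in>perms n. lookup 0 w \<in> component Dias n)"
    by (simp add: rat_vector.subspace_0[OF subspace_Dias])
next
  fix p q :: "nat list \<Rightarrow>\<^sub>0 dias"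
  assume "keys p \<subseteq> perms n" "keys q \<subseteq> perms n"
    "\<forall>w\<in>perms n. lookup p w \<in> component Dias n"
    "\<forall>w\<in>perms n. lookup q w \<in> component Dias n"
  then show "keys (p + q) \<subseteq> perms n \<and>
      (\<forall>w\<in>perms n. lookup (p + q) w \<in> component Dias n)"
    using keys_add[of p q] by (auto simp: lookup_add rat_vector.subspace_add[OF subspace_Dias])
next
  fix c and p :: "nat list \<Rightarrow>\<^sub>0 dias"
  assume "keys p \<subseteq> perms n"
    "\<forall>w\<in>perms n. lookup p w \<in> component Dias n"
  then show "keys (c *\<^sub>Q p) \<subseteq> perms n \<and>
      (\<forall>w\<in>perms n. lookup (c *\<^sub>Q p) w \<in> component Dias n)"
    by (auto simp: lookup_scaleQ in_keys_iff rat_vector.subspace_scale[OF subspace_Dias])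
qed

lemma word_position_surj:
  assumes "w \<in> perms n" "1 \<le> k" "k \<le> n"
  obtains a where "a \<in> {1..n}" "word_position a w = k"
proof
  have w: "distinct w" "set w = {1..n}" "length w = n" using permsD[OF assms(1)] by auto
  have "w = take (k - 1) w @ w ! (k - 1) # drop k w"
    using assms w by (metis One_nat_def Suc_pred diff_less_Suc id_take_nth_drop le_trans
        less_le_trans not_less_eq_eq zero_less_Suc Suc_le_eq)
  moreover from this have "w ! (k - 1) \<notin> set (take (k - 1) w)"
    using w(1) by (metis disjoint_iff distinct_append list.set_intros(1))
  ultimately have "word_position (w ! (k - 1)) w = length (take (k - 1) w) + 1"
    by (metis word_position_split)
  then show "word_position (w ! (k - 1)) w = k"
    using assms w by simp
  show "w ! (k - 1) \<in> {1..n}"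
    using assms w(2,3) nth_mem[of "k - 1" w] by auto
qed

lemma SymDias_span: "component SymDias n = rat_vector.span (pointed_words n)"
proof
  show "rat_vector.span (pointed_words n) \<subseteq> component SymDias n"
    by (rule rat_vector.span_minimal[OF pointed_words_subset subspace_SymDias])
  show "component SymDias n \<subseteq> rat_vector.span (pointed_words n)"
  proof
    fix p assume p: "p \<in> component SymDias n"
    have "single w (lookup p w) \<in> rat_vector.span (pointed_words n)"
      if w: "w \<in> perms n" for w
    proof (rule qlinear_span_image[where F = "single w" and B = "dias_basis n ` {1..n}"])
      show "qlinear (single w :: dias \<Rightarrow> _)"
        by (simp add: linear_on_def single_add single_scaleQ)
      show "lookup p w \<in> rat_vector.span (dias_basis n ` {1..n})"
        unfolding component_Dias[symmetric] using p w by (auto simp: SymDias_component)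
      fix b assume "b \<in> dias_basis n ` {1..n}"
      then obtain k where "b = dias_basis n k" "1 \<le> k" "k \<le> n" by auto
      with word_position_surj[OF w] obtain a where "a \<in> {1..n}"
        "single w b = pointed_word n w a"
        unfolding pointed_word_def by metis
      with w show "single w b \<in> rat_vector.span (pointed_words n)"
        by (auto simp: pointed_words_def intro!: rat_vector.span_base)
    qed simp
    with p show "p \<in> rat_vector.span (pointed_words n)"
      by (subst poly_mapping_expansion[of p])
        (auto simp: SymDias_component intro!: rat_vector.span_sum)
  qed
qed

lemma pointed_word_in_SymDias:
  "w \<in> perms n \<Longrightarrow> a \<in> {1..n} \<Longrightarrow> pointed_word n w a \<in> component SymDias n"
  using pointed_words_subset by (auto simp: pointed_words_def)

lemma sym_pcomp_superset:
  assumes "finite A" "finite B" "keys p \<subseteq> A" "keys q \<subseteq> B"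
  shows "sym_pcomp i p q = (\<Sum>w\<in>A. \<Sum>v\<in>B. single (word_subst i w v)
     (dias_pcomp (word_position i w) (lookup p w) (lookup q v)))"
proof -
  have "(\<Sum>v\<in>keys q. single (word_subst i w v)
        (dias_pcomp (word_position i w) x (lookup q v))) =
      (\<Sum>v\<in>B. single (word_subst i w v)
        (dias_pcomp (word_position i w) x (lookup q v)))" for w x
    by (rule sum_keys_superset[where F = "\<lambda>v y. single (word_subst i w v)
          (dias_pcomp (word_position i w) x y)"]) (use assms in \<open>auto simp: dias_pcomp_linear\<close>)
  then have "sym_pcomp i p q = (\<Sum>w\<in>keys p. \<Sum>v\<in>B.
      single (word_subst i w v)
        (dias_pcomp (word_position i w) (lookup p w) (lookup q v)))"
    by (simp add: symmetrization_def)
  also have "\<dots> = (\<Sum>w\<in>A. \<Sum>v\<in>B. single (word_subst i w v)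
     (dias_pcomp (word_position i w) (lookup p w) (lookup q v)))"
    by (rule sum_keys_superset[where F = "\<lambda>w x. \<Sum>v\<in>B. single (word_subst i w v)
          (dias_pcomp (word_position i w) x (lookup q v))"])
      (use assms in \<open>auto simp: dias_pcomp_linear intro!: sum.neutral\<close>)
  finally show ?thesis .
qed

lemma qlinear_sym_pcomp_left: "qlinear (\<lambda>p. sym_pcomp i p q)"
proof -
  have "sym_pcomp i (p + p') q = sym_pcomp i p q + sym_pcomp i p' q" for p p'
    using keys_add[of p p']
    by (subst (1 2 3) sym_pcomp_superset[where A = "keys p \<union> keys p'"
          and B = "keys q"])
      (auto simp: lookup_add dias_pcomp_linear single_add sum.distrib)
  moreover have "sym_pcomp i (c *\<^sub>Q p) q = c *\<^sub>Q sym_pcomp i p q" for c p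
    by (subst (1 2) sym_pcomp_superset[where A = "keys p"
          and B = "keys q"])
      (auto simp: lookup_scaleQ dias_pcomp_linear single_scaleQ rat_vector.scale_sum_right
        in_keys_iff)
  ultimately show ?thesis by (simp add: linear_on_def)
qed

lemma qlinear_sym_pcomp_right: "qlinear (\<lambda>q. sym_pcomp i p q)"
proof -
  have "sym_pcomp i p (q + q') = sym_pcomp i p q + sym_pcomp i p q'" for q q'
    using keys_add[of q q']
    by (subst (1 2 3) sym_pcomp_superset[where B = "keys q \<union> keys q'"
          and A = "keys p"])
      (auto simp: lookup_add dias_pcomp_linear single_add sum.distrib)
  moreover have "sym_pcomp i p (c *\<^sub>Q q) = c *\<^sub>Q sym_pcomp i p q" for c q
    by (subst (1 2) sym_pcomp_superset[where A = "keys p"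
          and B = "keys q"])
      (auto simp: lookup_scaleQ dias_pcomp_linear single_scaleQ rat_vector.scale_sum_right
        in_keys_iff)
  ultimately show ?thesis by (simp add: linear_on_def)
qed

lemmas sym_pcomp_linear =
  qlinear_add[OF qlinear_sym_pcomp_left] qlinear_add[OF qlinear_sym_pcomp_right]
  qlinear_diff[OF qlinear_sym_pcomp_left] qlinear_diff[OF qlinear_sym_pcomp_right]
  qlinear_uminus[OF qlinear_sym_pcomp_left] qlinear_uminus[OF qlinear_sym_pcomp_right]
  qlinear_scale[OF qlinear_sym_pcomp_left] qlinear_scale[OF qlinear_sym_pcomp_right]
  qlinear_zero[OF qlinear_sym_pcomp_left] qlinear_zero[OF qlinear_sym_pcomp_right]

lemma sym_pcomp_single:
  "sym_pcomp i (single w E) (single v F) =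
   single (word_subst i w v) (dias_pcomp (word_position i w) E F)"
  by (subst sym_pcomp_superset[where A = "{w}" and B = "{v}"]) auto

lemma sym_pcomp_pointed:
  assumes "w \<in> perms m" "v \<in> perms n" "i \<in> {1..m}" "a \<in> {1..m}" "b \<in> {1..n}"
  shows "sym_pcomp i (pointed_word m w a) (pointed_word n v b) =
    pointed_word (m + n - 1) (word_subst i w v) (insert_mark i n a b)"
  using assms permsD[OF assms(1)] permsD[OF assms(2)] word_position_bounds[of i w]
    word_position_bounds[of a w] word_position_bounds[of b v]
  by (simp add: pointed_word_def sym_pcomp_single word_position_subst dias_pcomp_basis)

lemma act_superset:
  assumes "finite A" "keys p \<subseteq> A"
  shows "act SymDias n \<sigma> p = (\<Sum>w\<in>A. single (map \<sigma> w) (lookup p w))"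
  unfolding symmetrization_def operad.simps
  by (rule sum_keys_superset[where F = "\<lambda>w x. single (map \<sigma> w) x"]) (use assms in auto)

lemma qlinear_act: "qlinear (act SymDias n \<sigma>)"
proof -
  have "act SymDias n \<sigma> (p + q) = act SymDias n \<sigma> p + act SymDias n \<sigma> q" for p q
    using keys_add[of p q]
    by (subst (1 2 3) act_superset[where A = "keys p \<union> keys q"])
      (auto simp: lookup_add single_add sum.distrib)
  moreover have "act SymDias n \<sigma> (c *\<^sub>Q p) = c *\<^sub>Q act SymDias n \<sigma> p" for c p
    by (subst (1 2) act_superset[where A = "keys p"])
      (auto simp: lookup_scaleQ single_scaleQ rat_vector.scale_sum_right in_keys_iff)
  ultimately show ?thesis by (simp add: linear_on_def)
qed

lemma act_single: "act SymDias n \<sigma> (single w E) = single (map \<sigma> w) E"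
  by (subst act_superset[where A = "{w}"]) auto

lemma act_pointed:
  "inj_on \<sigma> (set w) \<Longrightarrow> a \<in> set w \<Longrightarrow>
   act SymDias n' \<sigma> (pointed_word n w a) = pointed_word n (map \<sigma> w) (\<sigma> a)"
  by (simp add: pointed_word_def act_single word_position_map)

lemma map_perms: "\<sigma> permutes {1..n} \<Longrightarrow> w \<in> perms n \<Longrightarrow> map \<sigma> w \<in> perms n"
  using permsD[of w n] by (intro permsI) (auto simp: permutes_image simp del: One_nat_def)

lemma pointed_word_cases:
  assumes "x \<in> pointed_words n"
  obtains w a where "x = pointed_word n w a" "w \<in> perms n" "a \<in> {1..n}"
  using assms by (auto simp: pointed_words_def)

lemma sym_pcomp_in_SymDias:
  assumes "i \<in> {1..m}" "f \<in> component SymDias m" "g \<in> component SymDias n"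
  shows "sym_pcomp i f g \<in> component SymDias (m + n - 1)"
proof (rule qlinear_span_image[OF qlinear_sym_pcomp_left _ subspace_SymDias
      assms(2)[unfolded SymDias_span]])
  fix x assume "x \<in> pointed_words m"
  then obtain w a where x: "x = pointed_word m w a" "w \<in> perms m" "a \<in> {1..m}"
    by (rule pointed_word_cases)
  show "sym_pcomp i x g \<in> component SymDias (m + n - 1)"
  proof (rule qlinear_span_image[OF qlinear_sym_pcomp_right _ subspace_SymDias
        assms(3)[unfolded SymDias_span]])
    fix y assume "y \<in> pointed_words n"
    then obtain v b where y: "y = pointed_word n v b" "v \<in> perms n" "b \<in> {1..n}"
      by (rule pointed_word_cases)
    have "insert_mark i n a b \<in> {1..m + n - 1}"
      using insert_mark_bounds[of i m a b n] x y assms(1) by auto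
    then show "sym_pcomp i x y \<in> component SymDias (m + n - 1)"
      using x y assms(1) by (simp add: sym_pcomp_pointed pointed_word_in_SymDias word_subst_perms del: One_nat_def)
  qed
qed

lemma SymDias_assoc:
  assumes ij: "i \<in> {1..l}" "j \<in> {1..m}"
    and fgh: "f \<in> component SymDias l" "g \<in> component SymDias m" "h \<in> component SymDias n"
  shows "sym_pcomp (i + j - 1) (sym_pcomp i f g) h = sym_pcomp i f (sym_pcomp j g h)"
  using fgh unfolding SymDias_span
proof (rule trilinear_eq_on_span)
  fix x y z assume "x \<in> pointed_words l" "y \<in> pointed_words m" "z \<in> pointed_words n"
  then obtain w a v b u c where *: "w \<in> perms l" "a \<in> {1..l}" "v \<in> perms m" "b \<in> {1..m}"
    "u \<in> perms n" "c \<in> {1..n}" and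
    xyz: "x = pointed_word l w a" "y = pointed_word m v b" "z = pointed_word n u c"
    by (elim pointed_word_cases)
  have "insert_mark i m a b \<in> {1..l + m - 1}" "insert_mark j n b c \<in> {1..m + n - 1}"
    "i + j - 1 \<in> {1..l + m - 1}" "l + m - 1 + n - 1 = l + (m + n - 1) - 1"
    using insert_mark_bounds[of i l a b m] insert_mark_bounds[of j m b c n] * ij by auto
  moreover have "insert_mark (i + j - 1) n (insert_mark i m a b) c =
      insert_mark i (m + n - 1) a (insert_mark j n b c)"
    using * ij by (intro insert_mark_assoc) auto
  ultimately show "sym_pcomp (i + j - 1) (sym_pcomp i x y) z = sym_pcomp i x (sym_pcomp j y z)"
    using * ij word_subst_assoc[of v m u n i j w] unfolding xyz
    by (simp add: sym_pcomp_pointed word_subst_perms del: One_nat_def)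
qed (simp_all add: linear_on_def sym_pcomp_linear)

lemma SymDias_parallel:
  assumes ik: "1 \<le> i" "i < k" "k \<le> l"
    and fgh: "f \<in> component SymDias l" "g \<in> component SymDias m" "h \<in> component SymDias n"
  shows "sym_pcomp (k + m - 1) (sym_pcomp i f g) h = sym_pcomp i (sym_pcomp k f h) g"
  using fgh unfolding SymDias_span
proof (rule trilinear_eq_on_span)
  fix x y z assume "x \<in> pointed_words l" "y \<in> pointed_words m" "z \<in> pointed_words n"
  then obtain w a v b u c where *: "w \<in> perms l" "a \<in> {1..l}" "v \<in> perms m" "b \<in> {1..m}"
    "u \<in> perms n" "c \<in> {1..n}" and
    xyz: "x = pointed_word l w a" "y = pointed_word m v b" "z = pointed_word n u c"
    by (elim pointed_word_cases)
  have i: "i \<in> {1..l}" "k \<in> {1..l}" "i \<in> {1..l + n - 1}" "k + m - 1 \<in> {1..l + m - 1}"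
    using ik * by auto
  have "insert_mark i m a b \<in> {1..l + m - 1}" "insert_mark k n a c \<in> {1..l + n - 1}"
    using insert_mark_bounds[of i l a b m] insert_mark_bounds[of k l a c n] * i by auto
  moreover have "l + m - 1 + n - 1 = l + n - 1 + m - 1" using * by simp
  moreover have "insert_mark (k + m - 1) n (insert_mark i m a b) c =
      insert_mark i m (insert_mark k n a c) b"
    using * ik by (intro insert_mark_parallel) auto
  ultimately show "sym_pcomp (k + m - 1) (sym_pcomp i x y) z = sym_pcomp i (sym_pcomp k x z) y"
    using * i word_subst_parallel[of v m u n i k w] ik unfolding xyz
    by (simp add: sym_pcomp_pointed word_subst_perms del: One_nat_def)
qed (simp_all add: linear_on_def sym_pcomp_linear)

lemma SymDias_unit: "ns_operad.unit SymDias = pointed_word 1 [1] 1"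
  by (simp add: symmetrization_def pointed_word_def word_position_def)

lemma one_perms: "[1] \<in> perms 1"
  by (intro permsI) auto

lemma SymDias_unit_laws:
  assumes "f \<in> component SymDias n"
  shows "sym_pcomp 1 (ns_operad.unit SymDias) f = f"
    and "i \<in> {1..n} \<Longrightarrow> sym_pcomp i f (ns_operad.unit SymDias) = f"
proof -
  show "sym_pcomp 1 (ns_operad.unit SymDias) f = f"
  proof (rule qlinear_eq_on_span[OF qlinear_sym_pcomp_right qlinear_id assms[unfolded SymDias_span]])
    fix x assume "x \<in> pointed_words n"
    then obtain w a where "x = pointed_word n w a" "w \<in> perms n" "a \<in> {1..n}"
      by (rule pointed_word_cases)
    moreover have "word_subst 1 [1] w = w" by (simp add: word_subst_def)
    moreover have "insert_mark 1 n 1 a = a" by (simp add: insert_mark_def)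
    ultimately show "sym_pcomp 1 (ns_operad.unit SymDias) x = x"
      unfolding SymDias_unit using one_perms
      by (simp add: sym_pcomp_pointed del: One_nat_def)
  qed
  assume i: "i \<in> {1..n}"
  show "sym_pcomp i f (ns_operad.unit SymDias) = f"
  proof (rule qlinear_eq_on_span[OF qlinear_sym_pcomp_left qlinear_id assms[unfolded SymDias_span]])
    fix x assume "x \<in> pointed_words n"
    then obtain w a where "x = pointed_word n w a" "w \<in> perms n" "a \<in> {1..n}"
      by (rule pointed_word_cases)
    moreover have "word_subst i w [1] = w"
    proof -
      have "letter_subst i [1] = (\<lambda>b. [b])" by (auto simp: letter_subst_def fun_eq_iff)
      then show ?thesis by (simp add: word_subst_eq)
    qed
    moreover have "insert_mark i 1 a 1 = a" by (simp add: insert_mark_def)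
    ultimately show "sym_pcomp i x (ns_operad.unit SymDias) = x"
      unfolding SymDias_unit using one_perms i
      by (simp add: sym_pcomp_pointed del: One_nat_def)
  qed
qed

lemma is_ns_operad_SymDias: "is_ns_operad SymDias"
  unfolding is_ns_operad_def
proof (intro conjI)
  show "ns_operad.unit SymDias \<in> component SymDias 1"
    unfolding SymDias_unit using one_perms by (intro pointed_word_in_SymDias) auto
  show "\<forall>m\<ge>1. \<forall>n\<ge>1. \<forall>i\<in>{1..m}.
        (\<forall>f\<in>component SymDias m. linear_on (component SymDias n) (\<lambda>g. sym_pcomp i f g)) \<and>
        (\<forall>g\<in>component SymDias n. linear_on (component SymDias m) (\<lambda>f. sym_pcomp i f g))"
    by (intro allI impI ballI conjI qlinear_imp_linear_on[OF qlinear_sym_pcomp_left]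
        qlinear_imp_linear_on[OF qlinear_sym_pcomp_right])
  show "\<forall>n\<ge>1. rat_vector.subspace (component SymDias n)"
    by (intro allI impI subspace_SymDias)
  show "\<forall>m\<ge>1. \<forall>n\<ge>1. \<forall>i\<in>{1..m}. \<forall>f\<in>component SymDias m. \<forall>g\<in>component SymDias n.
      sym_pcomp i f g \<in> component SymDias (m + n - 1)"
    by (intro allI impI ballI sym_pcomp_in_SymDias)
  show "\<forall>n\<ge>1. \<forall>f\<in>component SymDias n. sym_pcomp 1 (ns_operad.unit SymDias) f = f \<and>
      (\<forall>i\<in>{1..n}. sym_pcomp i f (ns_operad.unit SymDias) = f)"
    by (intro allI impI ballI conjI SymDias_unit_laws)
  show "\<forall>l\<ge>1. \<forall>m\<ge>1. \<forall>n\<ge>1. \<forall>f\<in>component SymDias l. \<forall>g\<in>component SymDias m.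
      \<forall>h\<in>component SymDias n.
        (\<forall>i\<in>{1..l}. \<forall>j\<in>{1..m}.
           sym_pcomp (i + j - 1) (sym_pcomp i f g) h = sym_pcomp i f (sym_pcomp j g h)) \<and>
        (\<forall>i k. 1 \<le> i \<and> i < k \<and> k \<le> l \<longrightarrow>
           sym_pcomp (k + m - 1) (sym_pcomp i f g) h = sym_pcomp i (sym_pcomp k f h) g)"
    by (intro allI impI ballI conjI; (elim conjE)?) (rule SymDias_assoc SymDias_parallel; assumption)+
qed

lemma sym_rep_SymDias: "sym_rep n (component SymDias n) (act SymDias n)"
  unfolding sym_rep_def
proof (intro conjI allI impI ballI)
  show "rat_vector.subspace (component SymDias n)" by (rule subspace_SymDias)
next
  fix \<sigma> v assume \<sigma>: "\<sigma> permutes {1..n}"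
  show "linear_on (component SymDias n) (act SymDias n \<sigma>)"
    by (rule qlinear_imp_linear_on[OF qlinear_act])
  assume v: "v \<in> component SymDias n"
  show "act SymDias n \<sigma> v \<in> component SymDias n"
  proof (rule qlinear_span_image[OF qlinear_act _ subspace_SymDias v[unfolded SymDias_span]])
    fix x assume "x \<in> pointed_words n"
    then obtain w a where x: "x = pointed_word n w a" "w \<in> perms n" "a \<in> {1..n}"
      by (rule pointed_word_cases)
    have "\<sigma> a \<in> {1..n}" using permutes_in_image[OF \<sigma>] x(3) by blast
    with x \<sigma> permsD[of w n] permutes_inj_on[OF \<sigma>]
    show "act SymDias n \<sigma> x \<in> component SymDias n"
      by (auto simp: act_pointed intro!: pointed_word_in_SymDias map_perms)
  qed
next
  fix v show "act SymDias n id v = v"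
    by (subst act_superset[OF finite_keys subset_refl]) (simp flip: poly_mapping_expansion)
next
  fix \<sigma> \<pi> :: "nat \<Rightarrow> nat" and v
  have "qlinear (\<lambda>v. act SymDias n \<sigma> (act SymDias n \<pi> v))"
    by (simp add: linear_on_def qlinear_add[OF qlinear_act] qlinear_scale[OF qlinear_act])
  then show "act SymDias n (\<sigma> \<circ> \<pi>) v = act SymDias n \<sigma> (act SymDias n \<pi> v)"
    by (subst (1 2) poly_mapping_expansion[of v])
      (simp add: qlinear_sum[OF qlinear_act] qlinear_sum act_single)
qed

lemma SymDias_equivariant:
  assumes \<sigma>: "\<sigma> permutes {1..m}" and \<rho>: "\<rho> permutes {1..n}" and j: "j \<in> {1..m}"
    and fg: "f \<in> component SymDias m" "g \<in> component SymDias n"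
  shows "sym_pcomp (\<sigma> j) (act SymDias m \<sigma> f) (act SymDias n \<rho> g) =
    act SymDias (m + n - 1) (block_perm m n j \<sigma> \<rho>) (sym_pcomp j f g)"
  using fg unfolding SymDias_span
proof (rule bilinear_eq_on_span)
  fix x y assume "x \<in> pointed_words m" "y \<in> pointed_words n"
  then obtain w a v b where *: "w \<in> perms m" "a \<in> {1..m}" "v \<in> perms n" "b \<in> {1..n}" and
    xy: "x = pointed_word m w a" "y = pointed_word n v b"
    by (elim pointed_word_cases)
  let ?\<pi> = "block_perm m n j \<sigma> \<rho>"
  have wv: "word_subst (\<sigma> j) (map \<sigma> w) (map \<rho> v) = map ?\<pi> (word_subst j w v)"
    by (rule word_subst_block_perm[OF \<sigma> \<rho> j *(1,3)])
  have images: "\<sigma> j \<in> {1..m}" "\<sigma> a \<in> {1..m}" "\<rho> b \<in> {1..n}"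
    using permutes_in_image[OF \<sigma>] permutes_in_image[OF \<rho>] * j by blast+
  have sets: "set w = {1..m}" "set v = {1..n}" "set (word_subst j w v) = {1..m + n - 1}"
    using permsD[OF *(1)] permsD[OF *(3)] permsD[OF word_subst_perms[OF *(1,3) j]] by auto
  have "map ?\<pi> (word_subst j w v) \<in> perms (m + n - 1)"
    unfolding wv[symmetric]
    by (rule word_subst_perms[OF map_perms[OF \<sigma> *(1)] map_perms[OF \<rho> *(3)] images(1)])
  then have "distinct (map ?\<pi> (word_subst j w v))"
    by (rule permsD[THEN conjunct1])
  then have inj: "inj_on ?\<pi> (set (word_subst j w v))"
    by (simp add: distinct_map)
  have "insert_mark j n a b \<in> set (word_subst j w v)"
    unfolding sets using insert_mark_bounds[of j m a b n] j * by auto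
  then show "sym_pcomp (\<sigma> j) (act SymDias m \<sigma> x) (act SymDias n \<rho> y) =
      act SymDias (m + n - 1) ?\<pi> (sym_pcomp j x y)"
    unfolding xy using * j images \<sigma> \<rho> inj sets(1,2)
      permutes_inj_on[OF \<sigma>, of "{1..m}"] permutes_inj_on[OF \<rho>, of "{1..n}"]
    by (simp add: act_pointed sym_pcomp_pointed map_perms wv block_perm_insert_mark
        del: One_nat_def)
qed (simp_all add: linear_on_def sym_pcomp_linear qlinear_add[OF qlinear_act]
    qlinear_scale[OF qlinear_act])

lemma is_operad_SymDias: "is_operad SymDias"
  unfolding is_operad_def
  using is_ns_operad_SymDias sym_rep_SymDias SymDias_equivariant by blast

section \<open>Marked cyclic words\<close>

text \<open>
  The cyclic word \<open>W\<close> opened at the letter \<open>a\<close>, which is removed.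
\<close>

definition cut :: "nat \<Rightarrow> nat list \<Rightarrow> nat list" where
  "cut a W = tl (dropWhile (\<lambda>b. b \<noteq> a) W) @ takeWhile (\<lambda>b. b \<noteq> a) W"

lemma cut_split: "a \<notin> set X \<Longrightarrow> cut a (X @ a # Y) = Y @ X"
proof -
  assume "a \<notin> set X"
  then have "dropWhile (\<lambda>b. b \<noteq> a) (X @ a # Y) = a # Y" "takeWhile (\<lambda>b. b \<noteq> a) (X @ a # Y) = X"
    by (induction X) auto
  then show ?thesis by (simp add: cut_def)
qed

lemma cut_rotate:
  assumes "distinct (X @ Y)" "a \<in> set (X @ Y)"
  shows "cut a (X @ Y) = cut a (Y @ X)"
proof -
  have *: "cut a (X @ Y) = cut a (Y @ X)"
    if d: "distinct (X @ Y)" "a \<in> set X" for X Y :: "nat list"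
  proof -
    obtain us vs where X: "X = us @ a # vs" using d(2) by (metis split_list)
    have "cut a (X @ Y) = (vs @ Y) @ us" "cut a (Y @ X) = vs @ Y @ us"
      using d X cut_split[of a us "vs @ Y"] cut_split[of a "Y @ us" vs] by auto
    then show ?thesis by simp
  qed
  from assms consider "a \<in> set X" | "a \<in> set Y" by auto
  then show ?thesis
  proof cases
    case 1
    then show ?thesis using *[of X Y] assms(1) by simp
  next
    case 2
    then show ?thesis using *[of Y X] assms(1) by (simp add: Int_commute)
  qed
qed

text \<open>
  The vector \<open>f\<^sub>a - f\<^bsub>n+1\<^esub>\<close> on the cyclic word \<open>W\<close> in the letters \<open>1, \<dots>, n + 1\<close>: the root \<open>n + 1\<close> plays
  the role of the index \<open>0\<close> and the remaining letters, read from the root on, form a word pointed at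
  \<open>a\<close>. For \<open>a = n + 1\<close> the letter does not occur in the opened word and the value is \<open>0\<close>. The default
  \<open>0\<close> for other lists makes rotation invariance unconditional, so that the linear extension is a
  trace on the free associative algebra.
\<close>

definition marked :: "nat list \<Rightarrow> nat \<Rightarrow> (nat list \<Rightarrow>\<^sub>0 dias)" where
  "marked W a = (if W \<in> perms (length W)
     then pointed_word (length W - 1) (cut (length W) W) a else 0)"

lemma perms_rotate: "X @ Y \<in> perms n \<longleftrightarrow> Y @ X \<in> perms n"
  by (auto simp: permutations_of_set_def)

lemma marked_rotate: "marked (X @ Y) a = marked (Y @ X) a"
proof (cases "X @ Y = []")
  case False
  define N where "N = length (X @ Y)"
  have N: "length (X @ Y) = N" "length (Y @ X) = N" by (simp_all add: N_def)
  have "cut N (X @ Y) = cut N (Y @ X)" if "Y @ X \<in> perms N"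
  proof -
    have "X @ Y \<in> perms N" using that by (simp only: perms_rotate)
    from permsD[OF this] show ?thesis
      using False by (intro cut_rotate) (simp_all add: N_def Suc_leI)
  qed
  then show ?thesis
    unfolding marked_def N perms_rotate[of X Y]
    by (cases "Y @ X \<in> perms N") (simp_all only: if_True if_False)
qed simp

lemma perms_snoc: "w @ [n + 1] \<in> perms (n + 1) \<longleftrightarrow> w \<in> perms n"
proof
  assume "w @ [n + 1] \<in> perms (n + 1)"
  from permsD[OF this] have d: "distinct (w @ [n + 1])" "set (w @ [n + 1]) = {1..n + 1}"
    "length (w @ [n + 1]) = n + 1" by blast+
  have "set w = set (w @ [n + 1]) - {n + 1}" using d(1) by auto
  also have "\<dots> = {1..n}" unfolding d(2) by auto
  finally show "w \<in> perms n" using d(3) by (intro permsI) simp_all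
next
  assume "w \<in> perms n"
  from permsD[OF this] have w: "set w = {1..n}" "length w = n" by auto
  have "{1..n + 1} = insert (n + 1) {1..n}" by auto
  with w show "w @ [n + 1] \<in> perms (n + 1)" by (intro permsI) auto
qed

lemma marked_snoc:
  assumes "w \<in> perms n"
  shows "marked (w @ [n + 1]) a = pointed_word n w a"
proof -
  have "cut (n + 1) (w @ [n + 1]) = w"
    using cut_split[of "n + 1" w "[]"] permsD[OF assms] by auto
  moreover have "length w = n" using permsD[OF assms] by simp
  ultimately show ?thesis
    using perms_snoc[of w n] assms by (simp add: marked_def)
qed

lemma pointed_word_absent:
  assumes "w \<in> perms n" "a \<notin> {1..n}"
  shows "pointed_word n w a = 0"
proof -
  have all: "takeWhile (\<lambda>b. b \<noteq> a) w = w"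
    using assms permsD[OF assms(1)] by (auto simp: takeWhile_eq_all_conv)
  have "word_position a w = n + 1"
    unfolding word_position_def all using permsD[OF assms(1)] by simp
  then show ?thesis
    by (simp add: pointed_word_def)
qed

lemma cyclic_perms_cases:
  assumes "W \<in> perms (n + 1)"
  obtains X Y where "W = X @ (n + 1) # Y" "Y @ X \<in> perms n"
    "\<And>a. marked W a = pointed_word n (Y @ X) a"
proof -
  have "n + 1 \<in> set W" using permsD[OF assms] by simp
  then obtain X Y where W: "W = X @ (n + 1) # Y" by (metis split_list)
  then have "(Y @ X) @ [n + 1] \<in> perms (n + 1)"
    using assms perms_rotate[of "X @ [n + 1]" Y] perms_rotate[of "Y @ X" "[n+1]"]
      perms_rotate[of "[n + 1] @ Y" X]
    by simp
  then have YX: "Y @ X \<in> perms n" by (simp only: perms_snoc)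
  have "marked W a = pointed_word n (Y @ X) a" for a
    using marked_rotate[of X "[n + 1] @ Y" a] marked_rotate[of "[n + 1]" "Y @ X" a]
      marked_snoc[OF YX, of a] W by simp
  with W YX that show ?thesis by blast
qed

lemma marked_root: "W \<in> perms (n + 1) \<Longrightarrow> marked W (n + 1) = 0"
  by (erule cyclic_perms_cases) (simp add: pointed_word_absent)

lemma marked_in_SymDias:
  assumes "W \<in> perms (n + 1)"
  shows "marked W a \<in> component SymDias n"
proof -
  obtain X Y where "Y @ X \<in> perms n" "marked W a = pointed_word n (Y @ X) a"
    using cyclic_perms_cases[OF assms] by metis
  then show ?thesis
    using pointed_word_in_SymDias[of "Y @ X" n a] pointed_word_absent[of "Y @ X" n a]
      rat_vector.subspace_0[OF subspace_SymDias] by (cases "a \<in> {1..n}") auto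
qed

text \<open>
  The linear map on SymDias with prescribed values on pointed words; the coefficient of \<open>w\<close> pointed at
  \<open>a\<close> is read off with the coordinates of Dias.
\<close>

definition pointed_ext :: "nat \<Rightarrow> (nat list \<Rightarrow> nat \<Rightarrow> 'b::rat_vector) \<Rightarrow> (nat list \<Rightarrow>\<^sub>0 dias) \<Rightarrow> 'b"
  where "pointed_ext n F x = (\<Sum>w\<in>keys x. \<Sum>a\<in>{1..n}.
    coef n (word_position a w) (lookup x w) *\<^sub>Q F w a)"

lemmas coef_linear = qlinear_add[OF qlinear_coef] qlinear_scale[OF qlinear_coef]
  qlinear_zero[OF qlinear_coef]

lemma pointed_ext_superset:
  assumes "finite A" "keys x \<subseteq> A"
  shows "pointed_ext n F x = (\<Sum>w\<in>A. \<Sum>a\<in>{1..n}.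
    coef n (word_position a w) (lookup x w) *\<^sub>Q F w a)"
  unfolding pointed_ext_def
  by (rule sum_keys_superset[where F = "\<lambda>w x. \<Sum>a\<in>{1..n}.
        coef n (word_position a w) x *\<^sub>Q F w a"]) (use assms in \<open>auto simp: coef_linear\<close>)

lemma qlinear_pointed_ext: "qlinear (pointed_ext n F)"
proof -
  have "pointed_ext n F (p + q) = pointed_ext n F p + pointed_ext n F q" for p q
    using keys_add[of p q]
    by (subst (1 2 3) pointed_ext_superset[where A = "keys p \<union> keys q"])
      (auto simp: lookup_add coef_linear scaleQ_add_left sum.distrib)
  moreover have "pointed_ext n F (c *\<^sub>Q p) = c *\<^sub>Q pointed_ext n F p" for c p
    by (subst (1 2) pointed_ext_superset[where A = "keys p"])
      (auto simp: lookup_scaleQ coef_linear scaleQ_scaleQ scaleQ_rat_def in_keys_iff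
        rat_vector.scale_sum_right)
  ultimately show ?thesis by (simp add: linear_on_def)
qed

lemma word_position_inj:
  assumes "a \<in> set w" "b \<in> set w" "word_position a w = word_position b w"
  shows "a = b"
proof -
  have "w ! (word_position x w - 1) = x" if "x \<in> set w" for x
    using split_list_first[OF that] by (auto simp: word_position_split nth_append)
  with assms show ?thesis by metis
qed

lemma pointed_ext_pointed:
  assumes "w \<in> perms n" "a \<in> {1..n}"
  shows "pointed_ext n F (pointed_word n w a) = F w a"
proof -
  have w: "set w = {1..n}" "length w = n" using permsD[OF assms(1)] by auto
  have pos: "1 \<le> word_position a w" "word_position a w \<le> n"
    using word_position_bounds[of a w] assms(2) w by auto
  have "pointed_ext n F (pointed_word n w a) =
      (\<Sum>b\<in>{1..n}. coef n (word_position b w) (dias_basis n (word_position a w)) *\<^sub>Q F w b)"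
    by (subst pointed_ext_superset[where A = "{w}"]) (auto simp: pointed_word_def)
  also have "\<dots> = (\<Sum>b\<in>{1..n}. if b = a then F w b else 0)"
  proof (rule sum.cong[OF refl])
    fix b assume "b \<in> {1..n}"
    then show "coef n (word_position b w) (dias_basis n (word_position a w)) *\<^sub>Q F w b =
        (if b = a then F w b else 0)"
      using word_position_inj[of b w a] assms(2) w coef_basis[OF pos, of "word_position b w"]
      by (auto simp: scaleQ_one)
  qed
  also have "\<dots> = F w a"
    using assms(2) by simp
  finally show ?thesis .
qed

section \<open>The action on marked cyclic words\<close>

text \<open>
  Relabelling of marked cyclic words: \<open>f\<^sub>a - f\<^bsub>n+1\<^esub>\<close> goes to \<open>f\<^bsub>\<sigma>(a)\<^esub> - f\<^bsub>\<sigma>(n+1)\<^esub>\<close> on the relabelled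
  cyclic word, and both marks have to be expressed relative to the root.
\<close>

definition cyclic_act :: "nat \<Rightarrow> (nat \<Rightarrow> nat) \<Rightarrow> (nat list \<Rightarrow>\<^sub>0 dias) \<Rightarrow> (nat list \<Rightarrow>\<^sub>0 dias)" where
  "cyclic_act n \<sigma> = pointed_ext n (\<lambda>w a. marked (map \<sigma> (w @ [n + 1])) (\<sigma> a) -
     marked (map \<sigma> (w @ [n + 1])) (\<sigma> (n + 1)))"

lemma qlinear_cyclic_act: "qlinear (cyclic_act n \<sigma>)"
  by (simp add: cyclic_act_def qlinear_pointed_ext)

lemmas cyclic_act_linear =
  qlinear_add[OF qlinear_cyclic_act] qlinear_scale[OF qlinear_cyclic_act]
  qlinear_diff[OF qlinear_cyclic_act] qlinear_uminus[OF qlinear_cyclic_act]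
  qlinear_zero[OF qlinear_cyclic_act]

lemma cyclic_act_pointed:
  assumes "w \<in> perms n" "a \<in> {1..n}"
  shows "cyclic_act n \<sigma> (pointed_word n w a) = marked (map \<sigma> (w @ [n + 1])) (\<sigma> a) -
     marked (map \<sigma> (w @ [n + 1])) (\<sigma> (n + 1))"
  unfolding cyclic_act_def by (rule pointed_ext_pointed[OF assms])

lemma cyclic_act_marked:
  assumes "W \<in> perms (n + 1)" "a \<in> {1..n + 1}"
  shows "cyclic_act n \<sigma> (marked W a) = marked (map \<sigma> W) (\<sigma> a) - marked (map \<sigma> W) (\<sigma> (n + 1))"
proof -
  obtain X Y where W: "W = X @ (n + 1) # Y" "Y @ X \<in> perms n"
    "marked W a = pointed_word n (Y @ X) a"
    using cyclic_perms_cases[OF assms(1)] by metis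
  have rot: "marked (map \<sigma> W) b = marked (map \<sigma> ((Y @ X) @ [n + 1])) b" for b
    using marked_rotate[of "map \<sigma> (X @ [n + 1])" "map \<sigma> Y"] W by simp
  show ?thesis
  proof (cases "a = n + 1")
    case True
    with W show ?thesis by (simp add: pointed_word_absent cyclic_act_linear)
  next
    case False
    then have "a \<in> {1..n}" using assms(2) by auto
    then show ?thesis
      unfolding W(3) rot by (rule cyclic_act_pointed[OF W(2)])
  qed
qed

lemma SymDias_marked_span:
  "component SymDias n = rat_vector.span {marked W a |W a. W \<in> perms (n + 1) \<and> a \<in> {1..n + 1}}"
  (is "_ = rat_vector.span ?B")
proof
  show "component SymDias n \<subseteq> rat_vector.span ?B"
    unfolding SymDias_span
  proof (rule rat_vector.span_mono, rule subsetI)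
    fix x assume "x \<in> pointed_words n"
    then obtain w a where x: "x = pointed_word n w a" "w \<in> perms n" "a \<in> {1..n}"
      by (rule pointed_word_cases)
    then have "x = marked (w @ [n + 1]) a" "w @ [n + 1] \<in> perms (n + 1)" "a \<in> {1..n + 1}"
      using marked_snoc[OF x(2)] perms_snoc[of w n] by auto
    then show "x \<in> ?B" by blast
  qed
  show "rat_vector.span ?B \<subseteq> component SymDias n"
    by (rule rat_vector.span_minimal[OF _ subspace_SymDias]) (auto intro: marked_in_SymDias)
qed

lemma sym_rep_cyclic_act: "sym_rep (n + 1) (component SymDias n) (cyclic_act n)"
  unfolding sym_rep_def
proof (intro conjI allI impI ballI)
  show "rat_vector.subspace (component SymDias n)" by (rule subspace_SymDias)
next
  fix \<sigma> v assume \<sigma>: "\<sigma> permutes {1..n + 1}"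
  show "linear_on (component SymDias n) (cyclic_act n \<sigma>)"
    by (rule qlinear_imp_linear_on[OF qlinear_cyclic_act])
  assume v: "v \<in> component SymDias n"
  show "cyclic_act n \<sigma> v \<in> component SymDias n"
  proof (rule qlinear_span_image[OF qlinear_cyclic_act _ subspace_SymDias
        v[unfolded SymDias_marked_span]])
    fix x assume "x \<in> {marked W a |W a. W \<in> perms (n + 1) \<and> a \<in> {1..n + 1}}"
    then obtain W a where "x = marked W a" "W \<in> perms (n + 1)" "a \<in> {1..n + 1}" by blast
    with map_perms[OF \<sigma>] show "cyclic_act n \<sigma> x \<in> component SymDias n"
      by (simp add: cyclic_act_marked marked_in_SymDias rat_vector.subspace_diff[OF subspace_SymDias]
          del: One_nat_def)
  qed
next
  fix v assume v: "v \<in> component SymDias n"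
  show "cyclic_act n id v = v"
  proof (rule qlinear_eq_on_span[OF qlinear_cyclic_act qlinear_id v[unfolded SymDias_marked_span]])
    fix x assume "x \<in> {marked W a |W a. W \<in> perms (n + 1) \<and> a \<in> {1..n + 1}}"
    then show "cyclic_act n id x = x"
      using cyclic_act_marked[of _ n _ id] marked_root by (auto simp del: One_nat_def)
  qed
next
  fix \<sigma> \<pi> v assume \<sigma>: "\<sigma> permutes {1..n + 1}" and \<pi>: "\<pi> permutes {1..n + 1}"
    and v: "v \<in> component SymDias n"
  have lin: "qlinear (\<lambda>v. cyclic_act n \<sigma> (cyclic_act n \<pi> v))"
    by (simp add: linear_on_def cyclic_act_linear)
  show "cyclic_act n (\<sigma> \<circ> \<pi>) v = cyclic_act n \<sigma> (cyclic_act n \<pi> v)"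
  proof (rule qlinear_eq_on_span[OF qlinear_cyclic_act lin v[unfolded SymDias_marked_span]])
    fix x assume "x \<in> {marked W a |W a. W \<in> perms (n + 1) \<and> a \<in> {1..n + 1}}"
    then obtain W a where x: "x = marked W a" "W \<in> perms (n + 1)" "a \<in> {1..n + 1}" by blast
    moreover have "\<pi> a \<in> {1..n + 1}" "\<pi> (n + 1) \<in> {1..n + 1}"
      using permutes_in_image[OF \<pi>] x(3) by (blast, simp)
    ultimately show "cyclic_act n (\<sigma> \<circ> \<pi>) x = cyclic_act n \<sigma> (cyclic_act n \<pi> x)"
      using map_perms[OF \<pi>] by (simp add: cyclic_act_marked cyclic_act_linear del: One_nat_def)
  qed
qed

lemma cyclic_act_stabilizer:
  assumes \<sigma>: "\<sigma> permutes {1..n}" and f: "f \<in> component SymDias n"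
  shows "cyclic_act n \<sigma> f = act SymDias n \<sigma> f"
proof (rule qlinear_eq_on_span[OF qlinear_cyclic_act qlinear_act f[unfolded SymDias_span]])
  fix x assume "x \<in> pointed_words n"
  then obtain w a where x: "x = pointed_word n w a" "w \<in> perms n" "a \<in> {1..n}"
    by (rule pointed_word_cases)
  have fix_root: "\<sigma> (n + 1) = n + 1"
    using \<sigma> by (simp add: permutes_def)
  have w: "map \<sigma> w \<in> perms n" by (rule map_perms[OF \<sigma> x(2)])
  have "\<sigma> a \<in> {1..n}" using permutes_in_image[OF \<sigma>] x(3) by blast
  then show "cyclic_act n \<sigma> x = act SymDias n \<sigma> x"
    using x permsD[OF x(2)] permutes_inj_on[OF \<sigma>] fix_root marked_snoc[OF w]
      pointed_word_absent[OF w, of "n + 1"]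
    by (simp add: cyclic_act_pointed act_pointed del: One_nat_def)
qed

text \<open>
  Substitution commutes with rotation, and the root \<open>m + 1\<close> is renumbered like every other letter.
  So composition may be computed on the cyclic word opened anywhere.
\<close>

lemma sym_pcomp_marked:
  assumes W: "W \<in> perms (m + 1)" and a: "a \<in> {1..m + 1}" and v: "v \<in> perms n" and b: "b \<in> {1..n}"
    and i: "i \<in> {1..m}"
  shows "sym_pcomp i (marked W a) (pointed_word n v b) =
    marked (word_subst i W v) (insert_mark i n a b)"
proof -
  obtain X Y where XY: "W = X @ (m + 1) # Y" "Y @ X \<in> perms m"
    "marked W a = pointed_word m (Y @ X) a"
    using cyclic_perms_cases[OF W] by metis
  have n: "length v = n" "1 \<le> n" using permsD[OF v] b by auto
  then have mn: "m + n - 1 + 1 = m + n" by simp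
  have U: "word_subst i (Y @ X) v \<in> perms (m + n - 1)"
    by (rule word_subst_perms[OF XY(2) v i])
  have root: "letter_subst i v (m + 1) = [m + n]"
    using i n by (auto simp: letter_subst_def)
  have "marked (word_subst i W v) c = marked (word_subst i (Y @ X) v @ [m + n]) c" for c
    using marked_rotate[of "word_subst i X v @ [m + n]" "word_subst i Y v" c] XY(1) root
    by (simp add: word_subst_Cons)
  then have rot: "marked (word_subst i W v) c = pointed_word (m + n - 1) (word_subst i (Y @ X) v) c"
    for c using marked_snoc[OF U, of c] mn by simp
  show ?thesis
  proof (cases "a = m + 1")
    case True
    with i have "insert_mark i n a b = m + n" by (simp add: insert_mark_def)
    moreover have "pointed_word (m + n - 1) (word_subst i (Y @ X) v) (m + n) = 0"
      using n by (intro pointed_word_absent[OF U]) auto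
    ultimately show ?thesis
      using True XY(2,3) rot by (simp add: pointed_word_absent sym_pcomp_linear)
  next
    case False
    then have "a \<in> {1..m}" using a by auto
    then show ?thesis
      unfolding XY(3) rot by (rule sym_pcomp_pointed[OF XY(2) v i _ b])
  qed
qed

lemma long_cycle_permutes: "long_cycle n permutes {1..n + 1}"
proof (rule bij_imp_permutes)
  have "long_cycle n ` {1..n + 1} = {1..n + 1}"
  proof (intro equalityI subsetI)
    fix x assume "x \<in> {1..n + 1}"
    then show "x \<in> long_cycle n ` {1..n + 1}"
      by (intro image_eqI[of _ _ "if x = n + 1 then 1 else x + 1"]) (auto simp: long_cycle_def)
  qed (auto simp: long_cycle_def)
  then show "bij_betw (long_cycle n) {1..n + 1} {1..n + 1}"
    by (auto simp: bij_betw_def intro!: eq_card_imp_inj_on)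
qed (auto simp: long_cycle_def)

text \<open>
  The long cycle decreases each letter above \<open>1\<close>, in particular \<open>i\<close> and the block that replaces it;
  hence it commutes with the substitution up to the shift from \<open>i\<close> to \<open>i - 1\<close>.
\<close>

lemma cyclic_act_middle:
  assumes m: "1 \<le> m" "1 \<le> n" and fg: "f \<in> component SymDias m" "g \<in> component SymDias n"
    and i: "i \<in> {2..m}"
  shows "cyclic_act (m + n - 1) (long_cycle (m + n - 1)) (sym_pcomp i f g) =
    sym_pcomp (i - 1) (cyclic_act m (long_cycle m) f) g"
  using fg unfolding SymDias_span
proof (rule bilinear_eq_on_span)
  fix x y assume "x \<in> pointed_words m" "y \<in> pointed_words n"
  then obtain w a v b where *: "w \<in> perms m" "a \<in> {1..m}" "v \<in> perms n" "b \<in> {1..n}" and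
    xy: "x = pointed_word m w a" "y = pointed_word n v b"
    by (elim pointed_word_cases)
  let ?c = "long_cycle m" and ?d = "long_cycle (m + n - 1)"
  let ?W = "w @ [m + 1]"
  have W: "?W \<in> perms (m + 1)" using * by (simp only: perms_snoc)
  have x: "x = marked ?W a" using marked_snoc[OF *(1)] xy by simp
  have i': "i \<in> {1..m}" "i - 1 \<in> {1..m}" and a: "a \<in> {1..m + 1}" using i * by auto
  have v: "length v = n" "set v = {1..n}" using permsD[OF *(3)] by auto
  have mark: "?d (insert_mark i n c b) = insert_mark (i - 1) n (?c c) b" if "c \<in> {1..m + 1}" for c
    using that i *(4) by (cases c i rule: linorder_cases) (auto simp: insert_mark_def long_cycle_def)
  have letter: "map ?d (letter_subst i v c) = letter_subst (i - 1) v (?c c)"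
    if "c \<in> {1..m + 1}" for c
  proof (cases "c = i")
    case True
    have "?d (b + i - 1) = b + (i - 1) - 1" if "b \<in> {1..n}" for b
      using that i by (auto simp: long_cycle_def)
    with True i show ?thesis
      using v by (auto simp: letter_subst_def long_cycle_def)
  next
    case False
    then have "?c c \<noteq> i - 1" using that i by (auto simp: long_cycle_def)
    with False show ?thesis
      using mark[OF that] v
      by (simp add: letter_subst_other[of c i v b] letter_subst_other[of "?c c" "i - 1" v b]
          del: One_nat_def)
  qed
  have subst: "map ?d (word_subst i ?W v) = word_subst (i - 1) (map ?c ?W) v"
    unfolding word_subst_eq map_concat map_map comp_def
    using permsD[OF W] by (intro arg_cong[of _ _ concat] map_cong refl letter) auto
  have U: "word_subst i ?W v \<in> perms (m + n - 1 + 1)"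
    using word_subst_perms[OF W *(3), of i] i' m(2) by (simp del: One_nat_def)
  have a': "insert_mark i n a b \<in> {1..m + n - 1 + 1}"
    using insert_mark_bounds[of i m a b n] i' * by auto
  have "m + n - 1 + 1 = insert_mark i n (m + 1) b"
    using i m by (simp add: insert_mark_def)
  then have root: "?d (m + n - 1 + 1) = insert_mark (i - 1) n (?c (m + 1)) b"
    using mark[of "m + 1"] by simp
  have c: "?c a \<in> {1..m + 1}" "?c (m + 1) \<in> {1..m + 1}"
    using permutes_in_image[OF long_cycle_permutes, of m] a by (blast, simp)
  have cW: "map ?c ?W \<in> perms (m + 1)" by (rule map_perms[OF long_cycle_permutes W])
  have "cyclic_act (m + n - 1) ?d (sym_pcomp i x y) =
      cyclic_act (m + n - 1) ?d (marked (word_subst i ?W v) (insert_mark i n a b))"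
    unfolding x xy(2) by (simp only: sym_pcomp_marked[OF W a *(3,4) i'(1)])
  also have "\<dots> = marked (word_subst (i - 1) (map ?c ?W) v) (insert_mark (i - 1) n (?c a) b) -
      marked (word_subst (i - 1) (map ?c ?W) v) (insert_mark (i - 1) n (?c (m + 1)) b)"
    by (simp only: cyclic_act_marked[OF U a'] subst mark[OF a] root)
  also have "\<dots> = sym_pcomp (i - 1) (cyclic_act m ?c x) y"
    unfolding x xy(2)
    by (simp only: cyclic_act_marked[OF W a] sym_pcomp_linear
        sym_pcomp_marked[OF cW c(1) *(3,4) i'(2)] sym_pcomp_marked[OF cW c(2) *(3,4) i'(2)])
  finally show "cyclic_act (m + n - 1) ?d (sym_pcomp i x y) =
      sym_pcomp (i - 1) (cyclic_act m ?c x) y" .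
qed (simp_all add: linear_on_def sym_pcomp_linear cyclic_act_linear)

text \<open>
  When the letter \<open>1\<close> becomes the root, the two factors exchange their roles: both composites glue the
  same two cyclic words together, one factor being opened at its root and the other one at a letter.
  For coefficient vectors \<open>x\<close> and \<open>y\<close> of marks, opened at \<open>i\<close> and at the root \<open>r\<close>, gluing gives
  \<open>x\<^sub>i y - y\<^sub>r x\<close> on the remaining letters, which is antisymmetric; this explains the sign.
\<close>

lemma cyclic_act_first:
  assumes m: "1 \<le> m" "1 \<le> n" and fg: "f \<in> component SymDias m" "g \<in> component SymDias n"
  shows "cyclic_act (m + n - 1) (long_cycle (m + n - 1)) (sym_pcomp 1 f g) =
    - sym_pcomp n (cyclic_act n (long_cycle n) g) (cyclic_act m (long_cycle m) f)"
  using fg unfolding SymDias_span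
proof (rule bilinear_eq_on_span)
  fix x y assume "x \<in> pointed_words m" "y \<in> pointed_words n"
  then obtain w a v b where *: "w \<in> perms m" "a \<in> {1..m}" "v \<in> perms n" "b \<in> {1..n}" and
    xy: "x = pointed_word m w a" "y = pointed_word n v b"
    by (elim pointed_word_cases)
  let ?c = "long_cycle m" and ?d = "long_cycle (m + n - 1)" and ?e = "long_cycle n"
  have v: "length v = n" "set v = {1..n}" and w: "distinct w" "set w = {1..m}"
    using permsD[OF *(1)] permsD[OF *(3)] by auto
  have "1 \<in> set w" using w m by simp
  then obtain X Y where XY: "w = X @ 1 # Y" by (metis split_list)
  have XY_letters: "2 \<le> z \<and> z \<le> m" if "z \<in> set X \<union> set Y" for z
  proof -
    have "z \<in> {1..m}" "z \<noteq> 1" using that XY w by auto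
    then show ?thesis by auto
  qed
  let ?W = "w @ [m + 1]" and ?V = "v @ [n + 1]"
  have W: "?W \<in> perms (m + 1)" and V: "?V \<in> perms (n + 1)" using * by (simp_all only: perms_snoc)
  \<comment> \<open>the word of \<open>\<tau>(f)\<close>: the relabelled cyclic word, read from its new root on\<close>
  define u where "u = map ?c Y @ m # map ?c X"
  have cW: "map ?c ?W = map ?c X @ (m + 1) # map ?c Y @ [m]"
    using XY m by (simp add: long_cycle_def)
  have "map ?c ?W \<in> perms (m + 1)" by (rule map_perms[OF long_cycle_permutes W])
  then have "u @ [m + 1] \<in> perms (m + 1)"
    unfolding cW u_def using perms_rotate[of "map ?c X @ [m + 1]" "map ?c Y @ [m]"] by simp
  then have u: "u \<in> perms m" by (simp only: perms_snoc)
  have marked_cW: "marked (map ?c ?W) z = pointed_word m u z" for z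
    using marked_rotate[of "map ?c X @ [m + 1]" "map ?c Y @ [m]" z] marked_snoc[OF u, of z]
    unfolding cW u_def by simp
  have f: "cyclic_act m ?c x = pointed_word m u (?c a) - pointed_word m u m"
    using cyclic_act_pointed[OF *(1,2), of ?c] m unfolding marked_cW xy
    by (simp add: long_cycle_def[of m "Suc m"])
  have cV: "map ?e ?V \<in> perms (n + 1)" by (rule map_perms[OF long_cycle_permutes V])
  have g: "cyclic_act n ?e y = marked (map ?e ?V) (?e b) - marked (map ?e ?V) n"
    using cyclic_act_pointed[OF *(3,4), of ?e] m xy by (simp add: long_cycle_def[of n "Suc n"])
  \<comment> \<open>the cyclic word that both sides have in common; only the marks remain to be compared\<close>
  define R where "R = word_subst n (map ?e ?V) u"
  have lu: "length u = m" using permsD[OF u] by simp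
  have e: "?e z \<noteq> n" "insert_mark n m (?e z) z' = ?d z" if "z \<in> {1..n}" for z z'
    using that m by (auto simp: long_cycle_def insert_mark_def)
  have "word_subst n (map ?e v) u = map ?d v"
  proof -
    have "map (letter_subst n u) (map ?e v) = map (\<lambda>z. [?d z]) v"
      using e v lu by (auto simp: letter_subst_other[of _ n u 1])
    then show ?thesis by (simp only: word_subst_eq concat_map_singleton)
  qed
  moreover have "letter_subst n u (?e (n + 1)) = map (\<lambda>z. z + n - 1) u"
    using m by (simp add: long_cycle_def letter_subst_def)
  ultimately have R: "R = (map ?d v @ map (\<lambda>z. z + n - 1) (map ?c Y @ [m])) @
      map (\<lambda>z. z + n - 1) (map ?c X)"
    by (simp add: R_def word_subst_Cons u_def) (simp add: word_subst_eq)
  have "map ?d (word_subst 1 ?W v) = map (\<lambda>z. z + n - 1) (map ?c X) @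
      (map ?d v @ map (\<lambda>z. z + n - 1) (map ?c Y @ [m]))"
  proof -
    have "map ?d (word_subst 1 Z v) = map (\<lambda>z. z + n - 1) (map ?c Z)"
      if "\<And>z. z \<in> set Z \<Longrightarrow> 2 \<le> z \<and> z \<le> m + 1" for Z
    proof -
      have "map (\<lambda>z. map ?d (letter_subst 1 v z)) Z = map (\<lambda>z. [?c z + n - 1]) Z"
        using that v m by (auto simp: letter_subst_def long_cycle_def dest!: that)
      then have "concat (map (\<lambda>z. map ?d (letter_subst 1 v z)) Z) = map (\<lambda>z. ?c z + n - 1) Z"
        by (simp only: concat_map_singleton)
      then show ?thesis by (simp add: word_subst_eq map_concat comp_def)
    qed
    note sub = this
    have "map ?d (word_subst 1 X v) = map (\<lambda>z. z + n - 1) (map ?c X)"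
      by (rule sub) (use XY_letters in fastforce)
    moreover have "map ?d (word_subst 1 (Y @ [m + 1]) v) = map (\<lambda>z. z + n - 1) (map ?c (Y @ [m + 1]))"
      by (rule sub) (use XY_letters m in fastforce)
    moreover have "letter_subst 1 v 1 = v"
      by (simp add: letter_subst_def)
    moreover have "?c (m + 1) = m" using m by (simp add: long_cycle_def)
    ultimately show ?thesis
      unfolding XY by (simp add: word_subst_Cons del: One_nat_def)
  qed
  then have dW: "marked (map ?d (word_subst 1 ?W v)) z = marked R z" for z
    unfolding R using marked_rotate by metis
  have one: "1 \<in> {1..m}" and nn: "n \<in> {1..n}" using m by auto
  have U: "word_subst 1 ?W v \<in> perms (m + n - 1 + 1)"
    using word_subst_perms[OF W *(3), of 1] m by (simp del: One_nat_def)
  have root: "?d (m + n - 1 + 1) = m + n - 1"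
    using m by (simp add: long_cycle_def)
  have a': "insert_mark 1 n a b \<in> {1..m + n - 1 + 1}" and a1: "a \<in> {1..m + 1}"
    using insert_mark_bounds[of 1 m a b n] * m by auto
  have "sym_pcomp 1 x y = marked (word_subst 1 ?W v) (insert_mark 1 n a b)"
    using sym_pcomp_marked[OF W a1 *(3,4) one] marked_snoc[OF *(1)] xy by simp
  then have L: "cyclic_act (m + n - 1) ?d (sym_pcomp 1 x y) =
      marked R (?d (insert_mark 1 n a b)) - marked R (m + n - 1)"
    using cyclic_act_marked[OF U a', of ?d] unfolding dW root by simp
  have comp: "sym_pcomp n (marked (map ?e ?V) z) (pointed_word m u z') =
      marked R (insert_mark n m z z')" if "z \<in> {1..n + 1}" "z' \<in> {1..m}" for z z'
    unfolding R_def by (rule sym_pcomp_marked[OF cV that(1) u that(2) nn])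
  have eb: "?e b \<in> {1..n + 1}" "n \<in> {1..n + 1}" "m \<in> {1..m}"
    using permutes_in_image[OF long_cycle_permutes, of n b] *(4) m by auto
  have inner: "sym_pcomp n (cyclic_act n ?e y) (pointed_word m u z) =
      marked R (?d b) - marked R (z + n - 1)" if "z \<in> {1..m}" for z
    unfolding g sym_pcomp_linear comp[OF eb(1) that] comp[OF eb(2) that] e(2)[OF *(4)]
    by (simp add: insert_mark_def)
  have mn: "m + n - 1 = n + m - 1" by simp
  show "cyclic_act (m + n - 1) ?d (sym_pcomp 1 x y) =
      - sym_pcomp n (cyclic_act n ?e y) (cyclic_act m ?c x)"
  proof (cases "a = 1")
    case True
    then have "pointed_word m u (?c a) = 0"
      by (intro pointed_word_absent[OF u]) (simp add: long_cycle_def)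
    moreover have "insert_mark 1 n a b = b"
      using True by (simp add: insert_mark_def)
    ultimately show ?thesis
      unfolding L f by (simp add: sym_pcomp_linear inner[OF eb(3)])
  next
    case False
    then have ca: "?c a = a - 1" "?c a \<in> {1..m}" using *(2) by (auto simp: long_cycle_def)
    moreover have "?d (insert_mark 1 n a b) = ?c a + n - 1"
      using False *(2) m by (auto simp: long_cycle_def insert_mark_def)
    ultimately show ?thesis
      unfolding L f sym_pcomp_linear inner[OF eb(3)] inner[OF ca(2)] by simp
  qed
qed (simp_all add: linear_on_def sym_pcomp_linear cyclic_act_linear)

section \<open>The anticyclic structure is determined\<close>

lemma is_anticyclic_operad_cyclic_act: "is_anticyclic_operad SymDias cyclic_act"
  unfolding is_anticyclic_operad_def anticyclic_identities_def
proof (intro conjI allI impI ballI)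
  show "is_operad SymDias" by (rule is_operad_SymDias)
  show "sym_rep (n + 1) (component SymDias n) (cyclic_act n)" for n
    by (rule sym_rep_cyclic_act)
  show "cyclic_act n \<sigma> f = act SymDias n \<sigma> f"
    if "\<sigma> permutes {1..n}" "f \<in> component SymDias n" for n \<sigma> f
    by (rule cyclic_act_stabilizer[OF that])
  show "cyclic_act (m + n - 1) (long_cycle (m + n - 1)) (sym_pcomp i f g) =
      sym_pcomp (i - 1) (cyclic_act m (long_cycle m) f) g"
    if "1 \<le> m" "1 \<le> n" "f \<in> component SymDias m" "g \<in> component SymDias n" "i \<in> {2..m}"
    for m n i f g by (rule cyclic_act_middle[OF that])
  show "cyclic_act (m + n - 1) (long_cycle (m + n - 1)) (sym_pcomp 1 f g) =
      - sym_pcomp n (cyclic_act n (long_cycle n) g) (cyclic_act m (long_cycle m) f)"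
    if "1 \<le> m" "1 \<le> n" "f \<in> component SymDias m" "g \<in> component SymDias n"
    for m n f g by (rule cyclic_act_first[OF that])
  have "[1] @ [1 + 1] \<in> perms (1 + 1)" using one_perms by (simp only: perms_snoc)
  then have "map (long_cycle 1) ([1] @ [1 + 1]) \<in> perms (1 + 1)"
    using map_perms[OF long_cycle_permutes] by blast
  moreover have "map (long_cycle 1) ([1] @ [1 + 1]) = [1 + 1] @ [1]"
    by (simp add: long_cycle_def)
  ultimately show "cyclic_act 1 (long_cycle 1) (ns_operad.unit SymDias) = - ns_operad.unit SymDias"
    using cyclic_act_pointed[OF one_perms, of 1 "long_cycle 1"] marked_rotate[of "[1 + 1]" "[1]"]
      marked_snoc[OF one_perms] marked_root[of "[1] @ [1 + 1]" 1] pointed_word_absent[OF one_perms, of "Suc (Suc 0)"]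
    by (simp add: SymDias_unit long_cycle_def)
qed

lemma upt_perms: "[1..<n + 1] \<in> perms n"
  by (intro permsI) auto

lemma word_position_upt: "1 \<le> k \<Longrightarrow> k \<le> n \<Longrightarrow> word_position k [1..<n + 1] = k"
proof -
  assume k: "1 \<le> k" "k \<le> n"
  have "[1..<n + 1] = [1..<k] @ k # [k + 1..<n + 1]"
    using k by (metis le_imp_less_Suc Suc_eq_plus1 upt_conv_Cons upt_add_eq_append le_Suc_ex
        less_imp_le_nat)
  then show ?thesis
    using word_position_split[of k "[1..<k]" "[k + 1..<n + 1]"] k by simp
qed

lemma cyclic_act_long_cycle:
  assumes n: "1 \<le> n" and E: "E \<in> component Dias n"
  shows "cyclic_act n (long_cycle n) (single [1..<n + 1] E) =
    single [1..<n + 1] (dias_tau n E)"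
proof -
  let ?w = "[1..<n + 1]" and ?c = "long_cycle n"
  have lin1: "qlinear (\<lambda>E. cyclic_act n ?c (single ?w E))"
    and lin2: "qlinear (\<lambda>E. single ?w (dias_rotate n E))"
    by (simp_all add: linear_on_def single_add single_scaleQ cyclic_act_linear dias_rotate_linear)
  have single: "single ?w (dias_basis n k) = pointed_word n ?w k" if "k \<le> n" for k
  proof (cases "k = 0")
    case True
    then show ?thesis
      using pointed_word_absent[OF upt_perms, of 0 n] by (simp del: upt_Suc)
  next
    case False
    then show ?thesis using word_position_upt[of k n] that by (simp add: pointed_word_def)
  qed
  have "cyclic_act n ?c (single ?w E) =
      single ?w (dias_rotate n E)"
  proof (rule qlinear_eq_on_Dias[OF E lin1 lin2])
    fix k assume k: "1 \<le> k" "k \<le> n"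
    have "map ?c (?w @ [n + 1]) = [n + 1] @ ?w"
    proof (rule nth_equalityI)
      fix i assume "i < length (map ?c (?w @ [n + 1]))"
      then show "map ?c (?w @ [n + 1]) ! i = ([n + 1] @ ?w) ! i"
        using n by (auto simp: long_cycle_def nth_append nth_Cons' simp del: upt_Suc)
    qed simp
    then have "marked (map ?c (?w @ [n + 1])) z = pointed_word n ?w z" for z
      using marked_rotate[of "[n + 1]" ?w] marked_snoc[OF upt_perms] by simp
    then have "cyclic_act n ?c (pointed_word n ?w k) =
        pointed_word n ?w (?c k) - pointed_word n ?w (?c (n + 1))"
      using cyclic_act_pointed[OF upt_perms, of k n ?c] k by simp
    also have "pointed_word n ?w (?c k) = pointed_word n ?w (k - 1)"
      using k pointed_word_absent[OF upt_perms[of n]] by (auto simp: long_cycle_def)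
    also have "?c (n + 1) = n" using n by (simp add: long_cycle_def)
    finally show "cyclic_act n ?c (single ?w (dias_basis n k)) =
        single ?w (dias_rotate n (dias_basis n k))"
      using k single[of k] single[of "k - 1"] single[of n]
      by (simp add: dias_rotate_basis single_diff)
  qed
  then show ?thesis using dias_tau_eq_rotate[OF E n] by simp
qed

definition extends_dias_tau ::
    "(nat \<Rightarrow> (nat \<Rightarrow> nat) \<Rightarrow> (nat list \<Rightarrow>\<^sub>0 dias) \<Rightarrow> (nat list \<Rightarrow>\<^sub>0 dias)) \<Rightarrow> bool" where
  "extends_dias_tau \<alpha> \<longleftrightarrow> is_anticyclic_operad SymDias \<alpha> \<and>
     (\<forall>n\<ge>1. \<forall>E\<in>component Dias n. \<alpha> n (long_cycle n) (single [1..<n + 1] E) =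
        single [1..<n + 1] (dias_tau n E))"

lemma extends_dias_tau_cyclic_act: "extends_dias_tau cyclic_act"
  unfolding extends_dias_tau_def
  using is_anticyclic_operad_cyclic_act cyclic_act_long_cycle by blast

lemma extends_dias_tau_SymDias_action: "extends_dias_tau SymDias_action"
proof -
  have "extends_dias_tau (SOME \<alpha>. extends_dias_tau \<alpha>)"
    by (rule someI[of extends_dias_tau, OF extends_dias_tau_cyclic_act])
  then show ?thesis
    unfolding SymDias_action_def symmetrization_anticyclic_def extends_dias_tau_def .
qed

lemma permutation_of_word:
  assumes "w \<in> perms n"
  obtains \<pi> where "\<pi> permutes {1..n}" "map \<pi> [1..<n + 1] = w"
proof
  let ?\<pi> = "\<lambda>i. if i \<in> {1..n} then w ! (i - 1) else i"
  have w: "distinct w" "set w = {1..n}" "length w = n" using permsD[OF assms] by auto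
  show m: "map ?\<pi> [1..<n + 1] = w"
    by (rule nth_equalityI) (use w in \<open>auto simp del: upt_Suc\<close>)
  show "?\<pi> permutes {1..n}"
  proof (rule bij_imp_permutes)
    have "?\<pi> ` {1..n} = set (map ?\<pi> [1..<n + 1])" by auto
    then have "?\<pi> ` {1..n} = {1..n}" unfolding m w(2) .
    then show "bij_betw ?\<pi> {1..n} {1..n}"
      unfolding bij_betw_def using eq_card_imp_inj_on[of "{1..n}" ?\<pi>] by simp
  qed auto
qed

lemma long_cycle_power: "1 \<le> j \<Longrightarrow> j \<le> n + 1 \<Longrightarrow> (long_cycle n ^^ j) j = n + 1"
proof (induction j)
  case (Suc j)
  show ?case
  proof (cases "j = 0")
    case False
    then have "long_cycle n (Suc j) = j" using Suc.prems by (simp add: long_cycle_def)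
    with False Suc show ?thesis by (simp add: funpow_swap1)
  qed (simp add: long_cycle_def)
qed simp

lemma permutes_funpow: "\<sigma> permutes A \<Longrightarrow> (\<sigma> ^^ k) permutes A"
  by (induction k) (auto intro: permutes_compose permutes_id simp: id_def[symmetric])

text \<open>
  The stabilizer of \<open>n + 1\<close> and the powers of the long cycle exhaust the symmetric group, since some
  power of the long cycle moves any given letter to \<open>n + 1\<close>.
\<close>

lemma coset_decomposition:
  assumes "\<theta> permutes {1..n + 1}"
  obtains \<sigma> k where "\<sigma> permutes {1..n}" "\<theta> = \<sigma> \<circ> (long_cycle n ^^ k)"
proof
  define k where "k = inv \<theta> (n + 1)"
  let ?p = "long_cycle n ^^ k"
  have k: "1 \<le> k" "k \<le> n + 1"
    using permutes_in_image[OF permutes_inv[OF assms], of "n + 1"] by (auto simp: k_def)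
  have p: "?p permutes {1..n + 1}"
    by (rule permutes_funpow[OF long_cycle_permutes])
  show "\<theta> = (\<theta> \<circ> inv ?p) \<circ> ?p"
    using permutes_inv_o(2)[OF p] by (simp add: comp_assoc)
  have "inv ?p (n + 1) = k"
    using long_cycle_power[OF k] permutes_inverses(2)[OF p, of k] by simp
  then have "(\<theta> \<circ> inv ?p) (n + 1) = n + 1"
    using permutes_inverses(1)[OF assms] by (simp add: k_def)
  moreover have "(\<theta> \<circ> inv ?p) permutes {1..n + 1}"
    by (intro permutes_compose permutes_inv p assms)
  ultimately show "(\<theta> \<circ> inv ?p) permutes {1..n}"
    by (elim permutes_superset) (auto simp: le_Suc_eq)
qed

text \<open>
  Relabelling \<open>E \<otimes> 1\<close> gives \<open>E \<otimes> w\<close>, so the value is that of one permutation on \<open>E \<otimes> 1\<close>, which the coset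
  decomposition reduces to the given actions of the stabilizer and of the long cycle.
\<close>

lemma extends_dias_tau_determined:
  assumes n: "1 \<le> n" and \<sigma>: "\<sigma> permutes {1..n + 1}" and w: "w \<in> perms n" and E: "E \<in> component Dias n"
  obtains y where "\<And>\<alpha>. extends_dias_tau \<alpha> \<Longrightarrow> \<alpha> n \<sigma> (single w E) = y"
proof -
  let ?w = "[1..<n + 1]" and ?c = "long_cycle n"
  obtain \<pi> where \<pi>: "\<pi> permutes {1..n}" "map \<pi> ?w = w"
    by (rule permutation_of_word[OF w])
  have \<pi>': "\<pi> permutes {1..n + 1}"
    by (rule permutes_subset[OF \<pi>(1)]) auto
  obtain \<rho> k where \<rho>: "\<rho> permutes {1..n}" "\<sigma> \<circ> \<pi> = \<rho> \<circ> (?c ^^ k)"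
    by (rule coset_decomposition[OF permutes_compose[OF \<pi>' \<sigma>]])
  have \<rho>': "\<rho> permutes {1..n + 1}"
    by (rule permutes_subset[OF \<rho>(1)]) auto
  have single: "single v F \<in> component SymDias n" if "v \<in> perms n" "F \<in> component Dias n"
    for v F
    using that rat_vector.subspace_0[OF subspace_Dias]
    by (auto simp: SymDias_component lookup_single when_def split: if_splits)
  have tau: "(dias_tau n ^^ j) E \<in> component Dias n" for j
    using dias_tau_spec(1) n E by (induction j) (auto simp: is_ns_anticyclic_operad_def)
  have "\<alpha> n \<sigma> (single w E) =
      act SymDias n \<rho> (single ?w ((dias_tau n ^^ k) E))"
    if \<alpha>: "extends_dias_tau \<alpha>" for \<alpha>
  proof -
    have rep: "sym_rep (n + 1) (component SymDias n) (\<alpha> n)"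
      and stab: "\<And>\<sigma> f. \<sigma> permutes {1..n} \<Longrightarrow> f \<in> component SymDias n \<Longrightarrow>
        \<alpha> n \<sigma> f = act SymDias n \<sigma> f"
      and cyc: "\<And>F. F \<in> component Dias n \<Longrightarrow> \<alpha> n ?c (single ?w F) =
        single ?w (dias_tau n F)"
      using \<alpha> n by (auto simp: extends_dias_tau_def is_anticyclic_operad_def simp del: upt_Suc)
    have comp: "\<alpha> n (\<sigma> \<circ> \<pi>) v = \<alpha> n \<sigma> (\<alpha> n \<pi> v)"
      if "\<sigma> permutes {1..n + 1}" "\<pi> permutes {1..n + 1}" "v \<in> component SymDias n" for \<sigma> \<pi> v
      using rep that unfolding sym_rep_def by blast
    have pow: "\<alpha> n (?c ^^ j) (single ?w E) =
        single ?w ((dias_tau n ^^ j) E)" for j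
    proof (induction j)
      case 0
      have "\<alpha> n id v = v" if "v \<in> component SymDias n" for v
        using rep that unfolding sym_rep_def by blast
      with single[OF upt_perms E] show ?case by (simp add: id_def)
    next
      case (Suc j)
      have "\<alpha> n (?c \<circ> (?c ^^ j)) (single ?w E) =
          \<alpha> n ?c (\<alpha> n (?c ^^ j) (single ?w E))"
        by (rule comp[OF long_cycle_permutes permutes_funpow[OF long_cycle_permutes]
              single[OF upt_perms E]])
      also have "\<dots> = single ?w ((dias_tau n ^^ Suc j) E)"
        unfolding Suc using cyc[OF tau] by simp
      finally show ?case by (simp only: funpow.simps)
    qed
    have "single w E = \<alpha> n \<pi> (single ?w E)"
      using stab[OF \<pi>(1) single[OF upt_perms E]] \<pi>(2) act_single by metis
    then have "\<alpha> n \<sigma> (single w E) = \<alpha> n (\<sigma> \<circ> \<pi>) (single ?w E)"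
      using comp[OF \<sigma> \<pi>' single[OF upt_perms E]] by simp
    also have "\<dots> = \<alpha> n \<rho> (\<alpha> n (?c ^^ k) (single ?w E))"
      unfolding \<rho>(2)
      by (rule comp[OF \<rho>' permutes_funpow[OF long_cycle_permutes] single[OF upt_perms E]])
    also have "\<dots> = act SymDias n \<rho> (single ?w ((dias_tau n ^^ k) E))"
      unfolding pow by (rule stab[OF \<rho>(1) single[OF upt_perms tau]])
    finally show ?thesis .
  qed
  with that show ?thesis by blast
qed

lemma SymDias_action_eq:
  assumes n: "1 \<le> n" and \<sigma>: "\<sigma> permutes {1..n + 1}" and f: "f \<in> component SymDias n"
  shows "SymDias_action n \<sigma> f = cyclic_act n \<sigma> f"
proof -
  have rep: "sym_rep (n + 1) (component SymDias n) (SymDias_action n)"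
    using extends_dias_tau_SymDias_action n
    by (auto simp: extends_dias_tau_def is_anticyclic_operad_def)
  then have "linear_on (component SymDias n) (SymDias_action n \<sigma>)"
    using \<sigma> unfolding sym_rep_def by blast
  moreover have "SymDias_action n \<sigma> b = cyclic_act n \<sigma> b" if b: "b \<in> pointed_words n" for b
  proof -
    obtain w a where b: "b = pointed_word n w a" "w \<in> perms n"
      using b by (rule pointed_word_cases)
    obtain y where "\<And>\<alpha>. extends_dias_tau \<alpha> \<Longrightarrow> \<alpha> n \<sigma> b = y"
      using extends_dias_tau_determined[OF n \<sigma> b(2) basis_in_Dias[of n "word_position a w"]]
      unfolding b(1) pointed_word_def by blast
    then show ?thesis
      using extends_dias_tau_SymDias_action extends_dias_tau_cyclic_act by metis
  qed
  ultimately show ?thesis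
    using linear_on_eq_on_span[OF _ qlinear_imp_linear_on[OF qlinear_cyclic_act]] f
    unfolding SymDias_span by blast
qed

section \<open>The free associative algebra\<close>

text \<open>
  With concatenation as addition of exponents, finitely supported functions on words become the
  monoid algebra of the free monoid, that is the free associative algebra.
\<close>

instantiation list :: (type) monoid_add
begin

definition zero_list :: "'a list" where "zero_list = []"

definition plus_list :: "'a list \<Rightarrow> 'a list \<Rightarrow> 'a list" where "plus_list = (@)"

instance
  by standard (simp_all add: zero_list_def plus_list_def)

end

abbreviation word_vec :: "nat list \<Rightarrow> (nat list \<Rightarrow>\<^sub>0 rat)" where
  "word_vec w \<equiv> single w 1"

lemma word_vec_mult: "word_vec u * word_vec v = word_vec (u @ v)"
  by (simp add: mult_single plus_list_def)

lemma scaleQ_eq_mult: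
  fixes p :: "'a list \<Rightarrow>\<^sub>0 rat"
  shows "c *\<^sub>Q p = single 0 c * p" and "c *\<^sub>Q p = p * single 0 c"
proof -
  show "c *\<^sub>Q p = single 0 c * p"
    by (subst (1 2) poly_mapping_expansion[of p])
      (simp add: rat_vector.scale_sum_right sum_distrib_left mult_single
        scaleQ_rat_def flip: single_scaleQ)
  show "c *\<^sub>Q p = p * single 0 c"
    by (subst (1 2) poly_mapping_expansion[of p])
      (simp add: rat_vector.scale_sum_right sum_distrib_right mult_single
        scaleQ_rat_def mult.commute flip: single_scaleQ)
qed

lemma qlinear_mult:
  fixes q :: "'a list \<Rightarrow>\<^sub>0 rat"
  shows "qlinear (\<lambda>p. p * q)" and "qlinear (\<lambda>p. q * p)"
proof -
  have "(c *\<^sub>Q p) * q = c *\<^sub>Q (p * q)" for c p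
    by (simp only: scaleQ_eq_mult(1) mult.assoc)
  then show "qlinear (\<lambda>p. p * q)" by (simp add: linear_on_def distrib_right)
  have "q * (c *\<^sub>Q p) = c *\<^sub>Q (q * p)" for c p
    by (simp only: scaleQ_eq_mult(2) mult.assoc)
  then show "qlinear (\<lambda>p. q * p)" by (simp add: linear_on_def distrib_left)
qed

lemma span_singles: "p \<in> rat_vector.span (range (\<lambda>k. single k (1::rat)))"
proof -
  have "ext (\<lambda>k. single k (1::rat)) p \<in>
      rat_vector.span (range (\<lambda>k. single k (1::rat)))"
    unfolding ext_def by (intro rat_vector.span_sum rat_vector.span_scale rat_vector.span_base) auto
  then show ?thesis by (simp add: ext_self)
qed

text \<open>
  Identities between bilinear expressions in the free associative algebra reduce to words.
\<close>

lemma bilinear_eq_on_singles: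
  assumes "\<And>q. qlinear (\<lambda>p. F p q)" "\<And>p. qlinear (F p)"
    "\<And>q. qlinear (\<lambda>p. G p q)" "\<And>p. qlinear (G p)"
    "\<And>k l. F (single k (1::rat)) (single l (1::rat)) =
      G (single k 1) (single l 1)"
  shows "F p q = G p q"
  using span_singles[of p] span_singles[of q]
  by (rule bilinear_eq_on_span) (use assms in auto)

lemma qlinear_compose: "qlinear f \<Longrightarrow> qlinear g \<Longrightarrow> qlinear (\<lambda>x. f (g x))"
  by (simp add: linear_on_def)

lemma ext_mult:
  fixes F :: "nat list \<Rightarrow> (nat list \<Rightarrow>\<^sub>0 rat)"
  assumes "\<And>u v. F (u @ v) = F u * F v"
  shows "ext F (p * q) = ext F p * ext F q"
  by (rule bilinear_eq_on_singles[where F = "\<lambda>p q. ext F (p * q)"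
        and G = "\<lambda>p q. ext F p * ext F q"])
    (auto intro: qlinear_compose[OF qlinear_ext] qlinear_compose[OF qlinear_mult(1) qlinear_ext]
      qlinear_compose[OF qlinear_mult(2) qlinear_ext] qlinear_mult
      simp: word_vec_mult ext_single scaleQ_one assms)

lemma ext_trace:
  fixes F :: "nat list \<Rightarrow> 'b::rat_vector"
  assumes "\<And>u v. F (u @ v) = F (v @ u)"
  shows "ext F (p * q) = ext F (q * p)"
  by (rule bilinear_eq_on_singles[where F = "\<lambda>p q. ext F (p * q)"
        and G = "\<lambda>p q. ext F (q * p)"])
    (auto intro: qlinear_compose[OF qlinear_ext] qlinear_mult
      simp: word_vec_mult ext_single scaleQ_one assms)

lemma ext_mult_word_vec: "ext F (p * word_vec v) = ext (\<lambda>u. F (u @ v)) p"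
proof -
  have "qlinear (\<lambda>p. ext F (p * word_vec v))"
    by (rule qlinear_compose[OF qlinear_ext qlinear_mult(1)])
  from qlinear_eq_ext[OF this] show ?thesis
    by (simp add: word_vec_mult ext_single scaleQ_one)
qed

definition relabel :: "(nat \<Rightarrow> nat) \<Rightarrow> (nat list \<Rightarrow>\<^sub>0 rat) \<Rightarrow> (nat list \<Rightarrow>\<^sub>0 rat)" where
  "relabel \<sigma> = ext (\<lambda>w. word_vec (map \<sigma> w))"

text \<open>
  The image of a bracket monomial in the free associative algebra.
\<close>

primrec expand :: "lie_monomial \<Rightarrow> (nat list \<Rightarrow>\<^sub>0 rat)" where
  "expand (Var i) = word_vec [i]"
| "expand (Bracket a b) = expand a * expand b - expand b * expand a"

lemma keys_expand: "w \<in> keys (expand L) \<Longrightarrow> mset w = mset (variables L)"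
proof (induction L arbitrary: w)
  case (Bracket a b)
  have "w \<in> keys (expand a * expand b) \<union> keys (expand b * expand a)"
    using Bracket.prems keys_diff by fastforce
  then have "\<exists>u v. (w = u @ v \<or> w = v @ u) \<and> u \<in> keys (expand a) \<and>
      v \<in> keys (expand b)"
    using keys_mult[of "expand a" "expand b"] keys_mult[of "expand b" "expand a"]
    unfolding plus_list_def by blast
  with Bracket.IH show ?case by auto
qed auto

lemma mset_eq_perms: "mset u = mset v \<Longrightarrow> u \<in> perms n \<longleftrightarrow> v \<in> perms n"
  by (metis mem_Collect_eq mset_eq_imp_distinct_iff mset_eq_setD permutations_of_set_def)

lemma keys_expand_perms:
  "variables L \<in> perms n \<Longrightarrow> w \<in> keys (expand L) \<Longrightarrow> w \<in> perms n"
  using keys_expand mset_eq_perms by blast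

primrec lie_bind :: "(nat \<Rightarrow> lie_monomial) \<Rightarrow> lie_monomial \<Rightarrow> lie_monomial" where
  "lie_bind g (Var i) = g i"
| "lie_bind g (Bracket a b) = Bracket (lie_bind g a) (lie_bind g b)"

text \<open>
  Substitution into a word is an algebra homomorphism and therefore respects commutators.
\<close>

lemma expand_lie_bind:
  "expand (lie_bind g L) = ext (\<lambda>w. prod_list (map (\<lambda>i. expand (g i)) w)) (expand L)"
  by (induction L) (simp_all add: ext_single scaleQ_one ext_diff ext_mult)

lemma rename_eq_bind: "rename \<sigma> L = lie_bind (\<lambda>i. Var (\<sigma> i)) L"
  by (induction L) auto

lemma lie_bind_bind: "lie_bind g (lie_bind h L) = lie_bind (\<lambda>i. lie_bind g (h i)) L"
  by (induction L) auto

lemma lie_bind_cong: "(\<And>i. i \<in> set (variables L) \<Longrightarrow> g i = h i) \<Longrightarrow> lie_bind g L = lie_bind h L"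
  by (induction L) auto

lemma lie_bind_Var: "lie_bind Var L = L"
  by (induction L) auto

lemma variables_bind: "variables (lie_bind g L) = concat (map (\<lambda>i. variables (g i)) (variables L))"
  by (induction L) auto

lemma variables_rename: "variables (rename \<sigma> L) = map \<sigma> (variables L)"
  by (induction L) auto

lemma rename_rename: "rename \<sigma> (rename \<pi> L) = rename (\<lambda>i. \<sigma> (\<pi> i)) L"
  by (induction L) auto

lemma prod_list_word_vec: "prod_list (map (\<lambda>i. word_vec [\<sigma> i]) w) = word_vec (map \<sigma> w)"
  by (induction w) (simp_all add: word_vec_mult flip: single_one add: zero_list_def)

lemma expand_rename: "expand (rename \<sigma> L) = relabel \<sigma> (expand L)"
  by (simp add: rename_eq_bind expand_lie_bind prod_list_word_vec relabel_def)

text \<open>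
  Partial composition \<open>L \<circ>\<^sub>i K\<close> in the Lie operad, for \<open>K\<close> of arity \<open>n\<close>.
\<close>

definition lie_subst :: "nat \<Rightarrow> nat \<Rightarrow> lie_monomial \<Rightarrow> lie_monomial \<Rightarrow> lie_monomial" where
  "lie_subst i n K = lie_bind (\<lambda>j. if j = i then rename (\<lambda>b. b + i - 1) K
     else Var (insert_mark i n j 1))"

lemma variables_lie_subst:
  assumes "length (variables K) = n"
  shows "variables (lie_subst i n K L) = word_subst i (variables L) (variables K)"
proof -
  have "variables (if j = i then rename (\<lambda>b. b + i - 1) K else Var (insert_mark i n j 1)) =
      letter_subst i (variables K) j" for j
    using assms by (simp add: variables_rename insert_mark_def letter_subst_def)
  then show ?thesis
    by (simp add: lie_subst_def variables_bind word_subst_eq)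
qed

text \<open>
  The letter \<open>i\<close> occurs exactly once in each word of \<open>L\<close>, so the homomorphism that substitutes \<open>K\<close>
  for it is linear in \<open>K\<close>.
\<close>

lemma expand_lie_subst:
  assumes L: "variables L \<in> perms m" and K: "variables K \<in> perms n" and i: "i \<in> {1..m}"
  shows "expand (lie_subst i n K L) =
    ext (\<lambda>w. ext (\<lambda>v. word_vec (word_subst i w v)) (expand K)) (expand L)"
  unfolding lie_subst_def expand_lie_bind
proof (rule ext_cong)
  fix w assume "w \<in> keys (expand L)"
  then have w: "w \<in> perms m" by (rule keys_expand_perms[OF L])
  let ?g = "\<lambda>j. expand (if j = i then rename (\<lambda>b. b + i - 1) K else Var (insert_mark i n j 1))"
  obtain xs ys where xy: "w = xs @ i # ys"
    using i permsD[OF w] by (metis split_list)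
  then have i_notin: "i \<notin> set xs" "i \<notin> set ys" using permsD[OF w] by auto
  have absent: "prod_list (map ?g zs) = word_vec (map (\<lambda>j. insert_mark i n j 1) zs)"
    if "i \<notin> set zs" for zs
  proof -
    have "map ?g zs = map (\<lambda>j. word_vec [insert_mark i n j 1]) zs"
      using that by (auto intro!: map_cong)
    then show ?thesis by (simp only: prod_list_word_vec)
  qed
  let ?X = "map (\<lambda>j. insert_mark i n j 1) xs" and ?Y = "map (\<lambda>j. insert_mark i n j 1) ys"
  have "prod_list (map ?g w) = word_vec ?X * (relabel (\<lambda>b. b + i - 1) (expand K) * word_vec ?Y)"
    by (simp add: xy absent i_notin expand_rename mult.assoc)
  also have "\<dots> = ext (\<lambda>v. word_vec ?X * (word_vec (map (\<lambda>b. b + i - 1) v) * word_vec ?Y)) (expand K)"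
    unfolding relabel_def
    using qlinear_ext_comp[OF qlinear_compose[OF qlinear_mult(2)[of "word_vec ?X"]
          qlinear_mult(1)[of "word_vec ?Y"]]]
    by blast
  also have "\<dots> = ext (\<lambda>v. word_vec (word_subst i w v)) (expand K)"
  proof (rule ext_cong)
    fix v assume "v \<in> keys (expand K)"
    then have "length v = n" using keys_expand_perms[OF K] permsD by blast
    then show "word_vec ?X * (word_vec (map (\<lambda>b. b + i - 1) v) * word_vec ?Y) =
        word_vec (word_subst i w v)"
      using i_notin by (simp add: word_vec_mult xy word_subst_Cons word_subst_absent letter_subst_def)
  qed
  finally show "prod_list (map ?g w) = ext (\<lambda>v. word_vec (word_subst i w v)) (expand K)" .
qed

section \<open>Marked Lie monomials\<close>

text \<open>
  The Lie monomial \<open>L\<close> expanded into words, all pointed at the letter \<open>a\<close>.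
\<close>

definition marked_monomial :: "nat \<Rightarrow> lie_monomial \<Rightarrow> nat \<Rightarrow> (nat list \<Rightarrow>\<^sub>0 dias)" where
  "marked_monomial n L a = ext (\<lambda>w. pointed_word n w a) (expand L)"

definition marked_monomials :: "nat \<Rightarrow> (nat list \<Rightarrow>\<^sub>0 dias) set" where
  "marked_monomials n = {marked_monomial n L a |L a. variables L \<in> perms n \<and> a \<in> {1..n}}"

lemma marked_monomial_cases:
  assumes "x \<in> marked_monomials n"
  obtains L a where "x = marked_monomial n L a" "variables L \<in> perms n" "a \<in> {1..n}"
  using assms by (auto simp: marked_monomials_def)

lemma sym_pcomp_marked_monomial:
  assumes "variables L \<in> perms m" "variables K \<in> perms n" "i \<in> {1..m}" "a \<in> {1..m}" "b \<in> {1..n}"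
  shows "sym_pcomp i (marked_monomial m L a) (marked_monomial n K b) =
    marked_monomial (m + n - 1) (lie_subst i n K L) (insert_mark i n a b)"
proof -
  have "sym_pcomp i (marked_monomial m L a) (marked_monomial n K b) =
      ext (\<lambda>w. ext (\<lambda>v. sym_pcomp i (pointed_word m w a) (pointed_word n v b)) (expand K)) (expand L)"
    unfolding marked_monomial_def
    by (subst qlinear_ext_comp[OF qlinear_sym_pcomp_left],
        subst qlinear_ext_comp[OF qlinear_sym_pcomp_right]) (rule refl)
  also have "\<dots> = ext (\<lambda>w. ext (\<lambda>v. pointed_word (m + n - 1) (word_subst i w v)
      (insert_mark i n a b)) (expand K)) (expand L)"
    by (intro ext_cong sym_pcomp_pointed keys_expand_perms[OF assms(1)]
        keys_expand_perms[OF assms(2)] assms)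
  also have "\<dots> = marked_monomial (m + n - 1) (lie_subst i n K L) (insert_mark i n a b)"
    unfolding marked_monomial_def expand_lie_subst[OF assms(1-3)]
    by (simp add: qlinear_ext_comp[OF qlinear_ext] ext_single scaleQ_one)
  finally show ?thesis .
qed

lemma act_marked_monomial:
  assumes "variables L \<in> perms n" "a \<in> {1..n}" "\<sigma> permutes {1..n}"
  shows "act SymDias n \<sigma> (marked_monomial n L a) = marked_monomial n (rename \<sigma> L) (\<sigma> a)"
proof -
  have "act SymDias n \<sigma> (pointed_word n w a) = pointed_word n (map \<sigma> w) (\<sigma> a)"
    if "w \<in> keys (expand L)" for w
    using permsD[OF keys_expand_perms[OF assms(1) that]] assms(2) permutes_inj_on[OF assms(3)]
    by (intro act_pointed) auto
  then show ?thesis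
    unfolding marked_monomial_def expand_rename relabel_def qlinear_ext_comp[OF qlinear_act]
    by (simp add: qlinear_ext_comp[OF qlinear_ext] ext_single scaleQ_one cong: ext_cong)
qed

lemma marked_monomial_swap:
  "marked_monomial n (Bracket L K) a = - marked_monomial n (Bracket K L) a"
  by (simp add: marked_monomial_def ext_diff)

section \<open>Changing the root\<close>

text \<open>
  Solves for the letter \<open>a\<close> in the trace form of \<open>L\<close> and \<open>r\<close>: the subtrees hanging off the path from the
  root of \<open>L\<close> to \<open>a\<close> are moved to the other side one after the other.
\<close>

primrec reroot :: "lie_monomial \<Rightarrow> nat \<Rightarrow> lie_monomial \<Rightarrow> lie_monomial" where
  "reroot (Var i) a r = r"
| "reroot (Bracket L K) a r =
     (if a \<in> set (variables L) then reroot L a (Bracket K r) else reroot K a (Bracket r L))"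

lemma variables_reroot:
  "a \<in> set (variables L) \<Longrightarrow>
   mset (variables L) + mset (variables r) = add_mset a (mset (variables (reroot L a r)))"
proof (induction L arbitrary: r)
  case (Bracket L K)
  show ?case
  proof (cases "a \<in> set (variables L)")
    case True
    with Bracket.IH(1)[OF True, of "Bracket K r"] show ?thesis by (simp add: ac_simps)
  next
    case False
    then have "a \<in> set (variables K)" using Bracket.prems by simp
    with Bracket.IH(2)[of "Bracket r L"] False show ?thesis by (simp add: ac_simps)
  qed
qed simp

text \<open>
  For a trace one has \<open>tr([L, K] r) = tr(L [K, r]) = tr(K [r, L])\<close>.
\<close>

lemma reroot_trace:
  fixes F :: "nat list \<Rightarrow> 'b::rat_vector"
  assumes F: "\<And>u v. F (u @ v) = F (v @ u)"
  shows "a \<in> set (variables L) \<Longrightarrow>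
    ext F (expand L * expand r) = ext F (word_vec [a] * expand (reroot L a r))"
proof (induction L arbitrary: r)
  case (Bracket L K)
  let ?p = "expand L" and ?q = "expand K" and ?r = "expand r"
  have swap: "ext F (x * (y * z)) = ext F (y * (z * x))" for x y z
    using ext_trace[where F = F and p = x and q = "y * z", OF F] by (simp add: mult.assoc)
  show ?case
  proof (cases "a \<in> set (variables L)")
    case True
    have "ext F (expand (Bracket L K) * ?r) = ext F (?p * expand (Bracket K r))"
      using swap[of ?q ?p ?r] by (simp add: left_diff_distrib right_diff_distrib ext_diff mult.assoc)
    with Bracket.IH(1)[OF True, of "Bracket K r"] True show ?thesis by (simp del: expand.simps)
  next
    case False
    then have K: "a \<in> set (variables K)" using Bracket.prems by simp
    have "ext F (expand (Bracket L K) * ?r) = ext F (?q * expand (Bracket r L))"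
      using swap[of ?p ?q ?r] by (simp add: left_diff_distrib right_diff_distrib ext_diff mult.assoc)
    with Bracket.IH(2)[OF K, of "Bracket r L"] False show ?thesis by (simp del: expand.simps)
  qed
qed simp

text \<open>
  An element of the free associative algebra is read as a combination of cyclic words, all marked at
  \<open>a\<close>.
\<close>

definition cyclic_mark :: "nat \<Rightarrow> (nat list \<Rightarrow>\<^sub>0 rat) \<Rightarrow> (nat list \<Rightarrow>\<^sub>0 dias)" where
  "cyclic_mark a = ext (\<lambda>W. marked W a)"

lemma cyclic_mark_commute: "cyclic_mark a (p * q) = cyclic_mark a (q * p)"
  unfolding cyclic_mark_def by (rule ext_trace) (rule marked_rotate)

lemma cyclic_mark_reroot:
  "b \<in> set (variables L) \<Longrightarrow>
   cyclic_mark a (expand L * expand r) = cyclic_mark a (word_vec [b] * expand (reroot L b r))"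
  unfolding cyclic_mark_def by (rule reroot_trace) (rule marked_rotate)

lemma marked_monomial_cyclic:
  assumes "variables L \<in> perms n"
  shows "marked_monomial n L a = cyclic_mark a (expand L * word_vec [n + 1])"
  unfolding marked_monomial_def cyclic_mark_def ext_mult_word_vec
  by (intro ext_cong marked_snoc[symmetric] keys_expand_perms[OF assms])

lemma perms_reroot:
  assumes "variables L @ variables r \<in> perms n" "a \<in> set (variables L)"
  shows "a # variables (reroot L a r) \<in> perms n"
  using assms mset_eq_perms[of "a # variables (reroot L a r)" "variables L @ variables r"]
    variables_reroot[of a L r]
  by simp

text \<open>
  Whatever the position of the root, it can be moved to the end, and then a marked Lie monomial
  remains. This is what makes Leib stable under the full symmetric group.
\<close>

lemma cyclic_mark_Leib:
  assumes "variables L @ variables r \<in> perms (n + 1)" "a \<in> {1..n + 1}"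
  shows "cyclic_mark a (expand L * expand r) \<in> rat_vector.span (marked_monomials n)"
proof -
  have *: "cyclic_mark a (expand L * expand r) \<in> rat_vector.span (marked_monomials n)"
    if L: "variables L @ variables r \<in> perms (n + 1)" "n + 1 \<in> set (variables L)" for L r
  proof -
    let ?B = "reroot L (n + 1) r"
    have "(n + 1) # variables ?B \<in> perms (n + 1)"
      by (rule perms_reroot[OF L])
    then have "variables ?B @ [n + 1] \<in> perms (n + 1)"
      using perms_rotate[of "[n + 1]" "variables ?B"] by simp
    then have B: "variables ?B \<in> perms n" by (simp only: perms_snoc)
    have eq: "cyclic_mark a (expand L * expand r) = marked_monomial n ?B a"
      unfolding cyclic_mark_reroot[OF L(2)] marked_monomial_cyclic[OF B]
      by (rule cyclic_mark_commute)
    show ?thesis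
    proof (cases "a = n + 1")
      case True
      have "marked_monomial n ?B a = ext (\<lambda>w. 0) (expand ?B)"
        unfolding marked_monomial_def True
        by (intro ext_cong pointed_word_absent keys_expand_perms[OF B]) auto
      then show ?thesis
        unfolding eq by (simp add: ext_def rat_vector.span_zero)
    next
      case False
      with assms(2) have "a \<in> {1..n}" by auto
      with B show ?thesis
        unfolding eq marked_monomials_def by (intro rat_vector.span_base) blast
    qed
  qed
  have "n + 1 \<in> set (variables L @ variables r)"
    using permsD[OF assms(1)] by auto
  then consider "n + 1 \<in> set (variables L)" | "n + 1 \<in> set (variables r)" by auto
  then show ?thesis
  proof cases
    case 1
    then show ?thesis by (rule *[OF assms(1)])
  next
    case 2
    then show ?thesis
      using *[of r L] assms(1) perms_rotate cyclic_mark_commute by metis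
  qed
qed

lemma cyclic_act_cyclic_mark:
  assumes "\<And>W. W \<in> keys p \<Longrightarrow> W \<in> perms (n + 1)" "a \<in> {1..n + 1}"
  shows "cyclic_act n \<sigma> (cyclic_mark a p) =
    cyclic_mark (\<sigma> a) (relabel \<sigma> p) - cyclic_mark (\<sigma> (n + 1)) (relabel \<sigma> p)"
proof -
  have relabel: "cyclic_mark b (relabel \<sigma> p) = ext (\<lambda>W. marked (map \<sigma> W) b) p" for b
    by (simp add: cyclic_mark_def relabel_def qlinear_ext_comp[OF qlinear_ext] ext_single scaleQ_one)
  have "cyclic_act n \<sigma> (cyclic_mark a p) =
      ext (\<lambda>W. marked (map \<sigma> W) (\<sigma> a) - marked (map \<sigma> W) (\<sigma> (n + 1))) p"
    unfolding cyclic_mark_def qlinear_ext_comp[OF qlinear_cyclic_act]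
    by (intro ext_cong cyclic_act_marked assms)
  then show ?thesis by (simp only: ext_fun_diff relabel)
qed

lemma keys_expand_mult:
  assumes "variables L @ variables r \<in> perms n" "W \<in> keys (expand L * expand r)"
  shows "W \<in> perms n"
proof -
  obtain u v where "W = u @ v" "u \<in> keys (expand L)" "v \<in> keys (expand r)"
    using assms(2) keys_mult[of "expand L" "expand r"] unfolding plus_list_def by blast
  then have "mset W = mset (variables L @ variables r)" using keys_expand by simp
  with assms(1) show ?thesis using mset_eq_perms by blast
qed

lemma relabel_mult: "relabel \<sigma> (p * q) = relabel \<sigma> p * relabel \<sigma> q"
  unfolding relabel_def by (rule ext_mult) (simp add: word_vec_mult)

lemma cyclic_act_Leib:
  assumes \<sigma>: "\<sigma> permutes {1..n + 1}" and x: "x \<in> rat_vector.span (marked_monomials n)"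
  shows "cyclic_act n \<sigma> x \<in> rat_vector.span (marked_monomials n)"
proof (rule qlinear_span_image[OF qlinear_cyclic_act _ _ x])
  fix y assume "y \<in> marked_monomials n"
  then obtain L a where y: "y = marked_monomial n L a" and L: "variables L \<in> perms n" and a: "a \<in> {1..n}"
    by (rule marked_monomial_cases)
  have LN: "variables L @ variables (Var (n + 1)) \<in> perms (n + 1)"
    using L by (simp only: variables.simps perms_snoc)
  have a': "a \<in> {1..n + 1}" using a by auto
  have y: "y = cyclic_mark a (expand L * expand (Var (n + 1)))"
    unfolding y using marked_monomial_cyclic[OF L] by simp
  have \<sigma>LN: "variables (rename \<sigma> L) @ variables (rename \<sigma> (Var (n + 1))) \<in> perms (n + 1)"
    using map_perms[OF \<sigma> LN] by (simp only: variables_rename map_append)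
  have "\<sigma> a \<in> {1..n + 1}" "\<sigma> (n + 1) \<in> {1..n + 1}"
    using permutes_in_image[OF \<sigma>] a' by (blast, simp)
  moreover have "cyclic_act n \<sigma> y =
      cyclic_mark (\<sigma> a) (expand (rename \<sigma> L) * expand (rename \<sigma> (Var (n + 1)))) -
      cyclic_mark (\<sigma> (n + 1)) (expand (rename \<sigma> L) * expand (rename \<sigma> (Var (n + 1))))"
    unfolding y expand_rename relabel_mult[symmetric]
    by (rule cyclic_act_cyclic_mark[OF _ a']) (erule keys_expand_mult[OF LN])
  ultimately show "cyclic_act n \<sigma> y \<in> rat_vector.span (marked_monomials n)"
    by (simp only:) (intro rat_vector.span_diff cyclic_mark_Leib[OF \<sigma>LN])
qed simp

section \<open>The components of the Leibniz operad\<close>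

abbreviation leib_generators :: "nat \<Rightarrow> (nat list \<Rightarrow>\<^sub>0 dias) set" where
  "leib_generators n \<equiv> if n = 2 then {leib_bracket} else {}"

lemma Leib_component: "f \<in> component Leib n \<longleftrightarrow> (n, f) \<in> generated SymDias leib_generators"
  by (simp add: Leib_def generated_suboperad_def)

lemma marked_bracket:
  "marked_monomial 2 (Bracket (Var 1) (Var 2)) a = pointed_word 2 [1, 2] a - pointed_word 2 [2, 1] a"
  by (simp add: marked_monomial_def word_vec_mult ext_diff ext_single scaleQ_one)

lemma leib_bracket_marked: "leib_bracket = marked_monomial 2 (Bracket (Var 1) (Var 2)) 1"
  unfolding marked_bracket by (simp add: leib_bracket_def pointed_word_def word_position_def dias_generators)
    (simp add: numeral_2_eq_2)

lemma unit_marked: "ns_operad.unit SymDias = marked_monomial 1 (Var 1) 1"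
  by (simp add: SymDias_unit marked_monomial_def ext_single scaleQ_one)

lemma two_perms: "[1, 2] \<in> perms 2"
  by (intro permsI) auto

text \<open>
  The generator and the unit are marked Lie monomials, and composites of marked Lie monomials are
  again marked Lie monomials.
\<close>

lemma generated_in_span:
  "(n, f) \<in> generated SymDias leib_generators \<Longrightarrow> 1 \<le> n \<Longrightarrow>
   f \<in> rat_vector.span (marked_monomials n)"
proof (induction rule: generated.induct)
  case (gen g n)
  then have "n = 2" "g = marked_monomial 2 (Bracket (Var 1) (Var 2)) 1"
    using leib_bracket_marked by (auto split: if_splits)
  moreover have "g \<in> marked_monomials 2" if "g = marked_monomial 2 (Bracket (Var 1) (Var 2)) 1"
    using that two_perms unfolding marked_monomials_def
    by (intro CollectI exI[of _ "Bracket (Var 1) (Var 2)"] exI[of _ 1]) auto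
  ultimately show ?case by (auto intro: rat_vector.span_base)
next
  case unit
  have "marked_monomial 1 (Var 1) 1 \<in> marked_monomials 1"
    using one_perms unfolding marked_monomials_def by force
  then show ?case unfolding unit_marked by (auto intro: rat_vector.span_base)
next
  case (pcomp m f n g i)
  then have f: "f \<in> rat_vector.span (marked_monomials m)"
    and g: "g \<in> rat_vector.span (marked_monomials n)" and i: "i \<in> {1..m}" by auto
  have "sym_pcomp i f g \<in> rat_vector.span (marked_monomials (m + n - 1))"
  proof (rule qlinear_span_image[OF qlinear_sym_pcomp_left _ _ f])
    fix x assume "x \<in> marked_monomials m"
    then obtain L a where L: "x = marked_monomial m L a" "variables L \<in> perms m" "a \<in> {1..m}"
      by (rule marked_monomial_cases)
    show "sym_pcomp i x g \<in> rat_vector.span (marked_monomials (m + n - 1))"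
    proof (rule qlinear_span_image[OF qlinear_sym_pcomp_right _ _ g])
      fix y assume "y \<in> marked_monomials n"
      then obtain K b where K: "y = marked_monomial n K b" "variables K \<in> perms n" "b \<in> {1..n}"
        by (rule marked_monomial_cases)
      have "length (variables K) = n" using permsD[OF K(2)] by blast
      then have "variables (lie_subst i n K L) \<in> perms (m + n - 1)"
        using word_subst_perms[OF L(2) K(2) i] by (simp only: variables_lie_subst)
      moreover have "insert_mark i n a b \<in> {1..m + n - 1}"
        using insert_mark_bounds[of i m a b n] i L(3) K(3) by auto
      ultimately have "marked_monomial (m + n - 1) (lie_subst i n K L) (insert_mark i n a b)
          \<in> marked_monomials (m + n - 1)"
        unfolding marked_monomials_def by blast
      then show "sym_pcomp i x y \<in> rat_vector.span (marked_monomials (m + n - 1))"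
        unfolding L(1) K(1) sym_pcomp_marked_monomial[OF L(2) K(2) i L(3) K(3)]
        by (rule rat_vector.span_base)
    qed simp
  qed simp
  then show ?case by simp
next
  case (act n f \<sigma>)
  then have f: "f \<in> rat_vector.span (marked_monomials n)" by simp
  have "act SymDias n \<sigma> f \<in> rat_vector.span (marked_monomials n)"
  proof (rule qlinear_span_image[OF qlinear_act _ _ f])
    fix x assume "x \<in> marked_monomials n"
    then obtain L a where L: "x = marked_monomial n L a" "variables L \<in> perms n" "a \<in> {1..n}"
      by (rule marked_monomial_cases)
    have "variables (rename \<sigma> L) \<in> perms n"
      using map_perms[OF act(2) L(2)] by (simp only: variables_rename)
    moreover have "\<sigma> a \<in> {1..n}" using permutes_in_image[OF act(2)] L(3) by blast
    ultimately have "marked_monomial n (rename \<sigma> L) (\<sigma> a) \<in> marked_monomials n"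
      unfolding marked_monomials_def by blast
    then show "act SymDias n \<sigma> x \<in> rat_vector.span (marked_monomials n)"
      unfolding L(1) act_marked_monomial[OF L(2,3) act(2)] by (rule rat_vector.span_base)
  qed simp
  then show ?case by simp
qed (auto intro: rat_vector.span_zero rat_vector.span_add rat_vector.span_scale)

lemma Leib_closed_pcomp:
  "f \<in> component Leib m \<Longrightarrow> g \<in> component Leib n \<Longrightarrow> 1 \<le> n \<Longrightarrow> i \<in> {1..m} \<Longrightarrow>
   sym_pcomp i f g \<in> component Leib (m + n - 1)"
  unfolding Leib_component by (rule generated.pcomp) auto

lemma Leib_closed_act:
  "f \<in> component Leib n \<Longrightarrow> \<sigma> permutes {1..n} \<Longrightarrow> act SymDias n \<sigma> f \<in> component Leib n"
  unfolding Leib_component by (rule generated.act)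

lemma subspace_Leib: "rat_vector.subspace (component Leib n)"
  by (auto simp: rat_vector.subspace_def Leib_component
      intro: generated.zero generated.add generated.scale)

lemma bracket_in_Leib:
  assumes "a \<in> {1..2}"
  shows "marked_monomial 2 (Bracket (Var 1) (Var 2)) a \<in> component Leib 2"
proof -
  have first: "marked_monomial 2 (Bracket (Var 1) (Var 2)) 1 \<in> component Leib 2"
    unfolding Leib_component leib_bracket_marked[symmetric] by (rule generated.gen) simp
  consider "a = 1" | "a = 2" using assms by force
  then show ?thesis
  proof cases
    case 2
    let ?s = "transpose 1 (2::nat)"
    have s: "?s permutes {1..2}" by (rule permutes_swap_id) auto
    have "act SymDias 2 ?s (marked_monomial 2 (Bracket (Var 1) (Var 2)) 1) =
        marked_monomial 2 (rename ?s (Bracket (Var 1) (Var 2))) (?s 1)"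
      by (rule act_marked_monomial[OF _ _ s]) (use two_perms in auto)
    also have "\<dots> = - marked_monomial 2 (Bracket (Var 1) (Var 2)) 2"
      using marked_monomial_swap[of 2 "Var 2" "Var 1" 2] by simp
    finally have "- marked_monomial 2 (Bracket (Var 1) (Var 2)) 2 \<in> component Leib 2"
      using Leib_closed_act[OF first s] by simp
    with 2 show ?thesis
      using rat_vector.subspace_neg[OF subspace_Leib] by fastforce
  qed (use first in simp)
qed

text \<open>
  Conversely, a marked bracket is built from the generator: \<open>[L, K]\<close> is obtained by inserting \<open>K\<close> and
  then \<open>L\<close> into the bracket of two letters, and the mark is placed by marking all three of them suitably.
  The letters are in order here, as composition of operations without relabelling requires.
\<close>

lemma ordered_monomial_in_Leib:
  "variables L = [k + 1..<k + n + 1] \<Longrightarrow> a \<in> {1..n} \<Longrightarrow>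
   marked_monomial n (rename (\<lambda>x. x - k) L) a \<in> component Leib n"
proof (induction L arbitrary: k n a)
  case (Var i)
  then have i: "[i] = [k + 1..<k + n + 1]" by simp
  from arg_cong[OF this, of length] have "n = 1" by (simp del: upt_Suc)
  moreover from i this have "i = k + 1" by simp
  ultimately have "n = 1" "i = k + 1" by auto
  with Var.prems(2) show ?case
    using generated.unit[of SymDias leib_generators] unit_marked by (simp add: Leib_component)
next
  case (Bracket L K)
  define p where "p = length (variables L)"
  define q where "q = length (variables K)"
  have pos: "1 \<le> length (variables M)" for M
    by (induction M) auto
  have pq: "1 \<le> p" "1 \<le> q" unfolding p_def q_def by (rule pos)+
  have eq: "variables L @ variables K = [k + 1..<k + n + 1]" using Bracket.prems(1) by simp
  from arg_cong[OF this, of length] have n: "n = p + q"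
    by (simp add: p_def q_def del: upt_Suc)
  have "[k + 1..<k + n + 1] = [k + 1..<k + p + 1] @ [k + p + 1..<k + p + q + 1]"
    using upt_add_eq_append[of "k + 1" "k + p + 1" q] unfolding n
    by (simp add: ac_simps del: upt_Suc)
  with eq have "variables L @ variables K = [k + 1..<k + p + 1] @ [k + p + 1..<k + p + q + 1]"
    by (simp only:)
  moreover have "length (variables L) = length [k + 1..<k + p + 1]"
    by (simp add: p_def del: upt_Suc)
  ultimately have L: "variables L = [k + 1..<k + p + 1]"
    and K: "variables K = [k + p + 1..<k + p + q + 1]"
    using append_eq_append_conv by blast+
  define L' where "L' = rename (\<lambda>x. x - k) L"
  define K' where "K' = rename (\<lambda>x. x - (k + p)) K"
  have IH1: "marked_monomial p L' b \<in> component Leib p" if "b \<in> {1..p}" for b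
    unfolding L'_def by (rule Bracket.IH(1)[OF L that])
  have IH2: "marked_monomial q K' b \<in> component Leib q" if "b \<in> {1..q}" for b
    unfolding K'_def by (rule Bracket.IH(2)[OF K that])
  have L': "variables L' \<in> perms p" and K': "variables K' \<in> perms q"
  proof -
    have shift: "map (\<lambda>x. x - j) [j + 1..<j + l + 1] = [1..<l + 1]" for j l :: nat
      by (rule nth_equalityI) (simp_all del: upt_Suc)
    show "variables L' \<in> perms p" "variables K' \<in> perms q"
      unfolding L'_def K'_def variables_rename L K shift by (rule upt_perms)+
  qed
  let ?b = "Bracket (Var 1) (Var 2)"
  let ?M = "lie_subst 2 q K' ?b"
  have b2: "variables ?b \<in> perms 2" using two_perms by simp
  have "length (variables K') = q" using permsD[OF K'] by blast
  then have M: "variables ?M \<in> perms (1 + q)"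
    using word_subst_perms[OF b2 K', of 2] by (simp add: variables_lie_subst)
  have subst: "lie_subst 1 p L' ?M = rename (\<lambda>x. x - k) (Bracket L K)"
  proof -
    have "lie_subst 1 p L' ?M = Bracket (rename (\<lambda>b. b) L') (rename (\<lambda>b. b + p) K')"
    proof -
      have "lie_subst 1 p L' (rename (\<lambda>b. b + 1) K') = rename (\<lambda>b. b + p) K'"
        unfolding lie_subst_def rename_eq_bind[of _ K'] lie_bind_bind
        using permsD[OF K'] by (intro lie_bind_cong) (auto simp: insert_mark_def)
      moreover have "lie_subst 1 p L' (Var 1) = rename (\<lambda>b. b) L'" by (simp add: lie_subst_def)
      moreover have "?M = Bracket (Var 1) (rename (\<lambda>b. b + 1) K')"
        by (simp add: lie_subst_def insert_mark_def)
      ultimately show ?thesis by (simp add: lie_subst_def)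
    qed
    also have "rename (\<lambda>b. b) L' = rename (\<lambda>x. x - k) L"
      by (simp add: L'_def rename_rename)
    also have "rename (\<lambda>b. b + p) K' = rename (\<lambda>x. x - k) K"
      unfolding K'_def rename_rename unfolding rename_eq_bind
      using K by (intro lie_bind_cong) auto
    finally show ?thesis by simp
  qed
  have comp: "marked_monomial n (rename (\<lambda>x. x - k) (Bracket L K))
      (insert_mark 1 p (insert_mark 2 q c d) e) \<in> component Leib n"
    if "c \<in> {1..2}" "d \<in> {1..q}" "e \<in> {1..p}" for c d e
  proof -
    have two: "2 \<in> {1..2::nat}" by simp
    have "sym_pcomp 2 (marked_monomial 2 ?b c) (marked_monomial q K' d) =
        marked_monomial (1 + q) ?M (insert_mark 2 q c d)"
      using sym_pcomp_marked_monomial[OF b2 K' two that(1,2)] by simp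
    with Leib_closed_pcomp[OF bracket_in_Leib[OF that(1)] IH2[OF that(2)] pq(2) two]
    have mid: "marked_monomial (1 + q) ?M (insert_mark 2 q c d) \<in> component Leib (1 + q)"
      by simp
    have i: "insert_mark 2 q c d \<in> {1..1 + q}" "1 \<in> {1..1 + q}"
      using insert_mark_bounds[of 2 2 c d q] that by auto
    have "sym_pcomp 1 (marked_monomial (1 + q) ?M (insert_mark 2 q c d)) (marked_monomial p L' e) =
        marked_monomial n (rename (\<lambda>x. x - k) (Bracket L K))
          (insert_mark 1 p (insert_mark 2 q c d) e)"
    proof -
      have "1 + q + p - 1 = n" using n by simp
      with sym_pcomp_marked_monomial[OF M L' i(2,1) that(3)] show ?thesis
        by (simp only: subst)
    qed
    with Leib_closed_pcomp[OF mid IH1[OF that(3)] pq(1) i(2)] show ?thesis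
      using n by (simp add: add.commute)
  qed
  show ?case
  proof (cases "a \<le> p")
    case True
    have "insert_mark 1 p (insert_mark 2 q 1 1) a = a" by (simp add: insert_mark_def)
    with comp[of 1 1 a] True Bracket.prems(2) pq show ?thesis by simp
  next
    case False
    have "insert_mark 1 p (insert_mark 2 q 2 (a - p)) 1 = a"
      using False by (simp add: insert_mark_def)
    moreover have "2 \<in> {1..2::nat}" "a - p \<in> {1..q}" "1 \<in> {1..p}"
      using False Bracket.prems(2) pq n by auto
    ultimately show ?thesis using comp[of 2 "a - p" 1] by simp
  qed
qed

lemma marked_monomial_in_Leib:
  assumes L: "variables L \<in> perms n" and a: "a \<in> {1..n}"
  shows "marked_monomial n L a \<in> component Leib n"
proof -
  obtain \<pi> where \<pi>: "\<pi> permutes {1..n}" "map \<pi> [1..<n + 1] = variables L"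
    by (rule permutation_of_word[OF L])
  have inv: "inv \<pi> permutes {1..n}" by (rule permutes_inv[OF \<pi>(1)])
  let ?L = "rename (inv \<pi>) L"
  have vars: "variables ?L = [1..<n + 1]"
    unfolding variables_rename \<pi>(2)[symmetric] map_map permutes_inv_o(2)[OF \<pi>(1)] by simp
  have a': "inv \<pi> a \<in> {1..n}" using permutes_in_image[OF inv] a by blast
  have "marked_monomial n ?L (inv \<pi> a) \<in> component Leib n"
    using ordered_monomial_in_Leib[of ?L 0 n "inv \<pi> a"] vars a'
    by (simp add: rename_rename)
  from Leib_closed_act[OF this \<pi>(1)]
  have "act SymDias n \<pi> (marked_monomial n ?L (inv \<pi> a)) \<in> component Leib n" .
  moreover have "variables ?L \<in> perms n" unfolding vars by (rule upt_perms)
  then have "act SymDias n \<pi> (marked_monomial n ?L (inv \<pi> a)) =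
      marked_monomial n (rename \<pi> ?L) (\<pi> (inv \<pi> a))"
    by (rule act_marked_monomial[OF _ a' \<pi>(1)])
  moreover have "rename \<pi> ?L = L"
    unfolding rename_rename permutes_inverses(1)[OF \<pi>(1)] unfolding rename_eq_bind lie_bind_Var ..
  ultimately show ?thesis
    by (simp add: permutes_inverses(1)[OF \<pi>(1)])
qed

lemma component_Leib:
  assumes "1 \<le> n"
  shows "component Leib n = rat_vector.span (marked_monomials n)"
proof
  show "component Leib n \<subseteq> rat_vector.span (marked_monomials n)"
    using generated_in_span assms by (auto simp: Leib_component)
  show "rat_vector.span (marked_monomials n) \<subseteq> component Leib n"
    by (rule rat_vector.span_minimal[OF _ subspace_Leib])
      (auto simp: marked_monomials_def intro: marked_monomial_in_Leib)
qed

section \<open>The anticyclic operad Leib\<close>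

lemma Leib_fields:
  "ns_operad.unit Leib = ns_operad.unit SymDias" "ns_operad.pcomp Leib = sym_pcomp"
  "act Leib = act SymDias"
  by (simp_all add: Leib_def generated_suboperad_def)

lemma Leib_subset:
  assumes "1 \<le> n"
  shows "component Leib n \<subseteq> component SymDias n"
  unfolding component_Leib[OF assms]
proof (rule rat_vector.span_minimal[OF _ subspace_SymDias], rule subsetI)
  fix x assume "x \<in> marked_monomials n"
  then obtain L a where L: "x = marked_monomial n L a" "variables L \<in> perms n" "a \<in> {1..n}"
    by (rule marked_monomial_cases)
  show "x \<in> component SymDias n"
    unfolding L(1) marked_monomial_def ext_def
    using keys_expand_perms[OF L(2)] L(3)
    by (intro rat_vector.subspace_sum rat_vector.subspace_scale subspace_SymDias
        pointed_word_in_SymDias) auto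
qed

lemma sym_rep_subspace:
  assumes "sym_rep k V \<rho>" "rat_vector.subspace U" "U \<subseteq> V"
    "\<And>\<sigma> u. \<sigma> permutes {1..k} \<Longrightarrow> u \<in> U \<Longrightarrow> \<rho> \<sigma> u \<in> U"
  shows "sym_rep k U \<rho>"
  using assms unfolding sym_rep_def by (meson linear_on_subset subsetD)

lemma Leib_SymDias_action:
  assumes n: "1 \<le> n" and \<sigma>: "\<sigma> permutes {1..n + 1}" and f: "f \<in> component Leib n"
  shows "SymDias_action n \<sigma> f = cyclic_act n \<sigma> f"
    and "SymDias_action n \<sigma> f \<in> component Leib n"
proof -
  show "SymDias_action n \<sigma> f = cyclic_act n \<sigma> f"
    using SymDias_action_eq[OF n \<sigma>] Leib_subset[OF n] f by blast
  then show "SymDias_action n \<sigma> f \<in> component Leib n"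
    using cyclic_act_Leib[OF \<sigma>] f unfolding component_Leib[OF n] by simp
qed

lemma is_ns_operad_Leib: "is_ns_operad Leib"
proof -
  note S = is_ns_operad_SymDias[unfolded is_ns_operad_def]
  note sub = Leib_subset[THEN subsetD]
  show ?thesis
    unfolding is_ns_operad_def Leib_fields
  proof (intro conjI)
    show "\<forall>n\<ge>1. rat_vector.subspace (component Leib n)"
      using subspace_Leib by blast
    show "ns_operad.unit SymDias \<in> component Leib 1"
      unfolding Leib_component by (rule generated.unit)
    show "\<forall>m\<ge>1. \<forall>n\<ge>1. \<forall>i\<in>{1..m}. \<forall>f\<in>component Leib m. \<forall>g\<in>component Leib n.
        sym_pcomp i f g \<in> component Leib (m + n - 1)"
      using Leib_closed_pcomp by blast
    show "\<forall>m\<ge>1. \<forall>n\<ge>1. \<forall>i\<in>{1..m}.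
        (\<forall>f\<in>component Leib m. linear_on (component Leib n) (\<lambda>g. sym_pcomp i f g)) \<and>
        (\<forall>g\<in>component Leib n. linear_on (component Leib m) (\<lambda>f. sym_pcomp i f g))"
      by (intro allI impI ballI conjI qlinear_imp_linear_on[OF qlinear_sym_pcomp_left]
          qlinear_imp_linear_on[OF qlinear_sym_pcomp_right])
    show "\<forall>n\<ge>1. \<forall>f\<in>component Leib n. sym_pcomp 1 (ns_operad.unit SymDias) f = f \<and>
        (\<forall>i\<in>{1..n}. sym_pcomp i f (ns_operad.unit SymDias) = f)"
      using SymDias_unit_laws sub by blast
    show "\<forall>l\<ge>1. \<forall>m\<ge>1. \<forall>n\<ge>1. \<forall>f\<in>component Leib l. \<forall>g\<in>component Leib m.
        \<forall>h\<in>component Leib n.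
        (\<forall>i\<in>{1..l}. \<forall>j\<in>{1..m}.
           sym_pcomp (i + j - 1) (sym_pcomp i f g) h = sym_pcomp i f (sym_pcomp j g h)) \<and>
        (\<forall>i k. 1 \<le> i \<and> i < k \<and> k \<le> l \<longrightarrow>
           sym_pcomp (k + m - 1) (sym_pcomp i f g) h = sym_pcomp i (sym_pcomp k f h) g)"
      using SymDias_assoc SymDias_parallel sub by (metis (no_types, lifting))
  qed
qed

lemma is_anticyclic_operad_Leib: "is_anticyclic_operad Leib SymDias_action"
proof -
  have S: "is_anticyclic_operad SymDias SymDias_action"
    using extends_dias_tau_SymDias_action by (simp add: extends_dias_tau_def)
  note sub = Leib_subset[THEN subsetD]
  have rep: "sym_rep n (component Leib n) (act SymDias n)" if "1 \<le> n" for n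
    by (rule sym_rep_subspace[OF sym_rep_SymDias subspace_Leib Leib_subset[OF that]])
      (rule Leib_closed_act)
  have "is_operad Leib"
    unfolding is_operad_def Leib_fields
    using is_ns_operad_Leib rep SymDias_equivariant sub by blast
  moreover have "sym_rep (n + 1) (component Leib n) (SymDias_action n)" if n: "1 \<le> n" for n
  proof (rule sym_rep_subspace[OF _ subspace_Leib Leib_subset[OF n]])
    show "sym_rep (n + 1) (component SymDias n) (SymDias_action n)"
      using S n by (simp add: is_anticyclic_operad_def)
  qed (rule Leib_SymDias_action[OF n])
  moreover have "anticyclic_identities Leib (\<lambda>n. SymDias_action n (long_cycle n))"
    using S sub unfolding is_anticyclic_operad_def anticyclic_identities_def Leib_fields by blast
  ultimately show ?thesis
    using S sub unfolding is_anticyclic_operad_def Leib_fields by blast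
qed

lemma Leib_action_spec:
  "is_anticyclic_operad Leib Leib_action \<and>
   anticyclic_morphism Leib Leib_action SymDias SymDias_action (\<lambda>n f. f)" (is "?Q Leib_action")
proof -
  have "operad_morphism Leib SymDias (\<lambda>n f. f)"
    unfolding operad_morphism_def Leib_fields
    using Leib_subset qlinear_imp_linear_on[OF qlinear_id] by blast
  then have "?Q SymDias_action"
    using is_anticyclic_operad_Leib by (simp add: anticyclic_morphism_def)
  then show ?thesis
    unfolding Leib_action_def by (rule someI[of ?Q])
qed

lemma Leib_action_eq:
  assumes "1 \<le> n" "\<sigma> permutes {1..n + 1}" "f \<in> component Leib n"
  shows "Leib_action n \<sigma> f = cyclic_act n \<sigma> f"
  using assms Leib_action_spec Leib_SymDias_action(1)[OF assms]
  by (simp add: anticyclic_morphism_def)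

lemma sym_rep_Leib: "1 \<le> n \<Longrightarrow> sym_rep (n + 1) (component Leib n) (Leib_action n)"
  using Leib_action_spec by (simp add: is_anticyclic_operad_def)

section \<open>Multilinear Lie elements\<close>

lemma free_bracket_ext:
  "free_bracket p q = ext (\<lambda>a. ext (\<lambda>b. single (Bracket a b) 1) q) p"
  by (simp add: free_bracket_def ext_def rat_vector.scale_sum_right scaleQ_scaleQ
      scaleQ_rat_def flip: single_scaleQ)

lemma free_bracket_add:
  "free_bracket (p + p') q = free_bracket p q + free_bracket p' q"
  "free_bracket p (q + q') = free_bracket p q + free_bracket p q'"
  by (simp_all add: free_bracket_ext ext_add ext_fun_add)

lemma free_bracket_scale:
  "free_bracket (c *\<^sub>Q p) q = c *\<^sub>Q free_bracket p q"
  "free_bracket p (c *\<^sub>Q q) = c *\<^sub>Q free_bracket p q"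
  by (simp_all add: free_bracket_ext ext_scale ext_fun_scale)

lemma free_bracket_diff:
  "free_bracket (p - p') q = free_bracket p q - free_bracket p' q"
  "free_bracket p (q - q') = free_bracket p q - free_bracket p q'"
  by (simp_all add: free_bracket_ext ext_diff ext_fun_diff)

lift_definition lie_bracket :: "free_lie \<Rightarrow> free_lie \<Rightarrow> free_lie" is free_bracket
proof -
  fix p p' q q'
  assume "p - p' \<in> lie_ideal" "q - q' \<in> lie_ideal"
  then have "free_bracket (p - p') q + free_bracket p' (q - q') \<in> lie_ideal"
    by (intro lie_ideal.intros)
  then show "free_bracket p q - free_bracket p' q' \<in> lie_ideal"
    by (simp add: free_bracket_diff)
qed

lemma qlinear_lie_bracket: "qlinear (\<lambda>x. lie_bracket x y)" "qlinear (lie_bracket y)"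
proof -
  have "lie_bracket (x + x') y = lie_bracket x y + lie_bracket x' y" for x x'
    by transfer (simp add: free_bracket_add lie_ideal.zero)
  moreover have "lie_bracket (c *\<^sub>Q x) y = c *\<^sub>Q lie_bracket x y" for c x
    by transfer (simp add: free_bracket_scale lie_ideal.zero)
  ultimately show "qlinear (\<lambda>x. lie_bracket x y)" by (simp add: linear_on_def)
  have "lie_bracket y (x + x') = lie_bracket y x + lie_bracket y x'" for x x'
    by transfer (simp add: free_bracket_add lie_ideal.zero)
  moreover have "lie_bracket y (c *\<^sub>Q x) = c *\<^sub>Q lie_bracket y x" for c x
    by transfer (simp add: free_bracket_scale lie_ideal.zero)
  ultimately show "qlinear (lie_bracket y)" by (simp add: linear_on_def)
qed

lemma lie_bracket_vec: "lie_bracket (lie_vec a) (lie_vec b) = lie_vec (Bracket a b)"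
  by transfer (simp add: free_bracket_single lie_ideal.zero)

lemma lie_bracket_self: "lie_bracket x x = 0"
  by transfer (simp add: lie_ideal.alternating)

lemma lie_bracket_antisym: "lie_bracket x y = - lie_bracket y x"
proof -
  have "lie_bracket (x + y) (x + y) =
      lie_bracket x x + lie_bracket y y + (lie_bracket x y + lie_bracket y x)"
    by (simp add: qlinear_add[OF qlinear_lie_bracket(1)] qlinear_add[OF qlinear_lie_bracket(2)])
  then have "lie_bracket x y + lie_bracket y x = 0" by (simp add: lie_bracket_self)
  then show ?thesis by (simp add: eq_neg_iff_add_eq_0)
qed

lemma lie_bracket_jacobi:
  "lie_bracket x (lie_bracket y z) + lie_bracket y (lie_bracket z x) +
   lie_bracket z (lie_bracket x y) = 0"
  by transfer (simp add: lie_ideal.jacobi)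

lemma lie_bracket_bracket:
  "lie_bracket x (lie_bracket y z) = lie_bracket (lie_bracket x y) z - lie_bracket (lie_bracket x z) y"
proof -
  have "lie_bracket y (lie_bracket z x) = lie_bracket (lie_bracket x z) y"
    using lie_bracket_antisym[of y "lie_bracket z x"] lie_bracket_antisym[of z x]
    by (simp add: qlinear_uminus[OF qlinear_lie_bracket(1)])
  with lie_bracket_jacobi[of x y z] lie_bracket_antisym[of z "lie_bracket x y"]
  have "lie_bracket x (lie_bracket y z) + lie_bracket (lie_bracket x z) y -
      lie_bracket (lie_bracket x y) z = 0"
    by simp
  then show ?thesis
    by (simp only: diff_eq_eq eq_diff_eq add_0_left)
qed

definition left_normed :: "nat \<Rightarrow> nat list \<Rightarrow> lie_monomial" where
  "left_normed r as = foldl (\<lambda>t b. Bracket t (Var b)) (Var r) as"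

lemma left_normed_simps:
  "left_normed r [] = Var r" "left_normed r (as @ [b]) = Bracket (left_normed r as) (Var b)"
  by (simp_all add: left_normed_def)

lemma variables_left_normed: "variables (left_normed r as) = r # as"
  by (induction as rule: rev_induct) (simp_all add: left_normed_simps)

definition left_normed_span :: "nat \<Rightarrow> nat multiset \<Rightarrow> free_lie set" where
  "left_normed_span r X = rat_vector.span {lie_vec (left_normed r as) |as. mset as = X}"

lemma subspace_left_normed_span: "rat_vector.subspace (left_normed_span r X)"
  by (simp add: left_normed_span_def)

text \<open>
  The Jacobi identity in the form \<open>[x, [s, t]] = [[x, s], t] - [[x, t], s]\<close> straightens every bracket.
\<close>

lemma left_normed_span_bracket:
  "x \<in> left_normed_span r X \<Longrightarrow>
   lie_bracket x (lie_vec t) \<in> left_normed_span r (X + mset (variables t))"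
proof (induction t arbitrary: x X)
  case (Var b)
  show ?case
  proof (rule qlinear_span_image[OF qlinear_lie_bracket(1) _ subspace_left_normed_span
        Var[unfolded left_normed_span_def]])
    fix y assume "y \<in> {lie_vec (left_normed r as) |as. mset as = X}"
    then obtain as where "y = lie_vec (left_normed r as)" "mset as = X" by blast
    then have "lie_bracket y (lie_vec (Var b)) = lie_vec (left_normed r (as @ [b]))"
      "mset (as @ [b]) = X + mset (variables (Var b))"
      by (simp_all add: lie_bracket_vec left_normed_simps)
    then show "lie_bracket y (lie_vec (Var b)) \<in> left_normed_span r (X + mset (variables (Var b)))"
      unfolding left_normed_span_def by (intro rat_vector.span_base) blast
  qed
next
  case (Bracket s t)
  have "lie_bracket x (lie_vec (Bracket s t)) =
      lie_bracket (lie_bracket x (lie_vec s)) (lie_vec t) -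
      lie_bracket (lie_bracket x (lie_vec t)) (lie_vec s)"
    by (simp only: lie_bracket_vec[symmetric] lie_bracket_bracket)
  moreover have "lie_bracket (lie_bracket x (lie_vec s)) (lie_vec t) \<in>
      left_normed_span r (X + mset (variables (Bracket s t)))"
    using Bracket.IH(2)[OF Bracket.IH(1)[OF Bracket.prems]] by (simp add: add.assoc)
  moreover have "lie_bracket (lie_bracket x (lie_vec t)) (lie_vec s) \<in>
      left_normed_span r (X + mset (variables (Bracket s t)))"
    using Bracket.IH(1)[OF Bracket.IH(2)[OF Bracket.prems]]
    by (simp add: add.assoc add.commute[of "mset (variables s)"])
  ultimately show ?case
    using rat_vector.subspace_diff[OF subspace_left_normed_span] by simp
qed

lemma lie_vec_in_left_normed_span:
  "r \<in> set (variables t) \<Longrightarrow> lie_vec t \<in> left_normed_span r (mset (variables t) - {#r#})"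
proof (induction t)
  case (Var i)
  then have "lie_vec (Var i) = lie_vec (left_normed r [])" by (simp add: left_normed_simps)
  with Var show ?case unfolding left_normed_span_def by (intro rat_vector.span_base) auto
next
  case (Bracket s t)
  show ?case
  proof (cases "r \<in> set (variables s)")
    case True
    from left_normed_span_bracket[OF Bracket.IH(1)[OF True], of t] True show ?thesis
      by (simp add: lie_bracket_vec)
  next
    case False
    then have t: "r \<in> set (variables t)" using Bracket.prems by simp
    from left_normed_span_bracket[OF Bracket.IH(2)[OF t], of s] t
    have "lie_bracket (lie_vec t) (lie_vec s) \<in>
        left_normed_span r (mset (variables (Bracket s t)) - {#r#})"
      by (simp add: add.commute)
    then have "- lie_bracket (lie_vec t) (lie_vec s) \<in>
        left_normed_span r (mset (variables (Bracket s t)) - {#r#})"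
      by (rule rat_vector.subspace_neg[OF subspace_left_normed_span])
    moreover have "lie_vec (Bracket s t) = - lie_bracket (lie_vec t) (lie_vec s)"
      unfolding lie_bracket_vec[of s t, symmetric] by (rule lie_bracket_antisym)
    ultimately show ?thesis by simp
  qed
qed

lemma Lie_span_left_normed:
  "Lie (n + 1) = rat_vector.span {lie_vec (left_normed (n + 1) as) |as. as \<in> perms n}"
  (is "_ = rat_vector.span ?B")
proof
  show "Lie (n + 1) \<subseteq> rat_vector.span ?B"
    unfolding Lie_def
  proof (rule rat_vector.span_minimal, rule subsetI)
    fix x assume "x \<in> lie_vec ` {a. variables a \<in> perms (n + 1)}"
    then obtain t where t: "x = lie_vec t" "variables t \<in> perms (n + 1)" by blast
    have root: "n + 1 \<in> set (variables t)" using permsD[OF t(2)] by simp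
    have "as \<in> perms n" if "mset as = mset (variables t) - {#n + 1#}" for as
    proof -
      have "mset (as @ [n + 1]) = mset (variables t)" using that root by simp
      with t(2) have "as @ [n + 1] \<in> perms (n + 1)" using mset_eq_perms by blast
      then show ?thesis by (simp only: perms_snoc)
    qed
    then have "left_normed_span (n + 1) (mset (variables t) - {#n + 1#}) \<subseteq> rat_vector.span ?B"
      unfolding left_normed_span_def by (intro rat_vector.span_mono) blast
    with lie_vec_in_left_normed_span[OF root] t(1) show "x \<in> rat_vector.span ?B" by blast
  qed simp
  show "rat_vector.span ?B \<subseteq> Lie (n + 1)"
    unfolding Lie_def
  proof (rule rat_vector.span_mono, rule subsetI)
    fix x assume "x \<in> ?B"
    then obtain as where as: "x = lie_vec (left_normed (n + 1) as)" "as \<in> perms n" by blast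
    then have "as @ [n + 1] \<in> perms (n + 1)" by (simp only: perms_snoc)
    then have "variables (left_normed (n + 1) as) \<in> perms (n + 1)"
      using perms_rotate[of as "[n + 1]"] by (simp add: variables_left_normed)
    with as(1) show "x \<in> lie_vec ` {a. variables a \<in> perms (n + 1)}" by blast
  qed
qed

lemma subspace_Lie: "rat_vector.subspace (Lie k)"
  by (simp add: Lie_def)

lemma expand_free_bracket:
  "ext expand (free_bracket p q) = ext expand p * ext expand q - ext expand q * ext expand p"
proof (rule bilinear_eq_on_singles[where F = "\<lambda>p q. ext expand (free_bracket p q)"
      and G = "\<lambda>p q. ext expand p * ext expand q - ext expand q * ext expand p"])
  show "qlinear (\<lambda>p. ext expand (free_bracket p q))" for q
    by (simp add: linear_on_def free_bracket_add free_bracket_scale ext_add ext_scale)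
  show "qlinear (\<lambda>q. ext expand (free_bracket p q))" for p
    by (simp add: linear_on_def free_bracket_add free_bracket_scale ext_add ext_scale)
  show "qlinear (\<lambda>p. ext expand p * ext expand q - ext expand q * ext expand p)" for q
    by (simp add: linear_on_def ext_add ext_scale algebra_simps qlinear_scale[OF qlinear_mult(1)]
        qlinear_scale[OF qlinear_mult(2)] rat_vector.scale_right_diff_distrib)
  show "qlinear (\<lambda>q. ext expand p * ext expand q - ext expand q * ext expand p)" for p
    by (simp add: linear_on_def ext_add ext_scale algebra_simps qlinear_scale[OF qlinear_mult(1)]
        qlinear_scale[OF qlinear_mult(2)] rat_vector.scale_right_diff_distrib)
qed (simp add: free_bracket_single ext_single scaleQ_one)

lemma expand_lie_ideal: "p \<in> lie_ideal \<Longrightarrow> ext expand p = 0"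
  by (induction rule: lie_ideal.induct)
    (simp_all add: expand_free_bracket ext_add ext_scale ext_zero algebra_simps)

lift_definition assoc :: "free_lie \<Rightarrow> (nat list \<Rightarrow>\<^sub>0 rat)" is "ext expand"
proof -
  fix p q assume "p - q \<in> lie_ideal"
  from expand_lie_ideal[OF this] show "ext expand p = ext expand q" by (simp add: ext_diff)
qed

lemma qlinear_assoc: "qlinear assoc"
proof -
  have "assoc (x + y) = assoc x + assoc y" for x y by transfer (simp add: ext_add)
  moreover have "assoc (c *\<^sub>Q x) = c *\<^sub>Q assoc x" for c x by transfer (simp add: ext_scale)
  ultimately show ?thesis by (simp add: linear_on_def)
qed

lemma assoc_vec: "assoc (lie_vec t) = expand t"
  by transfer (simp add: ext_single scaleQ_one)

definition first_letter :: "nat \<Rightarrow> nat list \<Rightarrow> bool" where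
  "first_letter r w \<longleftrightarrow> (\<exists>as. w = r # as)"

text \<open>
  The expansion of a multilinear left-normed bracket starting with \<open>r\<close> contains exactly one word that begins with
  \<open>r\<close>, namely the bracket without its parentheses. So the bracket can be recovered from its expansion.
\<close>

definition retract :: "nat \<Rightarrow> (nat list \<Rightarrow>\<^sub>0 rat) \<Rightarrow> free_lie" where
  "retract r = ext (\<lambda>w. if first_letter r w then lie_vec (left_normed r (tl w)) else 0)"

lemma expand_left_normed_first:
  "r \<notin> set as \<Longrightarrow>
   ext (\<lambda>w. if first_letter r w then word_vec w else 0) (expand (left_normed r as)) =
     word_vec (r # as)"
proof (induction as rule: rev_induct)
  case Nil
  then show ?case by (simp add: left_normed_simps ext_single scaleQ_one first_letter_def)
next
  case (snoc b as)
  let ?P = "ext (\<lambda>w. if first_letter r w then word_vec w else 0)"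
  let ?p = "expand (left_normed r as)"
  have "?P (?p * word_vec [b]) =
      ext (\<lambda>u. (if first_letter r u then word_vec u else 0) * word_vec [b]) ?p"
    unfolding ext_mult_word_vec
  proof (rule ext_cong)
    fix u assume "u \<in> keys ?p"
    then have "u \<noteq> []" using keys_expand[of u "left_normed r as"] by (auto simp: variables_left_normed)
    then show "(if first_letter r (u @ [b]) then word_vec (u @ [b]) else 0) =
        (if first_letter r u then word_vec u else 0) * word_vec [b]"
      by (cases u) (auto simp: first_letter_def word_vec_mult)
  qed
  also have "\<dots> = ?P ?p * word_vec [b]"
    by (rule qlinear_ext_comp[OF qlinear_mult(1), symmetric])
  finally have 1: "?P (?p * word_vec [b]) = word_vec (r # as @ [b])"
    using snoc by (simp add: word_vec_mult)
  have "?P (word_vec [b] * ?p) = ext (\<lambda>u. ?P (word_vec [b] * word_vec u)) ?p"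
    by (rule qlinear_eq_ext[OF qlinear_compose[OF qlinear_ext qlinear_mult(2)]])
  also have "\<dots> = 0"
    using snoc.prems by (simp add: word_vec_mult ext_single first_letter_def) (simp add: ext_def)
  finally show ?case
    using 1 by (simp add: left_normed_simps ext_diff)
qed

text \<open>
  In particular the multilinear part of the free Lie algebra embeds into the free associative
  algebra.
\<close>

lemma retract_assoc:
  assumes "x \<in> Lie (n + 1)"
  shows "retract (n + 1) (assoc x) = x"
proof (rule qlinear_eq_on_span[OF qlinear_compose[OF _ qlinear_assoc] qlinear_id
      assms[unfolded Lie_span_left_normed]])
  show "qlinear (retract (n + 1))" by (simp add: retract_def qlinear_ext)
  fix b assume "b \<in> {lie_vec (left_normed (n + 1) as) |as. as \<in> perms n}"
  then obtain as where b: "b = lie_vec (left_normed (n + 1) as)" "as \<in> perms n" by blast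
  let ?r = "n + 1"
  have "?r \<notin> set as" using permsD[OF b(2)] by simp
  have split: "retract ?r p = retract ?r (ext (\<lambda>w. if first_letter ?r w then word_vec w else 0) p)"
    for p
    unfolding retract_def qlinear_ext_comp[OF qlinear_ext]
    by (rule ext_cong) (simp add: ext_single scaleQ_one ext_zero)
  have "retract ?r (assoc b) = retract ?r (word_vec (?r # as))"
    unfolding b(1) assoc_vec
    using split[of "expand (left_normed ?r as)"] expand_left_normed_first[OF \<open>?r \<notin> set as\<close>] by simp
  also have "\<dots> = b"
    by (simp add: retract_def ext_single scaleQ_one first_letter_def b(1))
  finally show "retract ?r (assoc b) = b" .
qed

lemma assoc_Lie_action: "assoc (Lie_action \<sigma> x) = relabel \<sigma> (assoc x)"
proof transfer
  fix \<sigma> p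
  have "free_rename \<sigma> p = ext (\<lambda>a. single (rename \<sigma> a) 1) p" for p
    by (simp add: free_rename_def ext_def scaleQ_rat_def flip: single_scaleQ)
  then show "ext expand (free_rename \<sigma> p) = relabel \<sigma> (ext expand p)"
    by (simp add: qlinear_ext_comp[OF qlinear_ext] ext_single scaleQ_one expand_rename relabel_def)
qed

lemma qlinear_Lie_action: "qlinear (Lie_action \<sigma>)"
proof -
  have "Lie_action \<sigma> (x + y) = Lie_action \<sigma> x + Lie_action \<sigma> y" for x y
    by transfer (simp add: free_rename_add lie_ideal.zero)
  moreover have "Lie_action \<sigma> (c *\<^sub>Q x) = c *\<^sub>Q Lie_action \<sigma> x" for c x
    by transfer (simp add: free_rename_scale lie_ideal.zero)
  ultimately show ?thesis by (simp add: linear_on_def)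
qed

lemma Lie_action_vec: "Lie_action \<sigma> (lie_vec t) = lie_vec (rename \<sigma> t)"
  by transfer (simp add: free_rename_single lie_ideal.zero)

lemma sym_rep_Lie: "sym_rep k (Lie k) Lie_action"
  unfolding sym_rep_def
proof (intro conjI allI impI ballI)
  show "rat_vector.subspace (Lie k)" by (rule subspace_Lie)
next
  fix \<sigma> v assume \<sigma>: "\<sigma> permutes {1..k}"
  show "linear_on (Lie k) (Lie_action \<sigma>)" by (rule qlinear_imp_linear_on[OF qlinear_Lie_action])
  assume v: "v \<in> Lie k"
  show "Lie_action \<sigma> v \<in> Lie k"
  proof (rule qlinear_span_image[OF qlinear_Lie_action _ subspace_Lie v[unfolded Lie_def]])
    fix x assume "x \<in> lie_vec ` {a. variables a \<in> perms k}"
    then obtain t where "x = lie_vec t" "variables t \<in> perms k" by blast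
    then show "Lie_action \<sigma> x \<in> Lie k"
      using map_perms[OF \<sigma>]
      by (auto simp: Lie_action_vec Lie_def variables_rename intro!: rat_vector.span_base imageI)
  qed
next
  fix v assume "v \<in> Lie k"
  have "rename id t = t" for t by (induction t) auto
  then show "Lie_action id v = v"
    by (intro qlinear_eq_on_span[OF qlinear_Lie_action qlinear_id \<open>v \<in> Lie k\<close>[unfolded Lie_def]])
      (auto simp: Lie_action_vec)
next
  fix \<sigma> \<pi> v assume "v \<in> Lie k"
  then show "Lie_action (\<sigma> \<circ> \<pi>) v = Lie_action \<sigma> (Lie_action \<pi> v)"
    by (intro qlinear_eq_on_span[OF qlinear_Lie_action
          qlinear_compose[OF qlinear_Lie_action qlinear_Lie_action]
          \<open>v \<in> Lie k\<close>[unfolded Lie_def]])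
      (auto simp: Lie_action_vec rename_rename comp_def)
qed

section \<open>The comparison map\<close>

text \<open>
  The cyclic word \<open>W\<close> is opened at \<open>a\<close>, say as \<open>a u\<close>, and gives the commutator \<open>a u - u a\<close>.
\<close>

definition cyclic_commutator :: "nat \<Rightarrow> nat list \<Rightarrow> (nat list \<Rightarrow>\<^sub>0 rat)" where
  "cyclic_commutator a W = (if distinct W \<and> a \<in> set W
     then word_vec (a # cut a W) - word_vec (cut a W @ [a]) else 0)"

lemma cyclic_commutator_rotate: "cyclic_commutator a (X @ Y) = cyclic_commutator a (Y @ X)"
  using cut_rotate[of X Y a] by (auto simp: cyclic_commutator_def)

text \<open>
  The map \<open>f\<^sub>a - f\<^sub>b \<mapsto> [a, u] - [b, v]\<close> for a cyclic word that reads \<open>a u\<close> from \<open>a\<close> on and \<open>b v\<close> from \<open>b\<close>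
  on.
\<close>

definition comparison :: "nat \<Rightarrow> (nat list \<Rightarrow>\<^sub>0 dias) \<Rightarrow> (nat list \<Rightarrow>\<^sub>0 rat)" where
  "comparison n = pointed_ext n (\<lambda>w a. cyclic_commutator a (w @ [n + 1]) -
     cyclic_commutator (n + 1) (w @ [n + 1]))"

lemma qlinear_comparison: "qlinear (comparison n)"
  by (simp add: comparison_def qlinear_pointed_ext)

lemma comparison_marked:
  assumes "W \<in> perms (n + 1)" "a \<in> {1..n + 1}"
  shows "comparison n (marked W a) = cyclic_commutator a W - cyclic_commutator (n + 1) W"
proof -
  obtain X Y where W: "W = X @ (n + 1) # Y" "Y @ X \<in> perms n"
    "marked W a = pointed_word n (Y @ X) a"
    using cyclic_perms_cases[OF assms(1)] by metis
  have rot: "cyclic_commutator b W = cyclic_commutator b ((Y @ X) @ [n + 1])" for b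
    using cyclic_commutator_rotate[of b "X @ [n + 1]" Y] W by simp
  show ?thesis
  proof (cases "a = n + 1")
    case True
    with W show ?thesis by (simp add: pointed_word_absent qlinear_zero[OF qlinear_comparison])
  next
    case False
    then have "a \<in> {1..n}" using assms(2) by auto
    then show ?thesis
      unfolding W(3) rot comparison_def by (rule pointed_ext_pointed[OF W(2)])
  qed
qed

lemma map_cut:
  assumes "a \<in> set W" "inj \<sigma>"
  shows "cut (\<sigma> a) (map \<sigma> W) = map \<sigma> (cut a W)"
proof -
  obtain X Y where W: "W = X @ a # Y" "a \<notin> set X" using split_list_first[OF assms(1)] by blast
  then have "\<sigma> a \<notin> set (map \<sigma> X)" using assms(2) by (auto dest: injD)
  from cut_split[OF this, of "map \<sigma> Y"] cut_split[OF W(2), of Y] show ?thesis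
    unfolding W(1) by simp
qed

lemma relabel_commutator:
  assumes "inj \<sigma>"
  shows "relabel \<sigma> (cyclic_commutator a W) = cyclic_commutator (\<sigma> a) (map \<sigma> W)"
proof (cases "distinct W \<and> a \<in> set W")
  case True
  moreover have "distinct (map \<sigma> W)"
    using True inj_on_subset[OF assms subset_UNIV] by (simp add: distinct_map)
  ultimately show ?thesis
    using map_cut[OF _ assms, of a W]
    by (simp add: cyclic_commutator_def relabel_def ext_diff ext_single scaleQ_one)
next
  case False
  then have "\<not> (distinct (map \<sigma> W) \<and> \<sigma> a \<in> set (map \<sigma> W))"
    using assms by (auto simp: distinct_map dest: injD)
  with False show ?thesis
    by (auto simp: cyclic_commutator_def relabel_def ext_zero)
qed

lemma qlinear_relabel: "qlinear (relabel \<sigma>)"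
  by (simp add: relabel_def qlinear_ext)

lemma comparison_equivariant:
  assumes \<sigma>: "\<sigma> permutes {1..n + 1}" and x: "x \<in> component SymDias n"
  shows "comparison n (cyclic_act n \<sigma> x) = relabel \<sigma> (comparison n x)"
proof (rule qlinear_eq_on_span[OF qlinear_compose[OF qlinear_comparison qlinear_cyclic_act]
      qlinear_compose[OF qlinear_relabel qlinear_comparison] x[unfolded SymDias_marked_span]])
  fix y assume "y \<in> {marked W a |W a. W \<in> perms (n + 1) \<and> a \<in> {1..n + 1}}"
  then obtain W a where y: "y = marked W a" and W: "W \<in> perms (n + 1)" and a: "a \<in> {1..n + 1}"
    by blast
  have \<sigma>W: "map \<sigma> W \<in> perms (n + 1)" by (rule map_perms[OF \<sigma> W])
  have \<sigma>a: "\<sigma> a \<in> {1..n + 1}" "\<sigma> (n + 1) \<in> {1..n + 1}"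
    using permutes_in_image[OF \<sigma>] a by (blast, simp)
  show "comparison n (cyclic_act n \<sigma> y) = relabel \<sigma> (comparison n y)"
    unfolding y
    by (simp only: cyclic_act_marked[OF W a] comparison_marked[OF W a]
        qlinear_diff[OF qlinear_comparison] comparison_marked[OF \<sigma>W \<sigma>a(1)]
        comparison_marked[OF \<sigma>W \<sigma>a(2)] qlinear_diff[OF qlinear_relabel]
        relabel_commutator[OF permutes_inj[OF \<sigma>]]) simp
qed

text \<open>
  A left inverse of the comparison map. Let \<open>e\<^sub>k = f\<^sub>k - f\<^sub>0\<close> and let \<open>R\<^sub>j\<close> be the rotation of a cyclic word
  that starts with its \<open>j\<close>-th letter, the root having index \<open>0\<close>. As the comparison map sends \<open>e\<^sub>k\<close> to
  \<open>(R\<^sub>k - R\<^sub>k\<^sub>+\<^sub>1) - (R\<^sub>0 - R\<^sub>1)\<close>, one sums up: \<open>R\<^sub>j\<close> goes to \<open>(j / (n + 1)) (e\<^sub>1 + \<dots> + e\<^sub>n) - (e\<^sub>1 + \<dots> + e\<^sub>j\<^sub>-\<^sub>1)\<close>.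
  The first term makes the value periodic in \<open>j\<close> and cancels in the difference above.
\<close>

definition unroot_word :: "nat \<Rightarrow> nat list \<Rightarrow> (nat list \<Rightarrow>\<^sub>0 dias)" where
  "unroot_word n U = (let w = cut (n + 1) U; Z = tl (dropWhile (\<lambda>b. b \<noteq> n + 1) U) in
     (of_nat (length Z + 1) / of_nat (n + 1)) *\<^sub>Q (\<Sum>a\<in>{1..n}. pointed_word n w a) -
     (\<Sum>a\<in>set Z. pointed_word n w a))"

lemma unroot_word_split:
  assumes "n + 1 \<notin> set Y"
  shows "unroot_word n (Y @ (n + 1) # Z) =
    (of_nat (length Z + 1) / of_nat (n + 1)) *\<^sub>Q (\<Sum>a\<in>{1..n}. pointed_word n (Z @ Y) a) -
     (\<Sum>a\<in>set Z. pointed_word n (Z @ Y) a)"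
proof -
  have "dropWhile (\<lambda>b. b \<noteq> n + 1) (Y @ (n + 1) # Z) = (n + 1) # Z"
    using assms by (induction Y) auto
  then show ?thesis
    using cut_split[OF assms, of Z] by (simp add: unroot_word_def Let_def)
qed

lemma unroot_comparison:
  assumes "x \<in> component SymDias n"
  shows "ext (unroot_word n) (comparison n x) = x"
proof (rule qlinear_eq_on_span[OF qlinear_compose[OF qlinear_ext qlinear_comparison] qlinear_id
      assms[unfolded SymDias_span]])
  fix y assume "y \<in> pointed_words n"
  then obtain w a where y: "y = pointed_word n w a" and w: "w \<in> perms n" and a: "a \<in> {1..n}"
    by (rule pointed_word_cases)
  have d: "distinct w" "set w = {1..n}" "length w = n" using permsD[OF w] by auto
  let ?N = "n + 1" and ?S = "\<Sum>a\<in>{1..n}. pointed_word n w a"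
  let ?c = "\<lambda>k. (of_nat k / of_nat (n + 1)) *\<^sub>Q ?S"
  obtain X Y where xy: "w = X @ a # Y" using a d by (metis split_list)
  have notin: "?N \<notin> set w" "?N \<notin> set X" "?N \<notin> set Y" "?N \<noteq> a" "a \<notin> set X"
  proof -
    show "?N \<notin> set w" "?N \<noteq> a" using d(2) a by auto
    with xy d(1) show "?N \<notin> set X" "?N \<notin> set Y" "a \<notin> set X" by auto
  qed
  have W: "w @ [?N] \<in> perms (n + 1)" using w by (simp only: perms_snoc)
  have c_add: "?c (k + l) = ?c k + ?c l" for k l
    by (simp only: of_nat_add add_divide_distrib scaleQ_add_left)
  have "cyclic_commutator a (w @ [?N]) =
      word_vec ((a # Y) @ ?N # X) - word_vec (Y @ ?N # (X @ [a]))"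
  proof -
    have "cut a (w @ [?N]) = (Y @ [?N]) @ X"
      using cut_split[of a X "Y @ [?N]"] notin xy by simp
    moreover have "distinct (w @ [?N])" "a \<in> set (w @ [?N])" using d a notin by auto
    ultimately show ?thesis by (simp add: cyclic_commutator_def)
  qed
  moreover have "unroot_word n ((a # Y) @ ?N # X) =
      ?c (length X + 1) - (\<Sum>b\<in>set X. pointed_word n w b)"
    using unroot_word_split[of n "a # Y" X] notin xy by simp
  moreover have "unroot_word n (Y @ ?N # (X @ [a])) =
      ?c (length X + 1 + 1) - (pointed_word n w a + (\<Sum>b\<in>set X. pointed_word n w b))"
    using unroot_word_split[of n Y "X @ [a]"] notin xy by simp
  ultimately have 1: "ext (unroot_word n) (cyclic_commutator a (w @ [?N])) =
      pointed_word n w a - ?c 1"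
    by (simp only: ext_diff ext_single scaleQ_one c_add) simp
  have "cyclic_commutator ?N (w @ [?N]) = word_vec ([] @ ?N # w) - word_vec (w @ ?N # [])"
    using cut_split[of ?N w "[]"] notin(1) d by (simp add: cyclic_commutator_def)
  moreover have "unroot_word n ([] @ ?N # w) = ?c (n + 1) - ?S"
    using unroot_word_split[of n "[]" w] d by simp
  moreover have "unroot_word n (w @ ?N # []) = ?c 1"
    using unroot_word_split[of n w "[]"] notin by simp
  moreover have "?c (n + 1) = ?S" by (simp add: scaleQ_one)
  ultimately have 2: "ext (unroot_word n) (cyclic_commutator ?N (w @ [?N])) = - ?c 1"
    by (simp only: ext_diff ext_single scaleQ_one) simp
  have "comparison n y = cyclic_commutator a (w @ [?N]) - cyclic_commutator ?N (w @ [?N])"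
    unfolding y comparison_def by (rule pointed_ext_pointed[OF w a])
  then show "ext (unroot_word n) (comparison n y) = y"
    using 1 2 y by (simp add: ext_diff)
qed

lemma comparison_cyclic_mark:
  assumes "\<And>W. W \<in> keys p \<Longrightarrow> W \<in> perms (n + 1)" "a \<in> {1..n + 1}"
  shows "comparison n (cyclic_mark a p) =
    ext (cyclic_commutator a) p - ext (cyclic_commutator (n + 1)) p"
proof -
  have "comparison n (cyclic_mark a p) =
      ext (\<lambda>W. cyclic_commutator a W - cyclic_commutator (n + 1) W) p"
    unfolding cyclic_mark_def qlinear_ext_comp[OF qlinear_comparison]
    by (intro ext_cong comparison_marked assms)
  then show ?thesis by (simp only: ext_fun_diff)
qed

lemma commutator_root:
  assumes "a # variables B \<in> perms n"
  shows "ext (cyclic_commutator a) (word_vec [a] * expand B) = expand (Bracket (Var a) B)"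
proof -
  have "ext (cyclic_commutator a) (word_vec [a] * expand B) =
      ext (\<lambda>u. ext (cyclic_commutator a) (word_vec [a] * word_vec u)) (expand B)"
    by (rule qlinear_eq_ext[OF qlinear_compose[OF qlinear_ext qlinear_mult(2)]])
  also have "\<dots> = ext (\<lambda>u. word_vec [a] * word_vec u - word_vec u * word_vec [a]) (expand B)"
  proof (rule ext_cong)
    fix u assume "u \<in> keys (expand B)"
    then have "mset (a # u) = mset (a # variables B)" using keys_expand by simp
    then have "a # u \<in> perms n" using assms mset_eq_perms by blast
    then have "distinct (a # u)" using permsD by blast
    then show "ext (cyclic_commutator a) (word_vec [a] * word_vec u) =
        word_vec [a] * word_vec u - word_vec u * word_vec [a]"
      using cut_split[of a "[]" u]
      by (simp add: word_vec_mult ext_single scaleQ_one cyclic_commutator_def)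
  qed
  also have "\<dots> = expand (Bracket (Var a) B)"
  proof -
    have "qlinear (\<lambda>p. word_vec [a] * p - p * word_vec [a])"
      using qlinear_mult[of "word_vec [a]"]
      by (simp add: linear_on_def rat_vector.scale_right_diff_distrib)
    from qlinear_eq_ext[OF this, of "expand B"] show ?thesis by simp
  qed
  finally show ?thesis .
qed

text \<open>
  Moving the root to \<open>a\<close> turns the trace form into words that begin with \<open>a\<close> and continue with a Lie
  element, whose commutator with \<open>a\<close> is again a Lie element.
\<close>

lemma commutator_expand:
  assumes "variables L @ variables r \<in> perms n" "a \<in> {1..n}"
  obtains B where "a # variables B \<in> perms n"
    "ext (cyclic_commutator a) (expand L * expand r) = expand (Bracket (Var a) B)"
proof -
  have *: "\<exists>B. a # variables B \<in> perms n \<and>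
      ext (cyclic_commutator a) (expand L * expand r) = expand (Bracket (Var a) B)"
    if L: "variables L @ variables r \<in> perms n" "a \<in> set (variables L)" for L r
    using commutator_root[OF perms_reroot[OF L]] perms_reroot[OF L]
      reroot_trace[of "cyclic_commutator a", OF cyclic_commutator_rotate L(2), of r]
    by metis
  have "a \<in> set (variables L @ variables r)" using permsD[OF assms(1)] assms(2) by simp
  then consider "a \<in> set (variables L)" | "a \<in> set (variables r)" by auto
  then show ?thesis
  proof cases
    case 1
    then show ?thesis using *[OF assms(1)] that by blast
  next
    case 2
    moreover have "variables r @ variables L \<in> perms n" using assms(1) by (simp only: perms_rotate)
    ultimately show ?thesis
      using *[of r L] that ext_trace[of "cyclic_commutator a", OF cyclic_commutator_rotate]
      by metis
  qed
qed

lemma lie_vec_in_Lie: "a # variables B \<in> perms k \<Longrightarrow> lie_vec (Bracket (Var a) B) \<in> Lie k"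
  by (auto simp: Lie_def intro!: rat_vector.span_base imageI)

lemma comparison_in_assoc_Lie:
  assumes "x \<in> rat_vector.span (marked_monomials n)"
  shows "comparison n x \<in> assoc ` Lie (n + 1)"
proof (rule qlinear_span_image[OF qlinear_comparison _ _ assms])
  show "rat_vector.subspace (assoc ` Lie (n + 1))"
    unfolding rat_vector.subspace_def
  proof (intro conjI ballI allI)
    show "0 \<in> assoc ` Lie (n + 1)"
      using rat_vector.subspace_0[OF subspace_Lie] qlinear_zero[OF qlinear_assoc]
      by (metis imageI)
    show "x + y \<in> assoc ` Lie (n + 1)" if "x \<in> assoc ` Lie (n + 1)" "y \<in> assoc ` Lie (n + 1)" for x y
      using that rat_vector.subspace_add[OF subspace_Lie]
      by (auto simp flip: qlinear_add[OF qlinear_assoc])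
    show "c *\<^sub>Q x \<in> assoc ` Lie (n + 1)" if "x \<in> assoc ` Lie (n + 1)" for c x
      using that rat_vector.subspace_scale[OF subspace_Lie]
      by (auto simp flip: qlinear_scale[OF qlinear_assoc])
  qed
  fix y assume "y \<in> marked_monomials n"
  then obtain L a where y: "y = marked_monomial n L a" and L: "variables L \<in> perms n" and a: "a \<in> {1..n}"
    by (rule marked_monomial_cases)
  let ?p = "expand L * expand (Var (n + 1))"
  have LN: "variables L @ variables (Var (n + 1)) \<in> perms (n + 1)"
    using L by (simp only: variables.simps perms_snoc)
  have a': "a \<in> {1..n + 1}" "n + 1 \<in> {1..n + 1}" using a by auto
  obtain B where B: "a # variables B \<in> perms (n + 1)"
    "ext (cyclic_commutator a) ?p = expand (Bracket (Var a) B)"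
    by (rule commutator_expand[OF LN a'(1)])
  obtain C where C: "(n + 1) # variables C \<in> perms (n + 1)"
    "ext (cyclic_commutator (n + 1)) ?p = expand (Bracket (Var (n + 1)) C)"
    by (rule commutator_expand[OF LN a'(2)])
  have "y = cyclic_mark a ?p"
    unfolding y using marked_monomial_cyclic[OF L] by simp
  then have "comparison n y = ext (cyclic_commutator a) ?p - ext (cyclic_commutator (n + 1)) ?p"
    using comparison_cyclic_mark[OF keys_expand_mult[OF LN] a'(1)] by simp
  also have "\<dots> = assoc (lie_vec (Bracket (Var a) B) - lie_vec (Bracket (Var (n + 1)) C))"
    by (simp only: B(2) C(2) qlinear_diff[OF qlinear_assoc] assoc_vec)
  finally show "comparison n y \<in> assoc ` Lie (n + 1)"
    using rat_vector.subspace_diff[OF subspace_Lie lie_vec_in_Lie[OF B(1)] lie_vec_in_Lie[OF C(1)]]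
    by blast
qed

text \<open>
  The commutators at consecutive letters telescope around the cyclic word.
\<close>

lemma sum_cyclic_commutator:
  assumes "distinct W"
  shows "(\<Sum>b\<in>set W. cyclic_commutator b W) = 0"
proof -
  have at: "cyclic_commutator (W ! j) W = word_vec (rotate j W) - word_vec (rotate (Suc j) W)"
    if j: "j < length W" for j
  proof -
    let ?X = "take j W" and ?Y = "drop (Suc j) W"
    have W: "W = ?X @ W ! j # ?Y" by (rule id_take_nth_drop[OF j])
    then have "W ! j \<notin> set ?X" using assms by (metis distinct_append disjoint_iff list.set_intros(1))
    then have c: "cut (W ! j) W = ?Y @ ?X" using W cut_split by metis
    have "rotate j W = (W ! j # ?Y) @ ?X"
      using j by (simp add: rotate_drop_take Cons_nth_drop_Suc)
    then show ?thesis
      using c assms j by (simp add: cyclic_commutator_def)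
  qed
  have "(\<Sum>b\<in>set W. cyclic_commutator b W) = (\<Sum>j<length W. cyclic_commutator (W ! j) W)"
    using bij_betw_nth[OF assms refl refl]
    by (intro sum.reindex_bij_betw[symmetric]) auto
  also have "\<dots> = (\<Sum>j<length W. word_vec (rotate j W) - word_vec (rotate (Suc j) W))"
    by (rule sum.cong) (simp_all add: at del: rotate_Suc)
  also have "\<dots> = word_vec (rotate 0 W) - word_vec (rotate (length W) W)"
    by (rule sum_lessThan_telescope')
  finally show ?thesis by simp
qed

text \<open>
  Let \<open>T\<^sub>a\<close> be the trace form of \<open>b\<close> and \<open>B\<close> marked at \<open>a\<close>. Since the commutators at all letters sum to zero,
  \<open>\<Sum>\<^sub>a (T\<^sub>b - T\<^sub>a)\<close> is sent to \<open>(n + 1) [b, B]\<close>, and brackets of this form span the multilinear part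
  of the free Lie algebra.
\<close>

lemma Lie_in_comparison:
  assumes n: "1 \<le> n" and x: "x \<in> Lie (n + 1)"
  shows "\<exists>y\<in>rat_vector.span (marked_monomials n). comparison n y = assoc x"
  using x unfolding Lie_span_left_normed
proof (induction rule: rat_vector.span_induct_alt)
  case base
  show ?case
    using rat_vector.span_zero qlinear_zero[OF qlinear_comparison] qlinear_zero[OF qlinear_assoc]
    by metis
next
  case (step c x z)
  then obtain as where as: "x = lie_vec (left_normed (n + 1) as)" "as \<in> perms n" by blast
  have "as \<noteq> []" using permsD[OF as(2)] n by auto
  then obtain bs b where bs: "as = bs @ [b]" by (metis rev_exhaust)
  let ?B = "left_normed (n + 1) bs"
  have x: "x = - lie_vec (Bracket (Var b) ?B)"
    unfolding as(1) bs left_normed_simps lie_bracket_vec[symmetric] by (rule lie_bracket_antisym)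
  have "as @ [n + 1] \<in> perms (n + 1)" using as(2) by (simp only: perms_snoc)
  then have bB: "b # variables ?B \<in> perms (n + 1)"
    using mset_eq_perms[of "b # variables ?B" "as @ [n + 1]"] bs
    by (simp add: variables_left_normed add_mset_commute)
  then have LN: "variables (Var b) @ variables ?B \<in> perms (n + 1)" by simp
  have b: "b \<in> {1..n + 1}" using permsD[OF bB] by auto
  let ?p = "expand (Var b) * expand ?B"
  \<comment> \<open>a preimage of \<open>(n + 1) [b, B]\<close>\<close>
  define t where "t = (\<Sum>a\<in>{1..n + 1}. cyclic_mark b ?p - cyclic_mark a ?p)"
  have t: "t \<in> rat_vector.span (marked_monomials n)"
    unfolding t_def
    by (intro rat_vector.span_sum rat_vector.span_diff cyclic_mark_Leib[OF LN] b)
  have "comparison n t = (\<Sum>a\<in>{1..n + 1}. comparison n (cyclic_mark b ?p) - comparison n (cyclic_mark a ?p))"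
    by (simp only: t_def qlinear_sum[OF qlinear_comparison] qlinear_diff[OF qlinear_comparison])
  also have "\<dots> = (\<Sum>a\<in>{1..n + 1}. ext (cyclic_commutator b) ?p - ext (cyclic_commutator a) ?p)"
    using comparison_cyclic_mark[OF keys_expand_mult[OF LN]] b by (intro sum.cong) auto
  also have "\<dots> = of_nat (n + 1) *\<^sub>Q ext (cyclic_commutator b) ?p -
      (\<Sum>a\<in>{1..n + 1}. ext (cyclic_commutator a) ?p)"
    unfolding sum_subtractf by (simp only: rat_vector.sum_constant_scale) simp
  also have "(\<Sum>a\<in>{1..n + 1}. ext (cyclic_commutator a) ?p) = 0"
  proof -
    have "(\<Sum>a\<in>{1..n + 1}. ext (cyclic_commutator a) ?p) =
        ext (\<lambda>W. \<Sum>a\<in>{1..n + 1}. cyclic_commutator a W) ?p"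
      by (rule ext_fun_sum[symmetric])
    also have "\<dots> = ext (\<lambda>W. 0) ?p"
    proof (rule ext_cong)
      fix W assume "W \<in> keys ?p"
      then have "W \<in> perms (n + 1)" by (rule keys_expand_mult[OF LN])
      then show "(\<Sum>a\<in>{1..n + 1}. cyclic_commutator a W) = 0"
        using permsD[of W "n + 1"] sum_cyclic_commutator[of W] by simp
    qed
    finally show ?thesis by (simp add: ext_def)
  qed
  also have "ext (cyclic_commutator b) ?p = - assoc x"
    using commutator_root[OF bB] by (simp add: x qlinear_uminus[OF qlinear_assoc] assoc_vec)
  finally have t_eq: "comparison n t = of_nat (n + 1) *\<^sub>Q (- assoc x)" by simp
  obtain z' where z': "z' \<in> rat_vector.span (marked_monomials n)" "comparison n z' = assoc z"
    using step by blast
  let ?y = "(- c / of_nat (n + 1)) *\<^sub>Q t + z'"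
  have "comparison n ?y = c *\<^sub>Q assoc x + assoc z"
    unfolding qlinear_add[OF qlinear_comparison] qlinear_scale[OF qlinear_comparison] t_eq z'(2)
    by (simp add: scaleQ_scaleQ)
  then have "comparison n ?y = assoc (c *\<^sub>Q x + z)"
    by (simp add: qlinear_add[OF qlinear_assoc] qlinear_scale[OF qlinear_assoc])
  moreover have "?y \<in> rat_vector.span (marked_monomials n)"
    by (intro rat_vector.span_add rat_vector.span_scale t z')
  ultimately show ?case by blast
qed

theorem theorem5p5:
  fixes n :: nat
  assumes "n \<ge> 1"
  shows "sym_rep_isomorphic (n + 1) (component Leib n) (Leib_action n) (Lie (n + 1)) Lie_action"
proof -
  let ?f = "\<lambda>x. retract (n + 1) (comparison n x)"
  note Leib = component_Leib[OF assms]
  have lin: "qlinear ?f"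
    by (rule qlinear_compose[OF _ qlinear_comparison]) (simp add: retract_def qlinear_ext)
  have image: "?f x \<in> Lie (n + 1)" "assoc (?f x) = comparison n x" if x: "x \<in> component Leib n" for x
  proof -
    obtain y where "y \<in> Lie (n + 1)" "comparison n x = assoc y"
      using comparison_in_assoc_Lie x unfolding Leib by blast
    then show "?f x \<in> Lie (n + 1)" "assoc (?f x) = comparison n x"
      using retract_assoc by simp_all
  qed
  have "bij_betw ?f (component Leib n) (Lie (n + 1))"
    unfolding bij_betw_def
  proof
    show "inj_on ?f (component Leib n)"
    proof (rule inj_onI)
      fix x y assume xy: "x \<in> component Leib n" "y \<in> component Leib n" "?f x = ?f y"
      have unroot: "ext (unroot_word n) (comparison n z) = z" if "z \<in> component Leib n" for z
        by (rule unroot_comparison[OF subsetD[OF Leib_subset[OF assms] that]])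
      have "comparison n x = comparison n y"
        by (rule trans[OF trans[OF image(2)[OF xy(1), symmetric] arg_cong[OF xy(3), of assoc]] image(2)[OF xy(2)]])
      then show "x = y"
        by (metis unroot xy(1,2))
    qed
    show "?f ` component Leib n = Lie (n + 1)"
    proof (intro equalityI subsetI)
      fix y assume y: "y \<in> Lie (n + 1)"
      obtain x where x: "x \<in> component Leib n" "comparison n x = assoc y"
        using Lie_in_comparison[OF assms y] unfolding Leib by blast
      have "y = ?f x" unfolding x(2) retract_assoc[OF y] ..
      then show "y \<in> ?f ` component Leib n" using x(1) by (rule image_eqI)
    next
      fix y assume "y \<in> ?f ` component Leib n"
      then show "y \<in> Lie (n + 1)" using image(1) by (elim imageE) (simp only:)
    qed
  qed
  moreover have "?f (Leib_action n \<sigma> x) = Lie_action \<sigma> (?f x)"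
    if \<sigma>: "\<sigma> permutes {1..n + 1}" and x: "x \<in> component Leib n" for \<sigma> x
  proof -
    have "comparison n (Leib_action n \<sigma> x) = relabel \<sigma> (comparison n x)"
      unfolding Leib_action_eq[OF assms \<sigma> x]
      by (rule comparison_equivariant[OF \<sigma> subsetD[OF Leib_subset[OF assms] x]])
    also have "\<dots> = assoc (Lie_action \<sigma> (?f x))"
      unfolding assoc_Lie_action image(2)[OF x] ..
    moreover have "Lie_action \<sigma> (?f x) \<in> Lie (n + 1)"
      using sym_rep_Lie \<sigma> image(1)[OF x] unfolding sym_rep_def by blast
    ultimately show ?thesis
      using retract_assoc[of "Lie_action \<sigma> (?f x)" n] by simp
  qed
  ultimately show ?thesis
    unfolding sym_rep_isomorphic_def
    using sym_rep_Leib[OF assms] sym_rep_Lie qlinear_imp_linear_on[OF lin] by blast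
qed

end
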